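(* Let $z\in\mathbb{C}$ with $\alpha:=\operatorname{Re}z\ge1$, let $\ell\in\mathbb{N}_0$ with $0\le\ell\le\lfloor\alpha-\tfrac12\rfloor$, let $$H_0(\gamma):=(\cos^2\pi\gamma)^z\sum_{k=0}^{\ell}\binom{z+\ell}{k}(\sin^2\pi\gamma)^k(\cos^2\pi\gamma)^{\ell-k},\qquad\gamma\in\mathbb{R},$$ and let $\varphi$ be the associated refinable function, given by $\widehat{\varphi}(\gamma)=\prod_{m=1}^\infty H_0(2^{-m}\gamma)$, $\gamma\in\mathbb{R}$. Put $$\eta(\gamma):=1-\left(|H_0(\gamma)|^2+|H_0(\gamma+\tfrac12)|^2\right).$$ Let $\sigma$ be a measurable $1$-periodic function on $\mathbb{R}$ such that $|\sigma(\gamma)|^2=\eta(\gamma)$, and define the filters $H_1,H_2,H_3$ by $$H_1(\gamma)=e^{2\pi i\gamma}\,\overline{H_0(\gamma+\tfrac12)},\qquad H_2(\gamma)=\tfrac{1}{\sqrt2}\,\sigma(\gamma),\qquad H_3(\gamma)=\tfrac{1}{\sqrt2}\,e^{2\pi i\gamma}\sigma(\gamma).$$ Then the functions $\psi_1,\psi_2,\psi_3$ given by $$\widehat{\psi_n}(2\gamma)=H_n(\gamma)\,\widehat{\varphi}(\gamma),\qquad n=1,2,3,$$ generate a Parseval frame $\{D^jT_k\psi_n\}_{j,k\in\mathbb{Z},\,n=1,2,3}$ for $L^2(\mathbb{R})$, i.e. $$\sum_{n=1}^3\sum_{j,k\in\mathbb{Z}}|\langle f,D^jT_k\psi_n\rangle|^2=\|f\|^2\qquad\text{for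 all }f\in L^2(\mathbb{R}).$$
   Context: The Fourier transform is normalized as $\widehat{f}(\gamma)=\int_{\mathbb{R}}f(t)e^{-2\pi i t\gamma}\,dt$ (extended to $L^2(\mathbb{R})$). $D$ is the unitary dilation operator $(Df)(x):=\sqrt2\,f(2x)$ and $T_k$ the translation operator $(T_kf)(x):=f(x-k)$, $k\in\mathbb{Z}$, on $L^2(\mathbb{R})$. For complex $w$ and $k\in\mathbb{N}_0$, $\binom{w}{k}:=\frac{\Gamma(w+1)}{\Gamma(k+1)\Gamma(w-k+1)}$. For real $t>0$, $t^z:=e^{z\ln t}$, and $0^z:=0$; $0^0:=1$ for integer powers. The function $\varphi$ (the "complex pseudo-spline of order $(z,\ell)$") satisfies $\widehat{\varphi}(\gamma)=H_0(\gamma/2)\widehat{\varphi}(\gamma/2)$ and is normalized by $\widehat{\varphi}(0)=1$. *)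

theory Defs
  imports "HOL-Analysis.Analysis"
begin

text \<open>Elements of \<open>L\<^sup>2(\<real>)\<close> are represented by Lebesgue measurable functions; two functions that
  agree almost everywhere stand for the same element.\<close>

definition L2 :: "(real \<Rightarrow> complex) set" where
  "L2 = {f. f \<in> borel_measurable lebesgue \<and> integrable lebesgue (\<lambda>x. (cmod (f x))\<^sup>2)}"

definition L2_inner :: "(real \<Rightarrow> complex) \<Rightarrow> (real \<Rightarrow> complex) \<Rightarrow> complex" where
  "L2_inner f g = (LINT x|lebesgue. f x * cnj (g x))"

definition L2_norm :: "(real \<Rightarrow> complex) \<Rightarrow> real" where
  "L2_norm f = sqrt (LINT x|lebesgue. (cmod (f x))\<^sup>2)"

text \<open>Convergence in mean square. The nonnegative integral is used because, unlike the Bochner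
  integral, it does not take the value 0 on functions that fail to be integrable.\<close>

definition L2_tendsto :: "(nat \<Rightarrow> real \<Rightarrow> complex) \<Rightarrow> (real \<Rightarrow> complex) \<Rightarrow> bool" where
  "L2_tendsto F f \<longleftrightarrow> (\<lambda>n. \<integral>\<^sup>+ x. ennreal ((cmod (F n x - f x))\<^sup>2) \<partial>lebesgue) \<longlonglongrightarrow> 0"

definition fourier :: "(real \<Rightarrow> complex) \<Rightarrow> real \<Rightarrow> complex" where
  "fourier f \<gamma> = (LINT t|lebesgue. f t * exp (- 2 * of_real pi * \<i> * of_real t * of_real \<gamma>))"

text \<open>\<open>has_fourier_L2 f g\<close>: the continuous extension of \<^const>\<open>fourier\<close> from \<open>L\<^sup>1 \<inter> L\<^sup>2\<close> to \<open>L\<^sup>2\<close>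
  sends the class of \<open>f\<close> to the class of \<open>g\<close>. It is a relation because \<open>g\<close> is determined only up to
  a null set.\<close>

definition has_fourier_L2 :: "(real \<Rightarrow> complex) \<Rightarrow> (real \<Rightarrow> complex) \<Rightarrow> bool" where
  "has_fourier_L2 f g \<longleftrightarrow> f \<in> L2 \<and> g \<in> L2 \<and>
     (\<exists>F. (\<forall>n. F n \<in> L2 \<and> integrable lebesgue (F n)) \<and>
          L2_tendsto F f \<and> L2_tendsto (\<lambda>n. fourier (F n)) g)"

definition dilation :: "(real \<Rightarrow> complex) \<Rightarrow> (real \<Rightarrow> complex)" where
  "dilation f = (\<lambda>x. of_real (sqrt 2) * f (2 * x))"

definition dilation_pow :: "int \<Rightarrow> (real \<Rightarrow> complex) \<Rightarrow> (real \<Rightarrow> complex)" where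
  "dilation_pow j = (if 0 \<le> j then dilation ^^ nat j else inv dilation ^^ nat (- j))"

definition translation :: "int \<Rightarrow> (real \<Rightarrow> complex) \<Rightarrow> (real \<Rightarrow> complex)" where
  "translation k f = (\<lambda>x. f (x - of_int k))"

lemma inv_dilation: "inv dilation f = (\<lambda>x. of_real (1 / sqrt 2) * f (x / 2))"
proof -
  have "inj dilation"
  proof (rule injI)
    fix f g assume "dilation f = dilation g"
    then have "f (2 * (x / 2)) = g (2 * (x / 2))" for x
      unfolding dilation_def by (metis mult_left_cancel of_real_eq_0_iff real_sqrt_eq_0_iff zero_neq_numeral)
    then show "f = g" by auto
  qed
  moreover have "dilation (\<lambda>x. of_real (1 / sqrt 2) * f (x / 2)) = f"
    by (auto simp: dilation_def simp flip: of_real_mult mult.assoc)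
  ultimately show ?thesis by (metis inv_f_f)
qed

lemma dilation_pow_eq:
  "dilation_pow j f x = of_real (2 powr (of_int j / 2)) * f (2 powr of_int j * x)"
proof -
  have pos: "(dilation ^^ n) f x = of_real (2 powr (real n / 2)) * f (2 powr real n * x)" for n x
  proof (induction n arbitrary: x)
    case (Suc n)
    have "2 powr (real (Suc n) / 2) = sqrt 2 * 2 powr (real n / 2)"
      by (simp add: powr_half_sqrt[symmetric] powr_add[symmetric] add_divide_distrib)
    then show ?case using Suc[of "2 * x"]
      by (simp add: dilation_def powr_add mult_ac)
  qed simp
  have neg: "(inv dilation ^^ n) f x = of_real (2 powr (- real n / 2)) * f (2 powr (- real n) * x)" for n x
  proof (induction n arbitrary: x)
    case (Suc n)
    have e1: "2 powr (- real (Suc n) / 2) = 1 / sqrt 2 * 2 powr (- real n / 2)"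
      by (simp add: powr_half_sqrt[symmetric] powr_add[symmetric] powr_minus_divide[symmetric] diff_divide_distrib)
    have "- real (Suc n) = - real n + - 1" by simp
    then have "2 powr (- real (Suc n)) = 2 powr (- real n) * (2::real) powr (- 1)"
      by (simp only: powr_add)
    then have e2: "2 powr (- real (Suc n)) * x = 2 powr (- real n) * (x / 2)"
      by (simp add: powr_minus)
    show ?case unfolding e1 e2 by (simp add: inv_dilation[of "(inv dilation ^^ n) f"] Suc)
  qed simp
  show ?thesis
    using pos[of "nat j" x] neg[of "nat (- j)" x] by (simp add: dilation_pow_def)
qed

definition parseval_frame :: "'i set \<Rightarrow> ('i \<Rightarrow> real \<Rightarrow> complex) \<Rightarrow> bool" where
  "parseval_frame I e \<longleftrightarrow> (\<forall>i\<in>I. e i \<in> L2) \<and>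
     (\<forall>f\<in>L2. ((\<lambda>i. (cmod (L2_inner f (e i)))\<^sup>2) has_sum (L2_norm f)\<^sup>2) I)"

definition cbinom :: "complex \<Rightarrow> nat \<Rightarrow> complex" where
  "cbinom w k = Gamma (w + 1) / (Gamma (of_nat k + 1) * Gamma (w - of_nat k + 1))"

definition H0 :: "complex \<Rightarrow> nat \<Rightarrow> real \<Rightarrow> complex" where
  "H0 z l \<gamma> = complex_of_real ((cos (pi * \<gamma>))\<^sup>2) powr z *
     (\<Sum>k=0..l. cbinom (z + of_nat l) k * of_real (((sin (pi * \<gamma>))\<^sup>2) ^ k * ((cos (pi * \<gamma>))\<^sup>2) ^ (l - k)))"

text \<open>Products in the library start at index 0, hence the shift \<open>m \<mapsto> Suc m\<close>.\<close>

definition phi_hat :: "complex \<Rightarrow> nat \<Rightarrow> real \<Rightarrow> complex" where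
  "phi_hat z l \<gamma> = (\<Prod>m. H0 z l (\<gamma> / 2 ^ Suc m))"

definition eta :: "complex \<Rightarrow> nat \<Rightarrow> real \<Rightarrow> real" where
  "eta z l \<gamma> = 1 - ((cmod (H0 z l \<gamma>))\<^sup>2 + (cmod (H0 z l (\<gamma> + 1/2)))\<^sup>2)"

text \<open>The filters \<open>H\<^sub>1, H\<^sub>2, H\<^sub>3\<close>; only the indices \<open>n = 1, 2, 3\<close> are meaningful.\<close>

definition H :: "complex \<Rightarrow> nat \<Rightarrow> (real \<Rightarrow> complex) \<Rightarrow> nat \<Rightarrow> real \<Rightarrow> complex" where
  "H z l \<sigma> n \<gamma> =
     (if n = 1 then exp (2 * of_real pi * \<i> * of_real \<gamma>) * cnj (H0 z l (\<gamma> + 1/2))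
      else if n = 2 then of_real (1 / sqrt 2) * \<sigma> \<gamma>
      else of_real (1 / sqrt 2) * exp (2 * of_real pi * \<i> * of_real \<gamma>) * \<sigma> \<gamma>)"

text \<open>The defining relation \<open>\<psi>\<^sub>n-hat(2\<gamma>) = H\<^sub>n(\<gamma>) \<phi>-hat(\<gamma>)\<close>, solved for the value at \<open>\<gamma>\<close>.\<close>

definition psi_hat :: "complex \<Rightarrow> nat \<Rightarrow> (real \<Rightarrow> complex) \<Rightarrow> nat \<Rightarrow> real \<Rightarrow> complex" where
  "psi_hat z l \<sigma> n \<gamma> = H z l \<sigma> n (\<gamma> / 2) * phi_hat z l (\<gamma> / 2)"

end

theory Submission
  imports Defs
begin

text \<open>
  Expanding \<open>f\<close>-hat over the dyadic translates of one generator turns the frame coefficients at a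
  fixed scale into the Fourier coefficients of a 1-periodic function, the bracket product
  \<open>\<Sum>\<^sub>m f-hat(2\<^sup>j(\<gamma> + m)) cnj \<psi>-hat(\<gamma> + m)\<close>. By Parseval's identity the energy at scale \<open>j\<close> is the squared
  norm of that function. The filters satisfy \<open>\<Sum>\<^sub>n |H\<^sub>n(\<gamma>)|\<^sup>2 = 1\<close> and
  \<open>\<Sum>\<^sub>n H\<^sub>n(\<gamma>) cnj (H\<^sub>n(\<gamma> + 1/2)) = 0\<close> over \<open>n = 0,\<dots>,3\<close>, so the energies of \<open>\<phi>, \<psi>\<^sub>1, \<psi>\<^sub>2, \<psi>\<^sub>3\<close> at scale
  \<open>j\<close> add up to the energy of \<open>\<phi>\<close> at scale \<open>j + 1\<close>. The sum over \<open>j\<close> telescopes; the energy of \<open>\<phi>\<close>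
  tends to \<open>\<parallel>f\<parallel>\<^sup>2\<close> at fine scales because \<open>\<phi>\<close>-hat is continuous at 0 with value 1, and to 0 at coarse
  scales because \<open>\<phi>\<close>-hat is square-integrable.

  The inequality \<open>|H\<^sub>0(\<gamma>)|\<^sup>2 + |H\<^sub>0(\<gamma> + 1/2)|\<^sup>2 \<le> 1\<close>, needed throughout, holds because \<open>\<eta> = |\<sigma>|\<^sup>2\<close>.
\<close>

section \<open>Square-integrable functions\<close>

text \<open>The relation between \<open>H0\<close> and its half-shift is only an inequality, so the
  integer translates of \<phi> need be neither orthonormal nor a Riesz sequence. What survives is a
  Bessel bound with constant exactly 1, read off from the partial products of \<phi>-hat. It yields
  square integrability of \<phi>-hat, makes the bracket products meaningful and keeps the energy
  below the squared norm.

  The filter \<sigma> appears twice for the sake of the cross terms. A half-shift turns exp(2 pi i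
  \<gamma>) into its negative. For \<open>H z l \<sigma> 1\<close> this cancels the cross term of
  \<open>H0\<close>; a single \<sigma> would leave its own cross term behind, while the copies with
  and without the exponential cancel each other, and the factor 1/sqrt 2 keeps their joint square at
  \<eta>.

  The generators are given by their transforms alone, so the Fourier transform on L2 must be shown
  to be onto before any \<psi> can be spoken of. Plancherel's theorem is derived from Parseval's
  identity on the circle by periodization, the device that also produces the bracket
  products.\<close>

definition sq_integrable :: "'a measure \<Rightarrow> ('a \<Rightarrow> complex) \<Rightarrow> bool" where
  "sq_integrable M f \<longleftrightarrow> f \<in> borel_measurable M \<and> integrable M (\<lambda>x. (cmod (f x))\<^sup>2)"

text \<open>Squares are kept throughout because energies add. The measure is a parameter since the
  same Hilbert space facts serve on the line, on the unit interval, and on the integers with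
  counting measure, where the fibers \<open>x + \<int>\<close> live.\<close>

definition sq_norm :: "'a measure \<Rightarrow> ('a \<Rightarrow> complex) \<Rightarrow> real" where
  "sq_norm M f = (LINT x|M. (cmod (f x))\<^sup>2)"

lemma cnj_borel_measurable [measurable]: "cnj \<in> borel_measurable borel"
  by (intro borel_measurable_continuous_onI continuous_intros)

definition inner_on :: "'a measure \<Rightarrow> ('a \<Rightarrow> complex) \<Rightarrow> ('a \<Rightarrow> complex) \<Rightarrow> complex" where
  "inner_on M f g = (LINT x|M. f x * cnj (g x))"

lemma sq_integrable_measurable [measurable_dest]: "sq_integrable M f \<Longrightarrow> f \<in> borel_measurable M"
  by (simp add: sq_integrable_def)

lemma sq_integrable_integrable: "sq_integrable M f \<Longrightarrow> integrable M (\<lambda>x. (cmod (f x))\<^sup>2)"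
  by (simp add: sq_integrable_def)

lemma sq_norm_nonneg [simp]: "0 \<le> sq_norm M f"
  by (simp add: sq_norm_def)

lemma nn_integral_sq_norm: "sq_integrable M f \<Longrightarrow> (\<integral>\<^sup>+x. ennreal ((cmod (f x))\<^sup>2) \<partial>M) = ennreal (sq_norm M f)"
  unfolding sq_norm_def by (rule nn_integral_eq_integral[OF sq_integrable_integrable]) auto

lemma sq_integrableI_nn:
  assumes "f \<in> borel_measurable M" "(\<integral>\<^sup>+x. ennreal ((cmod (f x))\<^sup>2) \<partial>M) < \<infinity>"
  shows "sq_integrable M f"
  unfolding sq_integrable_def using assms by (auto intro!: integrableI_bounded)

lemma sq_integrable_bound:
  assumes "sq_integrable M g" "f \<in> borel_measurable M" "\<And>x. cmod (f x) \<le> c * cmod (g x)"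
  shows "sq_integrable M f"
  unfolding sq_integrable_def
proof
  have "integrable M (\<lambda>x. c\<^sup>2 * (cmod (g x))\<^sup>2)"
    using sq_integrable_integrable[OF assms(1)] by simp
  then show "integrable M (\<lambda>x. (cmod (f x))\<^sup>2)"
    by (rule Bochner_Integration.integrable_bound)
      (use assms(2,3) in \<open>auto simp flip: power_mult_distrib intro!: power_mono\<close>)
qed fact

lemma cmod_add_sq_le: "(cmod (a + b))\<^sup>2 \<le> 2 * (cmod a)\<^sup>2 + 2 * (cmod b)\<^sup>2"
proof -
  have "(cmod (a + b))\<^sup>2 + (cmod (a - b))\<^sup>2 = 2 * (cmod a)\<^sup>2 + 2 * (cmod b)\<^sup>2"
    unfolding cmod_power2 by (simp add: power2_eq_square algebra_simps)
  then show ?thesis using zero_le_power2[of "cmod (a - b)"] by linarith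
qed

lemma sq_integrable_add [intro]:
  assumes "sq_integrable M f" "sq_integrable M g" shows "sq_integrable M (\<lambda>x. f x + g x)"
  unfolding sq_integrable_def
proof
  note [measurable] = assms[THEN sq_integrable_measurable]
  show "(\<lambda>x. f x + g x) \<in> borel_measurable M" by measurable
  have "integrable M (\<lambda>x. 2 * (cmod (f x))\<^sup>2 + 2 * (cmod (g x))\<^sup>2)"
    using assms[THEN sq_integrable_integrable] by auto
  then show "integrable M (\<lambda>x. (cmod (f x + g x))\<^sup>2)"
    by (rule Bochner_Integration.integrable_bound) (auto simp: cmod_add_sq_le)
qed

lemma sq_integrable_scale [intro]: "sq_integrable M f \<Longrightarrow> sq_integrable M (\<lambda>x. c * f x)"
  by (rule sq_integrable_bound[where c = "cmod c" and g = f]) (auto simp: norm_mult dest: sq_integrable_measurable)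

lemma sq_integrable_minus [intro]: "sq_integrable M f \<Longrightarrow> sq_integrable M (\<lambda>x. - f x)"
  using sq_integrable_scale[of M f "-1"] by simp

lemma sq_integrable_diff [intro]: "sq_integrable M f \<Longrightarrow> sq_integrable M g \<Longrightarrow> sq_integrable M (\<lambda>x. f x - g x)"
  using sq_integrable_add[of M f "\<lambda>x. - g x"] by auto

lemma sq_integrable_cnj [intro]: "sq_integrable M f \<Longrightarrow> sq_integrable M (\<lambda>x. cnj (f x))"
  unfolding sq_integrable_def by auto

lemma sq_integrable_zero [simp]: "sq_integrable M (\<lambda>x. 0)"
  by (simp add: sq_integrable_def)

lemma sq_integrable_sum [intro]: "(\<And>i. i \<in> S \<Longrightarrow> sq_integrable M (f i)) \<Longrightarrow> sq_integrable M (\<lambda>x. \<Sum>i\<in>S. f i x)"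
  by (induction S rule: infinite_finite_induct) auto

lemma sq_integrable_mult_integrable [intro]:
  assumes "sq_integrable M f" "sq_integrable M g" shows "integrable M (\<lambda>x. f x * g x)"
proof -
  note [measurable] = assms[THEN sq_integrable_measurable]
  have "integrable M (\<lambda>x. (cmod (f x))\<^sup>2 + (cmod (g x))\<^sup>2)"
    using assms[THEN sq_integrable_integrable] by auto
  then show ?thesis
  proof (rule Bochner_Integration.integrable_bound)
    have "cmod (f x) * cmod (g x) \<le> (cmod (f x))\<^sup>2 + (cmod (g x))\<^sup>2" for x
      using sum_squares_bound[of "cmod (f x)" "cmod (g x)"]
        mult_nonneg_nonneg[OF norm_ge_zero[of "f x"] norm_ge_zero[of "g x"]] unfolding mult.assoc by linarith
    then show "AE x in M. norm (f x * g x) \<le> norm ((cmod (f x))\<^sup>2 + (cmod (g x))\<^sup>2)"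
      by (simp add: norm_mult)
  qed measurable
qed

lemma sq_integrable_inner_on_integrable [intro]: "sq_integrable M f \<Longrightarrow> sq_integrable M g \<Longrightarrow> integrable M (\<lambda>x. f x * cnj (g x))"
  by auto

lemma inner_on_self: "inner_on M f f = of_real (sq_norm M f)"
  by (simp add: inner_on_def sq_norm_def complex_norm_square[symmetric] flip: integral_complex_of_real of_real_power)

lemma inner_on_add_left: "sq_integrable M f \<Longrightarrow> sq_integrable M g \<Longrightarrow> sq_integrable M h \<Longrightarrow> inner_on M (\<lambda>x. f x + g x) h = inner_on M f h + inner_on M g h"
  by (simp add: inner_on_def distrib_right sq_integrable_inner_on_integrable)

lemma inner_on_diff_left: "sq_integrable M f \<Longrightarrow> sq_integrable M g \<Longrightarrow> sq_integrable M h \<Longrightarrow> inner_on M (\<lambda>x. f x - g x) h = inner_on M f h - inner_on M g h"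
  by (simp add: inner_on_def left_diff_distrib sq_integrable_inner_on_integrable)

lemma inner_on_scale_right: "inner_on M f (\<lambda>x. c * g x) = cnj c * inner_on M f g"
  by (simp add: inner_on_def mult.left_commute)

lemma inner_on_commute: "inner_on M g f = cnj (inner_on M f g)"
  unfolding inner_on_def by (subst Bochner_Integration.integral_cnj[symmetric]) (simp add: mult.commute)

lemma sq_norm_scale: "sq_norm M (\<lambda>x. c * f x) = (cmod c)\<^sup>2 * sq_norm M f"
  by (simp add: sq_norm_def norm_mult power_mult_distrib)

lemma sq_norm_add:
  assumes "sq_integrable M f" "sq_integrable M g"
  shows "sq_norm M (\<lambda>x. f x + g x) = sq_norm M f + sq_norm M g + 2 * Re (inner_on M f g)"
proof -
  have e: "(cmod (f x + g x))\<^sup>2 = (cmod (f x))\<^sup>2 + (cmod (g x))\<^sup>2 + 2 * Re (f x * cnj (g x))" for x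
    unfolding cmod_power2 by (simp add: power2_eq_square algebra_simps)
  have i: "integrable M (\<lambda>x. f x * cnj (g x))" using assms by auto
  show ?thesis
    using sq_integrable_integrable[OF assms(1)] sq_integrable_integrable[OF assms(2)] integrable_Re[OF i] i
    unfolding sq_norm_def inner_on_def e by (simp add: integral_Re del: times_complex.simps)
qed

lemma sq_norm_diff:
  assumes "sq_integrable M f" "sq_integrable M g"
  shows "sq_norm M (\<lambda>x. f x - g x) = sq_norm M f + sq_norm M g - 2 * Re (inner_on M f g)"
  using sq_norm_add[OF assms(1) sq_integrable_scale[OF assms(2), of "-1"]]
  by (simp add: inner_on_scale_right[of M f "-1", simplified] sq_norm_scale[of M "-1", simplified])

lemma sq_norm_parallelogram:
  assumes "sq_integrable M f" "sq_integrable M g"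
  shows "sq_norm M (\<lambda>x. f x + g x) + sq_norm M (\<lambda>x. f x - g x) = 2 * sq_norm M f + 2 * sq_norm M g"
  using sq_norm_add[OF assms] sq_norm_diff[OF assms] by simp

lemma sq_norm_add_le:
  assumes "sq_integrable M f" "sq_integrable M g"
  shows "sq_norm M (\<lambda>x. f x + g x) \<le> 2 * sq_norm M f + 2 * sq_norm M g"
  using sq_norm_parallelogram[OF assms] sq_norm_nonneg[of M "\<lambda>x. f x - g x"] by linarith

lemma sq_norm_triangle:
  assumes "sq_integrable M f" "sq_integrable M g" "sq_integrable M h"
  shows "sq_norm M (\<lambda>x. f x - h x) \<le> 2 * sq_norm M (\<lambda>x. f x - g x) + 2 * sq_norm M (\<lambda>x. g x - h x)"
  using sq_norm_add_le[of M "\<lambda>x. f x - g x" "\<lambda>x. g x - h x"] assms by auto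

lemma sq_norm_cong_AE:
  assumes "AE x in M. f x = g x" "f \<in> borel_measurable M" "g \<in> borel_measurable M"
  shows "sq_norm M f = sq_norm M g"
  unfolding sq_norm_def using assms by (intro integral_cong_AE) auto

lemma sq_norm_eq_0_iff:
  assumes "sq_integrable M f" shows "sq_norm M f = 0 \<longleftrightarrow> (AE x in M. f x = 0)"
  unfolding sq_norm_def
  using integral_nonneg_eq_0_iff_AE[OF sq_integrable_integrable[OF assms]] by auto

text \<open>Nonnegativity of the squared distance from \<open>f\<close> to its orthogonal projection
  onto \<open>g\<close>; \<open>?c\<close> is the coefficient of that projection, so the degenerate
  case of a null \<open>g\<close> is separate.\<close>

lemma Cauchy_Schwarz_L2:
  assumes "sq_integrable M f" "sq_integrable M g"
  shows "(cmod (inner_on M f g))\<^sup>2 \<le> sq_norm M f * sq_norm M g"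
proof (cases "sq_norm M g = 0")
  case True
  then have "AE x in M. g x = 0" using sq_norm_eq_0_iff assms by blast
  moreover note [measurable] = assms[THEN sq_integrable_measurable]
  ultimately have "inner_on M f g = (LINT x|M. 0)"
    unfolding inner_on_def by (intro integral_cong_AE; measurable?) auto
  then show ?thesis by simp
next
  case False
  let ?b = "sq_norm M g" and ?p = "inner_on M f g"
  let ?c = "?p / of_real ?b"
  have b: "?b > 0" using False sq_norm_nonneg[of M g] by linarith
  have "0 \<le> sq_norm M (\<lambda>x. f x - ?c * g x)" by simp
  also have "\<dots> = sq_norm M f + (cmod ?c)\<^sup>2 * ?b - 2 * Re (cnj ?c * ?p)"
    using sq_norm_diff[OF assms(1) sq_integrable_scale[OF assms(2)], of ?c]
    by (simp only: inner_on_scale_right sq_norm_scale)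
  also have "cnj ?c * ?p = of_real ((cmod ?p)\<^sup>2 / ?b)"
    using complex_norm_square[of ?p] by (simp add: mult.commute)
  also have "(cmod ?c)\<^sup>2 * ?b = (cmod ?p)\<^sup>2 / ?b"
    using b by (simp add: norm_divide power_divide power2_eq_square)
  finally show ?thesis using b by (simp add: field_simps)
qed

lemma inner_on_tendsto:
  assumes "\<And>n. sq_integrable M (F n)" "sq_integrable M f" "\<And>n. sq_integrable M (G n)" "sq_integrable M g"
    and "(\<lambda>n. sq_norm M (\<lambda>x. F n x - f x)) \<longlonglongrightarrow> 0" "(\<lambda>n. sq_norm M (\<lambda>x. G n x - g x)) \<longlonglongrightarrow> 0"
  shows "(\<lambda>n. inner_on M (F n) (G n)) \<longlonglongrightarrow> inner_on M f g"
proof -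
  have cs: "cmod (inner_on M u v) \<le> sqrt (sq_norm M u) * sqrt (sq_norm M v)" if "sq_integrable M u" "sq_integrable M v" for u v
    using Cauchy_Schwarz_L2[OF that] by (simp add: real_le_rsqrt flip: real_sqrt_mult)
  let ?a = "\<lambda>n. sqrt (sq_norm M (\<lambda>x. F n x - f x))" and ?b = "\<lambda>n. sqrt (sq_norm M (\<lambda>x. G n x - g x))"
  have bd: "cmod (inner_on M (F n) (G n) - inner_on M f g) \<le> ?a n * ?b n + ?a n * sqrt (sq_norm M g) + sqrt (sq_norm M f) * ?b n" for n
  proof -
    have d: "sq_integrable M (\<lambda>x. F n x - f x)" "sq_integrable M (\<lambda>x. G n x - g x)" using assms(1-4) by auto
    have 1: "inner_on M (F n) (G n) = inner_on M (\<lambda>x. F n x - f x) (G n) + inner_on M f (G n)"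
      using inner_on_add_left[OF d(1) assms(2) assms(3)[of n]] by simp
    have 2: "inner_on M h (G n) = inner_on M h (\<lambda>x. G n x - g x) + inner_on M h g" if "sq_integrable M h" for h
      using arg_cong[OF inner_on_add_left[OF d(2) assms(4) that], of cnj] by (simp add: inner_on_commute[of M h])
    have 3: "inner_on M (F n) (G n) - inner_on M f g = inner_on M (\<lambda>x. F n x - f x) (\<lambda>x. G n x - g x)
       + inner_on M (\<lambda>x. F n x - f x) g + inner_on M f (\<lambda>x. G n x - g x)"
      unfolding 1 2[OF d(1)] 2[OF assms(2)] by simp
    show ?thesis
      unfolding 3
      by (intro norm_triangle_le add_mono cs d assms)
  qed
  have lim: "(\<lambda>n. ?a n * ?b n + ?a n * sqrt (sq_norm M g) + sqrt (sq_norm M f) * ?b n) \<longlonglongrightarrow> 0"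
  proof -
    have "?a \<longlonglongrightarrow> 0" "?b \<longlonglongrightarrow> 0"
      using assms(5,6)[THEN tendsto_real_sqrt] by simp_all
    then show ?thesis by - (rule tendsto_add_zero[OF tendsto_add_zero[OF tendsto_mult_zero tendsto_mult_left_zero] tendsto_mult_right_zero])
  qed
  have "(\<lambda>n. inner_on M (F n) (G n) - inner_on M f g) \<longlonglongrightarrow> 0"
    by (rule Lim_null_comparison[OF _ lim]) (rule always_eventually, rule allI, rule bd)
  then show ?thesis by (simp add: LIM_zero_iff)
qed

lemma sq_norm_tendsto:
  assumes "\<And>n. sq_integrable M (F n)" "sq_integrable M f" "(\<lambda>n. sq_norm M (\<lambda>x. F n x - f x)) \<longlonglongrightarrow> 0"
  shows "(\<lambda>n. sq_norm M (F n)) \<longlonglongrightarrow> sq_norm M f"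
  using tendsto_Re[OF inner_on_tendsto[OF assms(1,2,1,2,3,3)]] by (simp add: inner_on_self)

text \<open>The dominating function is four times the square of \<open>w\<close>, because a squared
  difference is at most twice the sum of the squares.\<close>

lemma sq_norm_dominated_convergence:
  assumes w: "sq_integrable M w" and f: "f \<in> borel_measurable M" and F: "\<And>n. F n \<in> borel_measurable M"
    and bd: "\<And>n x. cmod (F n x) \<le> cmod (w x)" "\<And>x. cmod (f x) \<le> cmod (w x)" and lim: "AE x in M. (\<lambda>n. F n x) \<longlonglongrightarrow> f x"
  shows "(\<lambda>n. sq_norm M (\<lambda>x. F n x - f x)) \<longlonglongrightarrow> 0"
proof -
  note [measurable] = F f
  have "(\<lambda>n. sq_norm M (\<lambda>x. F n x - f x)) \<longlonglongrightarrow> (LINT x|M. 0)"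
    unfolding sq_norm_def
  proof (rule integral_dominated_convergence[where w = "\<lambda>x. 4 * (cmod (w x))\<^sup>2"])
    show "integrable M (\<lambda>x. 4 * (cmod (w x))\<^sup>2)" using sq_integrable_integrable[OF w] by simp
    show "AE x in M. (\<lambda>n. (cmod (F n x - f x))\<^sup>2) \<longlonglongrightarrow> 0"
      using lim
    proof eventually_elim
      case (elim x)
      have "(\<lambda>n. (cmod (F n x - f x))\<^sup>2) \<longlonglongrightarrow> (cmod (f x - f x))\<^sup>2"
        by (intro tendsto_intros elim)
      then show ?case by simp
    qed
    fix n
    show "AE x in M. norm ((cmod (F n x - f x))\<^sup>2) \<le> 4 * (cmod (w x))\<^sup>2"
    proof (rule AE_I2)
      fix x
      have "(cmod (F n x - f x))\<^sup>2 \<le> 2 * (cmod (F n x))\<^sup>2 + 2 * (cmod (f x))\<^sup>2"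
        using cmod_add_sq_le[of "F n x" "- f x"] by simp
      then show "norm ((cmod (F n x - f x))\<^sup>2) \<le> 4 * (cmod (w x))\<^sup>2"
        using power_mono[OF bd(1)[of n x] norm_ge_zero, of 2] power_mono[OF bd(2)[of x] norm_ge_zero, of 2] by (simp del: power_mono_iff power2_le_iff_abs_le abs_norm_cancel norm_power)
    qed
  qed measurable
  then show ?thesis by simp
qed

text \<open>Along a subsequence \<open>r\<close> the squared steps are at most
  \<open>8^(-k)\<close>. The weight \<open>2^k\<close> leaves an integrable series of ratio 1/4, yet
  a finite weighted sum \<open>s\<close> at a point forces steps of size at most
  \<open>sqrt s * 2^(-k/2)\<close> there, so the subsequence converges almost everywhere. Fatou
  along it bounds the distance of every \<open>F n\<close> from the limit by
  \<open>e n\<close>.\<close>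

lemma Riesz_Fischer:
  assumes F: "\<And>n. sq_integrable M (F n)"
    and cauchy: "\<And>m n. m \<le> n \<Longrightarrow> sq_norm M (\<lambda>x. F n x - F m x) \<le> e m" and e: "e \<longlonglongrightarrow> 0"
  obtains g where "sq_integrable M g" "(\<lambda>n. sq_norm M (\<lambda>x. F n x - g x)) \<longlonglongrightarrow> 0"
proof -
  note [measurable] = F[THEN sq_integrable_measurable]
  have "\<exists>r. strict_mono (r :: nat \<Rightarrow> nat) \<and> (\<forall>k. e (r k) \<le> (1/8)^k)"
  proof -
    have ex: "\<exists>N. \<forall>n\<ge>N. e n \<le> (1/8)^k" for k :: nat
    proof -
      have "eventually (\<lambda>n. e n < (1/8)^k) sequentially" by (rule order_tendstoD(2)[OF e]) simp
      then show ?thesis unfolding eventually_sequentially by (meson less_imp_le)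
    qed
    have "\<exists>r. strict_mono (r :: nat \<Rightarrow> nat) \<and> (\<forall>k. \<forall>n\<ge>r k. e n \<le> (1/8)^k)"
    proof -
      from ex obtain N where N: "\<And>k n. n \<ge> N k \<Longrightarrow> e n \<le> (1/8::real)^k" by metis
      \<comment> \<open>Adding up the thresholds keeps \<open>r k\<close> above \<open>N k\<close>
        and makes \<open>r\<close> increasing; the \<open>Suc\<close> makes the increase
        strict.\<close>
      define r where "r k = (\<Sum>i\<le>k. Suc (N i))" for k
      have "strict_mono r" unfolding strict_mono_Suc_iff by (simp add: r_def)
      moreover have "r k \<ge> N k" for k unfolding r_def
        using member_le_sum[of k "{..k}" "\<lambda>i. Suc (N i)"] by auto
      ultimately show ?thesis using N by (meson order_trans)
    qed
    then show ?thesis by blast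
  qed
  then obtain r where r: "strict_mono (r :: nat \<Rightarrow> nat)" "\<And>k. e (r k) \<le> (1/8)^k" by blast
  define d where "d k x = F (r (Suc k)) x - F (r k) x" for k x
  have d: "sq_integrable M (d k)" "sq_norm M (d k) \<le> (1/8)^k" for k
    unfolding d_def using F apply blast
    using cauchy[of "r k" "r (Suc k)"] r(2)[of k] strict_monoD[OF r(1), of k "Suc k"] by simp
  note [measurable] = d(1)[THEN sq_integrable_measurable]
  have "(\<integral>\<^sup>+x. (\<Sum>k. ennreal (2^k * (cmod (d k x))\<^sup>2)) \<partial>M) = (\<Sum>k. \<integral>\<^sup>+x. ennreal (2^k * (cmod (d k x))\<^sup>2) \<partial>M)"
    by (rule nn_integral_suminf) measurable
  also have "\<dots> = (\<Sum>k. ennreal (2^k * sq_norm M (d k)))"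
    by (simp add: ennreal_mult nn_integral_cmult nn_integral_sq_norm[OF d(1)])
  also have "\<dots> \<le> (\<Sum>k. ennreal ((1/4)^k))"
  proof (rule suminf_le)
    fix k
    have "2^k * sq_norm M (d k) \<le> 2^k * (1/8)^k" using d(2) by (intro mult_left_mono) auto
    then show "ennreal (2^k * sq_norm M (d k)) \<le> ennreal ((1/4)^k)"
      by (intro ennreal_leI) (simp add: power_mult_distrib[symmetric])
  qed auto
  also have "\<dots> = ennreal (\<Sum>k. (1/4)^k)" by (rule suminf_ennreal_eq) (auto intro!: summable_sums summable_geometric)
  also have "\<dots> < \<infinity>" by simp
  finally have "AE x in M. (\<Sum>k. ennreal (2^k * (cmod (d k x))\<^sup>2)) \<noteq> \<infinity>"
    by (intro nn_integral_noteq_infinite) auto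
  then have ae: "AE x in M. convergent (\<lambda>k. F (r k) x)"
  proof eventually_elim
    case (elim x)
    define s where "s = enn2real (\<Sum>k. ennreal (2^k * (cmod (d k x))\<^sup>2))"
    have s: "(\<Sum>k. ennreal (2^k * (cmod (d k x))\<^sup>2)) = ennreal s" unfolding s_def using elim by (simp add: less_top)
    have "cmod (d k x) \<le> sqrt s * (1/sqrt 2)^k" for k
    proof -
      have "ennreal (2^k * (cmod (d k x))\<^sup>2) \<le> (\<Sum>k. ennreal (2^k * (cmod (d k x))\<^sup>2))"
        using sum_le_suminf[of "\<lambda>k. ennreal (2^k * (cmod (d k x))\<^sup>2)" "{k}", OF summableI]
        by (simp only: sum.insert finite.emptyI sum.empty empty_iff not_False_eq_True add_0_right finite.insertI zero_le simp_thms)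
      moreover have "0 \<le> s" by (simp add: s_def)
      ultimately have "2^k * (cmod (d k x))\<^sup>2 \<le> s" unfolding s by (simp only: ennreal_le_iff)
      then have "(cmod (d k x))\<^sup>2 \<le> s * (1/2)^k" by (simp add: field_simps)
      then have "cmod (d k x) \<le> sqrt (s * (1/2)^k)" by (rule real_le_rsqrt)
      then show ?thesis by (simp add: real_sqrt_mult real_sqrt_power real_sqrt_divide)
    qed
    moreover have "summable (\<lambda>k. sqrt s * (1/sqrt 2)^k)"
      by (intro summable_mult summable_geometric) simp
    ultimately have "summable (\<lambda>k. d k x)"
      by (rule summable_comparison_test'[rotated])
    then have "convergent (\<lambda>n. F (r 0) x + (\<Sum>k<n. d k x))"
      by (intro convergent_add convergent_const) (simp add: summable_iff_convergent)
    then show ?case unfolding d_def using sum_lessThan_telescope[of "\<lambda>k. F (r k) x"] by simp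
  qed
  define g where "g x = lim (\<lambda>k. F (r k) x)" for x
  have g [measurable]: "g \<in> borel_measurable M" unfolding g_def by measurable
  have key: "(\<integral>\<^sup>+x. ennreal ((cmod (F n x - g x))\<^sup>2) \<partial>M) \<le> ennreal (e n)" for n
  proof -
    have "(\<integral>\<^sup>+x. ennreal ((cmod (F n x - g x))\<^sup>2) \<partial>M)
        = (\<integral>\<^sup>+x. liminf (\<lambda>k. ennreal ((cmod (F n x - F (r k) x))\<^sup>2)) \<partial>M)"
    proof (rule nn_integral_cong_AE, use ae in eventually_elim)
      case (elim x)
      then have "(\<lambda>k. F (r k) x) \<longlonglongrightarrow> g x" by (simp add: g_def convergent_LIMSEQ_iff)
      then have "(\<lambda>k. ennreal ((cmod (F n x - F (r k) x))\<^sup>2)) \<longlonglongrightarrow> ennreal ((cmod (F n x - g x))\<^sup>2)"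
        by (intro tendsto_ennrealI tendsto_intros)
      then show ?case by (rule lim_imp_Liminf[OF sequentially_bot, symmetric])
    qed
    also have "\<dots> \<le> liminf (\<lambda>k. \<integral>\<^sup>+x. ennreal ((cmod (F n x - F (r k) x))\<^sup>2) \<partial>M)"
      by (rule nn_integral_liminf) measurable
    also have "\<dots> \<le> liminf (\<lambda>k. ennreal (e n))"
    proof (rule Liminf_mono, rule eventually_sequentiallyI[of n])
      fix k assume "n \<le> k"
      then have "n \<le> r k" using seq_suble[OF r(1), of k] by linarith
      then have "sq_norm M (\<lambda>x. F (r k) x - F n x) \<le> e n" by (rule cauchy)
      moreover have "sq_norm M (\<lambda>x. F (r k) x - F n x) = sq_norm M (\<lambda>x. F n x - F (r k) x)"
        unfolding sq_norm_def by (simp add: norm_minus_commute)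
      ultimately show "(\<integral>\<^sup>+x. ennreal ((cmod (F n x - F (r k) x))\<^sup>2) \<partial>M) \<le> ennreal (e n)"
        using F by (subst nn_integral_sq_norm) (auto intro: ennreal_leI)
    qed
    also have "\<dots> = ennreal (e n)" by (simp add: Liminf_const)
    finally show ?thesis .
  qed
  have diff: "sq_integrable M (\<lambda>x. F n x - g x)" for n
    by (rule sq_integrableI_nn, measurable) (use key[of n] in \<open>auto intro: le_less_trans\<close>)
  have "sq_integrable M (\<lambda>x. F 0 x - (F 0 x - g x))" using F diff by (rule sq_integrable_diff)
  then have gs: "sq_integrable M g" by simp
  have "sq_norm M (\<lambda>x. F n x - g x) \<le> e n" for n
  proof -
    have "0 \<le> e n" by (rule order_trans[OF sq_norm_nonneg cauchy[OF order_refl]])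
    then show ?thesis using key[of n] nn_integral_sq_norm[OF diff[of n]] by simp
  qed
  then have "(\<lambda>n. sq_norm M (\<lambda>x. F n x - g x)) \<longlonglongrightarrow> 0"
    by (intro tendsto_sandwich[OF _ _ tendsto_const e]) auto
  with gs show thesis by (rule that)
qed

lemma L2_sq_integrable: "f \<in> L2 \<longleftrightarrow> sq_integrable lebesgue f"
  by (simp add: L2_def sq_integrable_def)

lemma L2_tendsto_iff:
  assumes "\<And>n. sq_integrable lebesgue (F n)" "sq_integrable lebesgue f"
  shows "L2_tendsto F f \<longleftrightarrow> (\<lambda>n. sq_norm lebesgue (\<lambda>x. F n x - f x)) \<longlonglongrightarrow> 0"
  unfolding L2_tendsto_def
  using assms by (subst nn_integral_sq_norm) (auto simp: sq_integrable_diff simp flip: ennreal_0)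

section \<open>Periodization\<close>

lemma lebesgue_affine_measurable_real:
  "c \<noteq> 0 \<Longrightarrow> (\<lambda>x. t + c * x) \<in> lebesgue \<rightarrow>\<^sub>M lebesgue" for c t :: real
  using lebesgue_affine_measurable[where c = "\<lambda>x::real. c" and t = t] by simp

lemma borel_measurable_lebesgue_affine:
  assumes "f \<in> borel_measurable lebesgue" "c \<noteq> 0"
  shows "(\<lambda>x::real. f (t + c * x)) \<in> borel_measurable lebesgue"
  using measurable_compose[OF lebesgue_affine_measurable_real assms(1)] assms(2) by simp

abbreviation "CZ \<equiv> count_space (UNIV :: int set)"
text \<open>The model of the circle. It is half-open so that its integer translates tile the line
  without overlap.\<close>

abbreviation "U \<equiv> lebesgue_on {0..<1::real}"

interpretation CZ: sigma_finite_measure CZ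
  by (intro sigma_finite_measure_count_space_countable) simp

interpretation U: finite_measure U
  by (intro finite_measure_lebesgue_on bounded_set_imp_lmeasurable) auto

lemma measure_U [simp]: "measure U {0..<1} = 1"
  by (simp add: measure_restrict_space)

interpretation CZU: pair_sigma_finite CZ U ..

lemma unit_translate_measurable: "(\<lambda>x. x + of_int m) \<in> U \<rightarrow>\<^sub>M lebesgue"
  using measurable_restrict_space1[OF lebesgue_affine_measurable_real[of 1 "of_int m"], of "{0..<1}"]
  by (simp add: add.commute)

lemma unfold_measurable: "(\<lambda>(m, x). x + of_int m) \<in> CZ \<Otimes>\<^sub>M U \<rightarrow>\<^sub>M lebesgue"
  by (rule measurable_pair_measure_countable1) (use unit_translate_measurable in simp_all)

text \<open>The line is the disjoint union of the translates of \<open>{0..<1}\<close>. Phrased as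
  an image of a product measure, this lets Tonelli and Fubini deliver both periodization formulas
  directly.\<close>

lemma lebesgue_unfold: "lebesgue = distr (CZ \<Otimes>\<^sub>M U) lebesgue (\<lambda>(m, x). x + of_int m)"
proof (rule measure_eqI)
  fix A :: "real set" assume A: "A \<in> sets lebesgue"
  let ?T = "\<lambda>(m, x). x + of_int m :: real"
  have cover: "A = (\<Union>m::int. A \<inter> {of_int m..<of_int m + 1})"
  proof -
    have "\<exists>m::int. x \<in> {of_int m..<of_int m + 1}" for x :: real
      by (rule exI[of _ "\<lfloor>x\<rfloor>"]) simp
    then show ?thesis by blast
  qed
  have disj: "disjoint_family (\<lambda>m::int. A \<inter> {real_of_int m..<of_int m + 1})"
    unfolding disjoint_family_on_def
  proof (intro ballI impI)
    fix m n :: int assume "m \<noteq> n"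
    then have "m + 1 \<le> n \<or> n + 1 \<le> m" by linarith
    then have "real_of_int m + 1 \<le> n \<or> real_of_int n + 1 \<le> m" by linarith
    then show "A \<inter> {real_of_int m..<of_int m + 1} \<inter> (A \<inter> {real_of_int n..<of_int n + 1}) = {}" by auto
  qed
  have piece: "emeasure lebesgue (A \<inter> {of_int m..<of_int m + 1}) = emeasure U (Pair m -` (?T -` A \<inter> space (CZ \<Otimes>\<^sub>M U)))" for m :: int
  proof -
    have e: "Pair m -` (?T -` A \<inter> space (CZ \<Otimes>\<^sub>M U)) = (\<lambda>x. x + of_int m) -` A \<inter> space U"
      by (auto simp: space_pair_measure)
    have B: "A \<inter> {of_int m..<of_int m + 1} \<in> sets lebesgue" using A by (intro sets.Int) auto
    have s: "(\<lambda>x. x + of_int m) -` A \<inter> space U \<in> sets U"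
      by (rule measurable_sets[OF unit_translate_measurable A])
    have s': "(\<lambda>x. x + of_int m) -` A \<inter> {0..<1} \<in> sets lebesgue"
      using s by (simp add: sets_restrict_space_iff)
    have "emeasure lebesgue (A \<inter> {of_int m..<of_int m + 1}) = (\<integral>\<^sup>+x. indicator (A \<inter> {of_int m..<of_int m + 1}) x \<partial>lebesgue)"
      using B by (rule nn_integral_indicator[symmetric])
    also have "\<dots> = (\<integral>\<^sup>+x. indicator (A \<inter> {of_int m..<of_int m + 1}) (of_int m + 1 * x) \<partial>lebesgue)"
      using B by (subst nn_integral_real_affine_lebesgue[of _ 1 "of_int m"]) auto
    also have "\<dots> = (\<integral>\<^sup>+x. indicator ((\<lambda>x. x + of_int m) -` A \<inter> {0..<1}) x \<partial>lebesgue)"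
      by (intro nn_integral_cong) (auto simp: indicator_def add.commute)
    also have "\<dots> = emeasure lebesgue ((\<lambda>x. x + of_int m) -` A \<inter> {0..<1})"
      using s' by simp
    also have "\<dots> = emeasure U ((\<lambda>x. x + of_int m) -` A \<inter> {0..<1})"
      by (subst emeasure_restrict_space) auto
    finally show ?thesis unfolding e by simp
  qed
  have "emeasure lebesgue A = (\<integral>\<^sup>+m. emeasure lebesgue (A \<inter> {of_int m..<of_int m + 1}) \<partial>CZ)"
    using A disj by (subst cover, subst emeasure_UN_countable) auto
  also have "\<dots> = (\<integral>\<^sup>+m. emeasure U (Pair m -` (?T -` A \<inter> space (CZ \<Otimes>\<^sub>M U))) \<partial>CZ)"
    by (simp only: piece)
  also have "\<dots> = emeasure (CZ \<Otimes>\<^sub>M U) (?T -` A \<inter> space (CZ \<Otimes>\<^sub>M U))"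
    by (rule U.emeasure_pair_measure_alt[symmetric]) (rule measurable_sets[OF unfold_measurable A])
  also have "\<dots> = emeasure (distr (CZ \<Otimes>\<^sub>M U) lebesgue ?T) A"
    by (rule emeasure_distr[OF unfold_measurable A, symmetric])
  finally show "emeasure lebesgue A = emeasure (distr (CZ \<Otimes>\<^sub>M U) lebesgue ?T) A" .
qed simp

lemma unfold_measurable_comp:
  "f \<in> borel_measurable lebesgue \<Longrightarrow> (\<lambda>(m, x). f (x + of_int m)) \<in> borel_measurable (CZ \<Otimes>\<^sub>M U)"
  using measurable_compose[OF unfold_measurable, of f borel] by (simp add: case_prod_unfold)

lemma nn_integral_periodize:
  assumes "f \<in> borel_measurable lebesgue"
  shows "(\<integral>\<^sup>+x. f x \<partial>lebesgue) = (\<integral>\<^sup>+x. \<integral>\<^sup>+m. f (x + of_int m) \<partial>CZ \<partial>U)"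
proof -
  have "(\<integral>\<^sup>+x. f x \<partial>lebesgue) = (\<integral>\<^sup>+p. (\<lambda>(m, x). f (x + of_int m)) p \<partial>(CZ \<Otimes>\<^sub>M U))"
    using assms by (subst lebesgue_unfold, subst nn_integral_distr[OF unfold_measurable])
      (simp_all add: case_prod_unfold)
  also have "\<dots> = (\<integral>\<^sup>+x. \<integral>\<^sup>+m. f (x + of_int m) \<partial>CZ \<partial>U)"
    using CZU.nn_integral_snd[OF unfold_measurable_comp[OF assms]] by simp
  finally show ?thesis .
qed

lemma integral_periodize:
  fixes f :: "real \<Rightarrow> complex"
  assumes f: "integrable lebesgue f"
  shows "(LINT x|lebesgue. f x) = (LINT x|U. LINT m|CZ. f (x + of_int m))"
proof -
  have m: "f \<in> borel_measurable lebesgue" using f by auto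
  have i: "integrable (CZ \<Otimes>\<^sub>M U) (\<lambda>(m, x). f (x + of_int m))"
    using f by (subst (asm) lebesgue_unfold, subst (asm) integrable_distr_eq[OF unfold_measurable])
      (simp_all add: case_prod_unfold m)
  have "(LINT x|lebesgue. f x) = (LINT p|(CZ \<Otimes>\<^sub>M U). (\<lambda>(m, x). f (x + of_int m)) p)"
    using m by (subst lebesgue_unfold, subst integral_distr[OF unfold_measurable])
      (simp_all add: case_prod_unfold)
  then show ?thesis using CZU.integral_snd[OF i] by simp
qed

section \<open>Characters and Fourier coefficients on the circle\<close>

definition ee :: "real \<Rightarrow> complex" where "ee x = cis (2 * pi * x)"

lemma ee_add: "ee (x + y) = ee x * ee y"
  by (simp add: ee_def cis_mult distrib_left)

lemma ee_0 [simp]: "ee 0 = 1" and ee_half: "ee (1/2) = -1"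
  by (simp_all add: ee_def)

lemma ee_minus: "ee (- x) = cnj (ee x)"
  by (simp add: ee_def cis_cnj)

lemma norm_ee [simp]: "cmod (ee x) = 1"
  by (simp add: ee_def)

lemma ee_mult_cnj [simp]: "ee x * cnj (ee x) = 1" "cnj (ee x) * ee x = 1"
  by (simp_all add: ee_add[symmetric] ee_minus[symmetric])

lemma ee_of_int [simp]: "ee (of_int n) = 1"
  by (simp add: ee_def cis_multiple_2pi)

lemma ee_eq_exp: "ee x = exp (2 * of_real pi * \<i> * of_real x)"
  by (simp add: ee_def cis_conv_exp mult_ac)

lemma continuous_on_ee [continuous_intros]:
  "continuous_on S f \<Longrightarrow> continuous_on S (\<lambda>x. ee (f x))"
  unfolding ee_def by (intro continuous_intros)

lemma ee_borel_measurable [measurable]: "ee \<in> borel_measurable borel"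
  by (intro borel_measurable_continuous_onI continuous_on_ee continuous_intros)

lemma id_measurable_lebesgue [measurable]: "(\<lambda>x::real. x) \<in> borel_measurable lebesgue"
  by (rule measurable_completion) simp

lemma id_measurable_lebesgue_on [measurable]: "(\<lambda>x::real. x) \<in> borel_measurable (lebesgue_on S)"
  by (rule measurable_restrict_space1) simp

lemma sq_integrable_U_bounded:
  assumes "f \<in> borel_measurable U" "\<And>x. x \<in> {0..<1} \<Longrightarrow> cmod (f x) \<le> K"
  shows "sq_integrable U f" "sq_norm U f \<le> K\<^sup>2"
proof -
  have K: "(cmod (f x))\<^sup>2 \<le> K\<^sup>2" if "x \<in> {0..<1}" for x
    using assms(2)[OF that] by (intro power_mono) auto
  have "integrable U (\<lambda>x. (cmod (f x))\<^sup>2)"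
    using assms(1) K by (intro U.integrable_const_bound[where B = "K\<^sup>2"]) auto
  then show "sq_integrable U f" using assms(1) by (simp add: sq_integrable_def)
  have "sq_norm U f \<le> (LINT x|U. K\<^sup>2)"
    unfolding sq_norm_def using \<open>integrable U (\<lambda>x. (cmod (f x))\<^sup>2)\<close> K by (intro integral_mono) auto
  then show "sq_norm U f \<le> K\<^sup>2" by (simp add: measure_restrict_space)
qed

lemma sq_integrable_ee [simp]: "sq_integrable U (\<lambda>t. ee (s * t))"
  by (rule sq_integrable_U_bounded[where K = 1]) auto

lemma integral_U_ee: "(LINT t|U. ee (of_int k * t)) = (if k = 0 then 1 else 0)"
proof (cases "k = 0")
  case True
  then show ?thesis by (simp add: measure_restrict_space)
next
  case False
  let ?c = "2 * of_real pi * \<i> * of_int k :: complex"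
  have c: "?c \<noteq> 0" using False by simp
  have e: "ee (of_int k * t) = exp (?c * of_real t)" for t
    by (simp add: ee_eq_exp mult_ac)
  have "((\<lambda>t. ee (of_int k * t)) has_integral (exp (?c * of_real 1) / ?c - exp (?c * of_real 0) / ?c)) {0..1}"
  proof (rule fundamental_theorem_of_calculus)
    fix t :: real
    have "((\<lambda>z. exp (?c * z) / ?c) has_field_derivative exp (?c * of_real t)) (at (of_real t))"
      using c by (auto intro!: derivative_eq_intros)
    then show "((\<lambda>t. exp (?c * of_real t) / ?c) has_vector_derivative ee (of_int k * t)) (at t within {0..1})"
      unfolding e by (rule has_vector_derivative_real_field)
  qed simp
  also have "exp (?c * of_real 1) = exp (?c * of_real 0)"
    unfolding e[symmetric] using ee_of_int[of k] by simp
  finally have "((\<lambda>t. ee (of_int k * t)) has_integral 0) {0..1}" by simp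
  then have i: "((\<lambda>t. ee (of_int k * t)) has_integral 0) {0..<1}"
    by (subst has_integral_spike_set_eq[of _ "{0..1}"]) (auto intro: negligible_subset[of "{1::real}"])
  have "integrable U (\<lambda>t. ee (of_int k * t))"
    by (rule U.integrable_const_bound[where B = 1]) auto
  then have "(LINT t|U. ee (of_int k * t)) = integral {0..<1} (\<lambda>t. ee (of_int k * t))"
    by (rule lebesgue_integral_eq_integral) simp
  with i False show ?thesis by (simp add: integral_unique)
qed

definition fourier_coeff :: "(real \<Rightarrow> complex) \<Rightarrow> int \<Rightarrow> complex" where
  "fourier_coeff F k = inner_on U F (\<lambda>t. ee (of_int k * t))"

lemma fourier_coeff_ee: "fourier_coeff (\<lambda>t. ee (of_int j * t)) k = (if j = k then 1 else 0)"
proof -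
  have "ee (of_int j * t) * cnj (ee (of_int k * t)) = ee (of_int (j - k) * t)" for t
    by (simp add: ee_minus[symmetric] ee_add[symmetric] algebra_simps)
  then show ?thesis using integral_U_ee[of "j - k"] by (simp add: fourier_coeff_def inner_on_def del: of_int_diff)
qed

lemma inner_on_sum_right:
  assumes "sq_integrable M F" "\<And>k. k \<in> S \<Longrightarrow> sq_integrable M (e k)"
  shows "inner_on M F (\<lambda>t. \<Sum>k\<in>S. a k * e k t) = (\<Sum>k\<in>S. cnj (a k) * inner_on M F (e k))"
proof -
  have "inner_on M F (\<lambda>t. \<Sum>k\<in>S. a k * e k t) = (LINT t|M. (\<Sum>k\<in>S. cnj (a k) * (F t * cnj (e k t))))"
    by (simp add: inner_on_def sum_distrib_left mult_ac)
  also have "\<dots> = (\<Sum>k\<in>S. LINT t|M. cnj (a k) * (F t * cnj (e k t)))"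
    using assms by (intro Bochner_Integration.integral_sum integrable_mult_right sq_integrable_inner_on_integrable) auto
  finally show ?thesis by (simp add: inner_on_def)
qed

text \<open>Completing the square with the orthonormal characters. Taking \<open>a\<close> to be the
  Fourier coefficients gives Bessel's inequality; dropping the last sum shows that no other choice
  of \<open>a\<close> approximates better.\<close>

lemma sq_norm_diff_trig:
  assumes F: "sq_integrable U F" and S: "finite S"
  shows "sq_norm U (\<lambda>t. F t - (\<Sum>k\<in>S. a k * ee (of_int k * t)))
    = sq_norm U F - (\<Sum>k\<in>S. (cmod (fourier_coeff F k))\<^sup>2) + (\<Sum>k\<in>S. (cmod (fourier_coeff F k - a k))\<^sup>2)"
proof -
  let ?T = "\<lambda>t. \<Sum>k\<in>S. a k * ee (of_int k * t)"
  have T: "sq_integrable U ?T" by (intro sq_integrable_sum sq_integrable_scale) simp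
  have ipF: "inner_on U G ?T = (\<Sum>k\<in>S. cnj (a k) * fourier_coeff G k)" if "sq_integrable U G" for G
    unfolding fourier_coeff_def using that by (subst inner_on_sum_right) auto
  have fcT: "fourier_coeff ?T j = a j" if "j \<in> S" for j
  proof -
    have "fourier_coeff ?T j = cnj (\<Sum>k\<in>S. cnj (a k) * fourier_coeff (\<lambda>t. ee (of_int j * t)) k)"
      unfolding fourier_coeff_def[of ?T] by (subst inner_on_commute, subst ipF) simp_all
    also have "\<dots> = (\<Sum>k\<in>S. if j = k then a k else 0)"
      by (simp add: fourier_coeff_ee if_distrib cong: if_cong)
    finally show ?thesis using that S by simp
  qed
  have "of_real (sq_norm U ?T) = (\<Sum>k\<in>S. cnj (a k) * a k)"
    unfolding inner_on_self[symmetric] ipF[OF T] by (simp add: fcT)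
  also have "\<dots> = of_real (\<Sum>k\<in>S. (cmod (a k))\<^sup>2)"
    by (simp only: complex_norm_square of_real_sum mult.commute)
  finally have sT: "sq_norm U ?T = (\<Sum>k\<in>S. (cmod (a k))\<^sup>2)" by (simp only: of_real_eq_iff)
  have 1: "(cmod (c - a))\<^sup>2 = (cmod c)\<^sup>2 + (cmod a)\<^sup>2 - 2 * Re (cnj a * c)" for a c
    unfolding cmod_power2 by (simp add: power2_eq_square algebra_simps)
  show ?thesis
    unfolding sq_norm_diff[OF F T] sT ipF[OF F] 1
    by (simp add: sum.distrib sum_subtractf sum_distrib_left Re_sum del: times_complex.simps)
qed

section \<open>Parseval's identity for Fourier series\<close>

definition trigpoly :: "(real \<Rightarrow> complex) set" where
  "trigpoly = {h. \<exists>S a. finite S \<and> h = (\<lambda>t. \<Sum>k\<in>S. a k * ee (of_int k * t))}"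

lemma trigpolyI: "finite S \<Longrightarrow> (\<lambda>t. \<Sum>k\<in>S. a k * ee (of_int k * t)) \<in> trigpoly"
  by (auto simp: trigpoly_def)

lemma trigpoly_monomial: "(\<lambda>t. c * ee (of_int k * t)) \<in> trigpoly"
  using trigpolyI[of "{k}" "\<lambda>_. c"] by simp

lemma trigpoly_const: "(\<lambda>t. c) \<in> trigpoly"
  using trigpoly_monomial[of c 0] by simp

lemma trigpoly_add:
  assumes "f \<in> trigpoly" "g \<in> trigpoly" shows "(\<lambda>t. f t + g t) \<in> trigpoly"
proof -
  obtain S a where f: "finite S" "f = (\<lambda>t. \<Sum>k\<in>S. a k * ee (of_int k * t))"
    using assms by (auto simp: trigpoly_def)
  obtain T b where g: "finite T" "g = (\<lambda>t. \<Sum>k\<in>T. b k * ee (of_int k * t))"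
    using assms by (auto simp: trigpoly_def)
  let ?c = "\<lambda>k. (if k \<in> S then a k else 0) + (if k \<in> T then b k else 0)"
  have "(\<Sum>k\<in>S. a k * ee (of_int k * t)) = (\<Sum>k\<in>S\<union>T. (if k \<in> S then a k else 0) * ee (of_int k * t))" for t
    using f g by (intro sum.mono_neutral_cong_left) auto
  moreover have "(\<Sum>k\<in>T. b k * ee (of_int k * t)) = (\<Sum>k\<in>S\<union>T. (if k \<in> T then b k else 0) * ee (of_int k * t))" for t
    using f g by (intro sum.mono_neutral_cong_left) auto
  ultimately have "(\<lambda>t. f t + g t) = (\<lambda>t. \<Sum>k\<in>S\<union>T. ?c k * ee (of_int k * t))"
    by (simp add: f g distrib_right sum.distrib)
  then show ?thesis using trigpolyI[of "S \<union> T" ?c] f g by simp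
qed

lemma trigpoly_sum:
  "(\<And>i. i \<in> I \<Longrightarrow> f i \<in> trigpoly) \<Longrightarrow> (\<lambda>t. \<Sum>i\<in>I. f i t) \<in> trigpoly"
  by (induction I rule: infinite_finite_induct) (auto simp: trigpoly_const trigpoly_add)

lemma trigpoly_mult:
  assumes "f \<in> trigpoly" "g \<in> trigpoly" shows "(\<lambda>t. f t * g t) \<in> trigpoly"
proof -
  obtain S a where f: "f = (\<lambda>t. \<Sum>k\<in>S. a k * ee (of_int k * t))"
    using assms by (auto simp: trigpoly_def)
  obtain T b where g: "g = (\<lambda>t. \<Sum>k\<in>T. b k * ee (of_int k * t))"
    using assms by (auto simp: trigpoly_def)
  have "(\<lambda>t. f t * g t) = (\<lambda>t. \<Sum>k\<in>S. \<Sum>j\<in>T. (a k * b j) * ee (of_int (k + j) * t))"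
    by (simp add: f g sum_product ee_add[symmetric] distrib_right[symmetric] mult_ac) (simp add: ee_add distrib_left mult_ac)
  then show ?thesis by (simp only: trigpoly_sum trigpoly_monomial)
qed

text \<open>A real linear form in \<open>w\<close> is a combination of \<open>w\<close> and
  \<open>cnj w\<close>, and on the circle \<open>cnj (ee t)\<close> is the character of frequency
  -1; sums and products stay inside \<open>trigpoly\<close>.\<close>

lemma real_polynomial_ee_trigpoly:
  assumes "real_polynomial_function p"
  shows "(\<lambda>t. of_real (p (ee t))) \<in> trigpoly"
  using assms
proof induction
  case (linear f)
  then interpret bounded_linear f .
  have fw: "f w = Re w * f 1 + Im w * f \<i>" for w
  proof -
    have "w = Re w *\<^sub>R 1 + Im w *\<^sub>R \<i>" by (simp add: complex_eq_iff)
    then have "f w = f (Re w *\<^sub>R 1 + Im w *\<^sub>R \<i>)" by simp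
    then show ?thesis by (simp only: add scaleR real_scaleR_def)
  qed
  have fw': "complex_of_real (f w) = (of_real (f 1) / 2 - \<i> * of_real (f \<i>) / 2) * w
      + (of_real (f 1) / 2 + \<i> * of_real (f \<i>) / 2) * cnj w" for w
    by (simp add: fw[of w] complex_eq_iff algebra_simps)
  have "(\<lambda>t. of_real (f (ee t))) =
      (\<lambda>t. (of_real (f 1) / 2 - \<i> * of_real (f \<i>) / 2) * ee (of_int 1 * t)
         + (of_real (f 1) / 2 + \<i> * of_real (f \<i>) / 2) * ee (of_int (-1) * t))"
    unfolding fw'[of "ee _"] by (simp add: ee_minus)
  then show ?case by (simp only: trigpoly_add trigpoly_monomial)
qed (simp_all add: trigpoly_const trigpoly_add trigpoly_mult)

lemma polynomial_ee_trigpoly: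
  fixes p :: "complex \<Rightarrow> complex"
  assumes "polynomial_function p"
  shows "(\<lambda>t. p (ee t)) \<in> trigpoly"
proof -
  have "real_polynomial_function (\<lambda>w. Re (p w))" "real_polynomial_function (\<lambda>w. Im (p w))"
    using assms bounded_linear_Re bounded_linear_Im unfolding polynomial_function_def o_def by auto
  then have "(\<lambda>t. of_real (Re (p (ee t))) + \<i> * of_real (Im (p (ee t)))) \<in> trigpoly"
    by (intro trigpoly_add trigpoly_mult trigpoly_const real_polynomial_ee_trigpoly)
  then show ?thesis by (simp flip: complex_eq)
qed

text \<open>Stone-Weierstrass on the unit circle, after \<open>g\<close> has been transported there
  by the angle.\<close>

lemma trigpoly_uniform_approx:
  fixes g :: "real \<Rightarrow> complex"
  assumes g: "continuous_on {0..1} g" "g 0 = g 1" and e: "0 < e"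
  obtains h where "h \<in> trigpoly" "\<And>t. t \<in> {0..1} \<Longrightarrow> cmod (g t - h t) < e"
proof -
  \<comment> \<open>\<open>Arg2pi\<close> takes values in [0, 2 pi), so at the end point 1 the
    function \<open>G\<close> reads off \<open>g 0\<close>. This is why the end values of
    \<open>g\<close> have to agree.\<close>
  define G where "G w = g (Arg2pi w / (2 * pi))" for w
  have G: "G (ee t) = g t" if "t \<in> {0..1}" for t
  proof (cases "t = 1")
    case True
    then show ?thesis using g(2) ee_of_int[of 1] Arg2pi_of_real[of 1] by (simp add: G_def)
  next
    case False
    have "Arg2pi (ee t) = 2 * pi * t"
      using that False by (intro Arg2pi_unique[of 1]) (auto simp: ee_eq_exp mult_ac)
    then show ?thesis by (simp add: G_def)
  qed
  have im: "sphere 0 1 = ee ` {0..1}"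
  proof
    show "sphere 0 1 \<subseteq> ee ` {0..1}"
    proof
      fix w :: complex assume "w \<in> sphere 0 1"
      then have "w = ee (Arg2pi w / (2 * pi))"
        using Arg2pi_eq[of w] by (simp add: ee_eq_exp mult_ac)
      moreover have "Arg2pi w / (2 * pi) \<in> {0..1}"
        using Arg2pi_ge_0[of w] Arg2pi_lt_2pi[of w] by auto
      ultimately show "w \<in> ee ` {0..1}" by blast
    qed
  qed auto
  \<comment> \<open>\<open>Arg2pi\<close> jumps at 1, so continuity cannot come from composition.
    Instead the circle is treated as a quotient of \<open>{0..1}\<close>: the preimage of a closed
    set under \<open>g\<close> is compact, and so is its image under \<open>ee\<close>.\<close>
  have "continuous_on (sphere 0 1) G"
    unfolding continuous_on_closed_invariant
  proof (intro allI impI)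
    fix B :: "complex set" assume "closed B"
    have "compact (ee ` ({0..1} \<inter> g -` B))"
      using continuous_closed_preimage[OF g(1) _ \<open>closed B\<close>]
      by (intro compact_continuous_image continuous_on_ee continuous_on_id)
        (auto simp: compact_eq_bounded_closed bounded_Int)
    moreover have "ee ` ({0..1} \<inter> g -` B) \<inter> sphere 0 1 = G -` B \<inter> sphere 0 1"
    proof (intro equalityI subsetI)
      fix w assume "w \<in> ee ` ({0..1} \<inter> g -` B) \<inter> sphere 0 1"
      then obtain t where "t \<in> {0..1}" "g t \<in> B" "w = ee t" "w \<in> sphere 0 1" by blast
      then show "w \<in> G -` B \<inter> sphere 0 1" using G by (simp del: atLeastAtMost_iff)
    next
      fix w assume w: "w \<in> G -` B \<inter> sphere 0 1"
      then obtain t where t: "t \<in> {0..1}" "w = ee t" unfolding im by blast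
      then have "g t \<in> B" using w G[OF t(1)] by simp
      with t w show "w \<in> ee ` ({0..1} \<inter> g -` B) \<inter> sphere 0 1" by blast
    qed
    ultimately show "\<exists>A. closed A \<and> A \<inter> sphere 0 1 = G -` B \<inter> sphere 0 1"
      using compact_imp_closed by blast
  qed
  then obtain p where p: "polynomial_function p" "\<And>w. w \<in> sphere 0 1 \<Longrightarrow> cmod (G w - p w) < e"
    using Stone_Weierstrass_polynomial_function[OF compact_sphere _ e] by metis
  show thesis
  proof
    show "(\<lambda>t. p (ee t)) \<in> trigpoly" by (rule polynomial_ee_trigpoly[OF p(1)])
    show "cmod (g t - p (ee t)) < e" if "t \<in> {0..1}" for t
      using p(2)[of "ee t"] G[OF that] by simp
  qed
qed

lemma sq_integrable_trigpoly: "h \<in> trigpoly \<Longrightarrow> sq_integrable U h"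
  by (auto simp: trigpoly_def intro!: sq_integrable_sum sq_integrable_scale)

lemma bounded_continuous_approx:
  fixes F :: "real \<Rightarrow> complex"
  assumes F: "F \<in> borel_measurable U" and K: "\<And>x. cmod (F x) \<le> K" and e: "0 < e"
  obtains g where "continuous_on UNIV g" "g 0 = 0" "g 1 = 0" "sq_integrable U g" "sq_norm U (\<lambda>t. g t - F t) < e"
proof -
  define L where "L = max K 1"
  have L: "L > 0" "\<And>x. cmod (F x) \<le> L" using K by (auto simp: L_def intro: le_max_iff_disj[THEN iffD2])
  have "F measurable_on {0..<1}"
    using F by (simp add: measurable_on_iff_borel_measurable)
  then obtain N g where N: "negligible N" and gc: "\<And>n. continuous_on UNIV (g n)"
    and gl: "\<And>x. x \<notin> N \<Longrightarrow> (\<lambda>n. g n x) \<longlonglongrightarrow> (if x \<in> {0..<1} then F x else 0)"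
    unfolding measurable_on_def by metis
  \<comment> \<open>The clipped parabola vanishes at 0 and 1, which lets \<open>h n\<close> close up
    on the circle, and equals 1 eventually at each interior point. The denominator cuts the modulus
    down to \<open>L\<close> for dominated convergence; it leaves \<open>F\<close> unchanged because
    its modulus is already at most \<open>L\<close>.\<close>
  define h where "h n x = of_real (max 0 (min 1 (real n * (x * (1 - x)))) / max 1 (cmod (g n x) / L)) * g n x" for n x
  have hc: "continuous_on UNIV (h n)" for n
    unfolding h_def by (intro continuous_intros gc continuous_on_max) (auto simp: max_def L_def)
  have hb: "cmod (h n x) \<le> cmod (of_real L)" for n x
  proof -
    have "cmod (g n x) / max 1 (cmod (g n x) / L) \<le> L"
      using L(1) by (simp add: divide_simps max_def)
    moreover have "max 0 (min 1 (real n * (x * (1 - x)))) * (cmod (g n x) / max 1 (cmod (g n x) / L))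
        \<le> 1 * (cmod (g n x) / max 1 (cmod (g n x) / L))"
      by (intro mult_right_mono) auto
    ultimately show ?thesis using L(1) by (simp add: h_def norm_mult norm_divide)
  qed
  have lim: "(\<lambda>n. h n x) \<longlonglongrightarrow> F x" if "x \<notin> N" "x \<in> {0<..<1}" for x
  proof -
    have x: "x * (1 - x) > 0" using that by simp
    have "eventually (\<lambda>n. max 0 (min 1 (real n * (x * (1 - x)))) = 1) sequentially"
    proof -
      obtain M where M: "1 / (x * (1 - x)) < real M" using reals_Archimedean2 by blast
      have "max 0 (min 1 (real n * (x * (1 - x)))) = 1" if "n \<ge> M" for n
      proof -
        have "1 / (x * (1 - x)) \<le> real n" using M that by linarith
        then have "1 \<le> real n * (x * (1 - x))" using x by (simp add: pos_divide_le_eq)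
        then show ?thesis by simp
      qed
      then show ?thesis by (rule eventually_sequentiallyI)
    qed
    then have 1: "(\<lambda>n. max 0 (min 1 (real n * (x * (1 - x))))) \<longlonglongrightarrow> 1"
      by (rule tendsto_eventually)
    have 2: "(\<lambda>n. g n x) \<longlonglongrightarrow> F x" using gl[of x] that by auto
    have "(\<lambda>n. h n x) \<longlonglongrightarrow> of_real (1 / max 1 (cmod (F x) / L)) * F x"
      unfolding h_def using L(1) by (intro tendsto_intros 1 2) (auto simp: max_def)
    also have "of_real (1 / max 1 (cmod (F x) / L)) * F x = F x"
      using L(2)[of x] L(1) by (simp add: max_def divide_simps)
    finally show ?thesis .
  qed
  have hm: "h n \<in> borel_measurable U" for n
    using borel_measurable_continuous_onI[OF hc[of n]] by measurable
  have "(\<lambda>n. sq_norm U (\<lambda>t. h n t - F t)) \<longlonglongrightarrow> 0"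
  proof (rule sq_norm_dominated_convergence[where w = "\<lambda>_. of_real L"])
    show "sq_integrable U (\<lambda>_. complex_of_real L)" by (rule sq_integrable_U_bounded[where K = "\<bar>L\<bar>"]) auto
    have "AE x in lebesgue. x \<notin> N \<union> {0}"
      using N by (intro AE_not_in) (simp add: negligible_iff_null_sets[symmetric])
    then have "AE x in lebesgue. x \<in> {0..<1} \<longrightarrow> (\<lambda>n. h n x) \<longlonglongrightarrow> F x"
      by eventually_elim (use lim in auto)
    then show "AE x in U. (\<lambda>n. h n x) \<longlonglongrightarrow> F x"
      by (subst AE_restrict_space_iff) auto
  qed (use F hm hb L in auto)
  then have "eventually (\<lambda>n. sq_norm U (\<lambda>t. h n t - F t) < e) sequentially"
    using e by (rule order_tendstoD(2))
  then obtain n where n: "sq_norm U (\<lambda>t. h n t - F t) < e"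
    using eventually_happens sequentially_bot by blast
  show thesis
  proof (rule that[OF hc _ _ _ n])
    show "sq_integrable U (h n)" by (rule sq_integrable_U_bounded[where K = L]) (use hm hb L in auto)
  qed (simp_all add: h_def)
qed

text \<open>Three approximations in turn: cutting off large values (error \<open>e/8\<close>), a
  continuous function vanishing at both ends (\<open>e/16\<close>), a trigonometric polynomial
  (\<open>e/16\<close>). Each triangle inequality for squares costs a factor 2, for a total below
  \<open>e/4 + e/2\<close>.\<close>

lemma trigpoly_dense:
  assumes F: "sq_integrable U F" and e: "0 < e"
  obtains h where "h \<in> trigpoly" "sq_norm U (\<lambda>t. F t - h t) < e"
proof -
  note [measurable] = sq_integrable_measurable[OF F]
  define FK where "FK n t = (if cmod (F t) \<le> real n then F t else 0)" for n :: nat and t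
  have [measurable]: "FK n \<in> borel_measurable U" for n unfolding FK_def by measurable
  have "(\<lambda>n. sq_norm U (\<lambda>t. FK n t - F t)) \<longlonglongrightarrow> 0"
  proof (rule sq_norm_dominated_convergence[OF F])
    have "(\<lambda>n. FK n t) \<longlonglongrightarrow> F t" for t
    proof (rule tendsto_eventually)
      obtain M where "cmod (F t) < real M" using reals_Archimedean2 by blast
      then show "eventually (\<lambda>n. FK n t = F t) sequentially"
        by (intro eventually_sequentiallyI[of M]) (auto simp: FK_def)
    qed
    then show "AE t in U. (\<lambda>n. FK n t) \<longlonglongrightarrow> F t" by simp
  qed (auto simp: FK_def)
  then have "eventually (\<lambda>n. sq_norm U (\<lambda>t. FK n t - F t) < e / 8) sequentially"
    using e by (intro order_tendstoD(2)) auto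
  then obtain n where n: "sq_norm U (\<lambda>t. FK n t - F t) < e / 8"
    using eventually_happens sequentially_bot by blast
  obtain g where g: "continuous_on UNIV g" "g 0 = 0" "g 1 = 0" "sq_integrable U g" "sq_norm U (\<lambda>t. g t - FK n t) < e / 16"
    by (rule bounded_continuous_approx[of "FK n" "real n" "e / 16"]) (use e in \<open>auto simp: FK_def\<close>)
  obtain h where h: "h \<in> trigpoly" "\<And>t. t \<in> {0..1} \<Longrightarrow> cmod (g t - h t) < sqrt (e / 16)"
    by (rule trigpoly_uniform_approx[of g "sqrt (e / 16)"]) (use g(2,3) e continuous_on_subset[OF g(1)] in auto)
  have "sq_norm U (\<lambda>t. g t - h t) \<le> (sqrt (e / 16))\<^sup>2"
    using h sq_integrable_diff[OF g(4) sq_integrable_trigpoly[OF h(1)]]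
    by (intro sq_integrable_U_bounded) (auto intro: less_imp_le simp: sq_integrable_def)
  also have "\<dots> = e / 16" using e by simp
  finally have gh: "sq_norm U (\<lambda>t. g t - h t) \<le> e / 16" .
  have FKs: "sq_integrable U (FK n)" by (rule sq_integrable_U_bounded[where K = "real n"]) (auto simp: FK_def)
  have sym: "sq_norm U (\<lambda>t. a t - b t) = sq_norm U (\<lambda>t. b t - a t)" for a b
    by (simp add: sq_norm_def norm_minus_commute)
  have "sq_norm U (\<lambda>t. F t - h t) \<le> 2 * sq_norm U (\<lambda>t. F t - FK n t) + 2 * sq_norm U (\<lambda>t. FK n t - h t)"
    by (intro sq_norm_triangle F FKs sq_integrable_trigpoly h)
  moreover have "sq_norm U (\<lambda>t. FK n t - h t) \<le> 2 * sq_norm U (\<lambda>t. FK n t - g t) + 2 * sq_norm U (\<lambda>t. g t - h t)"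
    by (intro sq_norm_triangle F FKs sq_integrable_trigpoly h g)
  ultimately have "sq_norm U (\<lambda>t. F t - h t) < e"
    using n g(5) gh e sym[of F "FK n"] sym[of "FK n" g] by linarith
  with h(1) show thesis by (rule that)
qed

text \<open>For a finite \<open>Y\<close> containing the frequencies of a good approximant
  \<open>h\<close>, Bessel bounds the partial sum from above, and the best approximation property
  bounds the missing part by the squared distance to \<open>h\<close>. Arbitrary such
  \<open>Y\<close> are what unconditional summation asks for.\<close>

theorem parseval_circle:
  assumes F: "sq_integrable U F"
  shows "((\<lambda>k. (cmod (fourier_coeff F k))\<^sup>2) has_sum sq_norm U F) UNIV"
  unfolding has_sum_def tendsto_iff eventually_finite_subsets_at_top
proof (intro allI impI)
  fix e :: real assume "e > 0"
  then obtain h where "h \<in> trigpoly" and h: "sq_norm U (\<lambda>t. F t - h t) < e"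
    using trigpoly_dense[OF F] by blast
  then obtain S a where S: "finite S" "h = (\<lambda>t. \<Sum>k\<in>S. a k * ee (of_int k * t))"
    by (auto simp: trigpoly_def)
  have "dist (\<Sum>k\<in>Y. (cmod (fourier_coeff F k))\<^sup>2) (sq_norm U F) < e" if Y: "finite Y" "S \<subseteq> Y" for Y
  proof -
    have "0 \<le> sq_norm U (\<lambda>t. F t - (\<Sum>k\<in>Y. fourier_coeff F k * ee (of_int k * t)))" by simp
    then have 1: "(\<Sum>k\<in>Y. (cmod (fourier_coeff F k))\<^sup>2) \<le> sq_norm U F"
      unfolding sq_norm_diff_trig[OF F Y(1)] by simp
    have "sq_norm U F - (\<Sum>k\<in>S. (cmod (fourier_coeff F k))\<^sup>2) \<le> sq_norm U (\<lambda>t. F t - h t)"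
      unfolding S(2) sq_norm_diff_trig[OF F S(1)] by (simp add: sum_nonneg)
    moreover have "(\<Sum>k\<in>S. (cmod (fourier_coeff F k))\<^sup>2) \<le> (\<Sum>k\<in>Y. (cmod (fourier_coeff F k))\<^sup>2)"
      using Y by (intro sum_mono2) auto
    ultimately show ?thesis using 1 h by (simp add: dist_real_def)
  qed
  then show "\<exists>X. finite X \<and> X \<subseteq> UNIV \<and>
      (\<forall>Y. finite Y \<and> X \<subseteq> Y \<and> Y \<subseteq> UNIV \<longrightarrow> dist (\<Sum>k\<in>Y. (cmod (fourier_coeff F k))\<^sup>2) (sq_norm U F) < e)"
    using S(1) by blast
qed

lemma has_sum_nn_integral:
  fixes f :: "'a \<Rightarrow> real"
  assumes "\<And>x. x \<in> A \<Longrightarrow> 0 \<le> f x" "(f has_sum s) A"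
  shows "(\<integral>\<^sup>+x. ennreal (f x) \<partial>count_space A) = ennreal s"
proof -
  have "Infinite_Set_Sum.abs_summable_on f A"
    using assms by (subst abs_summable_equivalent[symmetric]) (auto simp: summable_on_def cong: summable_on_cong)
  then have "integrable (count_space A) f" "infsetsum f A = infsum f A"
    by (simp_all add: abs_summable_on_def infsetsum_infsum)
  with assms show ?thesis
    by (subst nn_integral_eq_integral) (auto simp: infsetsum_def infsumI AE_count_space)
qed

lemma parseval_circle_nn:
  "sq_integrable U F \<Longrightarrow> (\<integral>\<^sup>+k. ennreal ((cmod (fourier_coeff F k))\<^sup>2) \<partial>CZ) = ennreal (sq_norm U F)"
  using has_sum_nn_integral[OF _ parseval_circle] by simp

section \<open>Plancherel's theorem\<close>

lemma
  fixes f :: "real \<Rightarrow> 'a::{banach, second_countable_topology}"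
  assumes f: "f \<in> borel_measurable lebesgue" and c: "c \<noteq> 0"
  shows lebesgue_integral_affine: "(LINT x|lebesgue. f (t + c * x)) = (1 / \<bar>c\<bar>) *\<^sub>R (LINT x|lebesgue. f x)" (is ?I)
    and lebesgue_integrable_affine: "integrable lebesgue (\<lambda>x. f (t + c * x)) \<longleftrightarrow> integrable lebesgue f" (is ?J)
proof -
  note T = lebesgue_affine_measurable_real[OF c, of t]
  have d: "f \<in> borel_measurable (distr lebesgue lebesgue (\<lambda>x. t + c * x))" using f by simp
  have "integrable lebesgue f \<longleftrightarrow> integrable (density (distr lebesgue lebesgue (\<lambda>x. t + c * x)) (\<lambda>_. ennreal \<bar>c\<bar>)) f"
    using lebesgue_real_affine[OF c, of t] by simp
  also have "\<dots> \<longleftrightarrow> integrable (distr lebesgue lebesgue (\<lambda>x. t + c * x)) (\<lambda>x. \<bar>c\<bar> *\<^sub>R f x)"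
    using d by (intro integrable_density) auto
  also have "\<dots> \<longleftrightarrow> integrable lebesgue (\<lambda>x. f (t + c * x))"
    using c f integrable_scaleR_right[of "1 / \<bar>c\<bar>" lebesgue "\<lambda>x. \<bar>c\<bar> *\<^sub>R f (t + c * x)"]
    by (subst integrable_distr_eq[OF T]) auto
  finally show ?J by simp
  have "(LINT x|lebesgue. f x) = (LINT x|density (distr lebesgue lebesgue (\<lambda>x. t + c * x)) (\<lambda>_. ennreal \<bar>c\<bar>). f x)"
    using lebesgue_real_affine[OF c, of t] by simp
  also have "\<dots> = (LINT x|distr lebesgue lebesgue (\<lambda>x. t + c * x). \<bar>c\<bar> *\<^sub>R f x)"
    using d by (intro integral_density) auto
  also have "\<dots> = \<bar>c\<bar> *\<^sub>R (LINT x|lebesgue. f (t + c * x))"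
    using f by (subst integral_distr[OF T]) auto
  finally show ?I using c by simp
qed

lemma
  assumes f: "sq_integrable lebesgue f" and c: "c \<noteq> 0"
  shows sq_integrable_affine: "sq_integrable lebesgue (\<lambda>x. f (t + c * x))"
    and sq_norm_affine: "sq_norm lebesgue (\<lambda>x. f (t + c * x)) = sq_norm lebesgue f / \<bar>c\<bar>"
proof -
  have m: "(\<lambda>x. (cmod (f x))\<^sup>2) \<in> borel_measurable lebesgue" using sq_integrable_integrable[OF f] by auto
  show "sq_integrable lebesgue (\<lambda>x. f (t + c * x))"
    using sq_integrable_integrable[OF f] lebesgue_integrable_affine[OF m c]
      borel_measurable_lebesgue_affine[OF sq_integrable_measurable[OF f] c, of t]
    by (simp add: sq_integrable_def)
  show "sq_norm lebesgue (\<lambda>x. f (t + c * x)) = sq_norm lebesgue f / \<bar>c\<bar>"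
    using lebesgue_integral_affine[OF m c] by (simp add: sq_norm_def)
qed

lemma fourier_ee: "fourier f \<gamma> = (LINT t|lebesgue. f t * cnj (ee (t * \<gamma>)))"
  unfolding fourier_def ee_eq_exp exp_cnj by (simp add: mult_ac)

lemma integrable_mult_ee:
  assumes "integrable lebesgue f"
  shows "integrable lebesgue (\<lambda>t. f t * cnj (ee (t * \<gamma>)))"
proof -
  note [measurable] = borel_measurable_integrable[OF assms]
  show ?thesis by (rule Bochner_Integration.integrable_bound[OF assms]) (auto simp: norm_mult)
qed

lemma fourier_add:
  "integrable lebesgue f \<Longrightarrow> integrable lebesgue g \<Longrightarrow> fourier (\<lambda>x. f x + g x) \<gamma> = fourier f \<gamma> + fourier g \<gamma>"
  unfolding fourier_ee by (simp add: distrib_right integrable_mult_ee)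

lemma fourier_diff:
  "integrable lebesgue f \<Longrightarrow> integrable lebesgue g \<Longrightarrow> fourier (\<lambda>x. f x - g x) \<gamma> = fourier f \<gamma> - fourier g \<gamma>"
  unfolding fourier_ee by (simp add: left_diff_distrib integrable_mult_ee)

lemma fourier_scale: "fourier (\<lambda>x. c * f x) \<gamma> = c * fourier f \<gamma>"
  unfolding fourier_ee by (simp add: mult.assoc)

lemma fourier_cnj: "fourier (\<lambda>x. cnj (f x)) \<gamma> = cnj (fourier f (- \<gamma>))"
  unfolding fourier_ee by (subst Bochner_Integration.integral_cnj[symmetric]) (simp add: ee_minus)

lemma fourier_affine:
  assumes f: "integrable lebesgue f" and a: "a > 0"
  shows "fourier (\<lambda>x. f (b + a * x)) \<gamma> = of_real (1 / a) * ee (b * \<gamma> / a) * fourier f (\<gamma> / a)"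
proof -
  let ?h = "\<lambda>y. f y * cnj (ee (y * (\<gamma> / a)))"
  have eq: "f (b + a * x) * cnj (ee (x * \<gamma>)) = ee (b * \<gamma> / a) * ?h (b + a * x)" for x
  proof -
    have "(b + a * x) * (\<gamma> / a) = b * \<gamma> / a + x * \<gamma>" using a by (simp add: field_simps)
    then show ?thesis by (simp add: ee_add)
  qed
  have "fourier (\<lambda>x. f (b + a * x)) \<gamma> = ee (b * \<gamma> / a) * (LINT x|lebesgue. ?h (b + a * x))"
    unfolding fourier_ee by (simp only: eq integral_mult_right_zero)
  also have "(LINT x|lebesgue. ?h (b + a * x)) = (1 / \<bar>a\<bar>) *\<^sub>R fourier f (\<gamma> / a)"
    unfolding fourier_ee
    by (rule lebesgue_integral_affine[OF borel_measurable_integrable[OF integrable_mult_ee[OF f]]]) (use a in simp)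
  finally show ?thesis using a by (simp add: scaleR_conv_of_real)
qed

lemma fourier_tendsto:
  assumes f: "integrable lebesgue f" and x: "X \<longlonglongrightarrow> x"
  shows "(\<lambda>n. fourier f (X n)) \<longlonglongrightarrow> fourier f x"
  unfolding fourier_ee
proof (rule integral_dominated_convergence[where w = "\<lambda>t. cmod (f t)"])
  have "(\<lambda>n. f t * cnj (ee (t * X n))) \<longlonglongrightarrow> f t * cnj (ee (t * x))" for t
  proof -
    have "isCont ee (t * x)" using continuous_on_ee[of UNIV "\<lambda>x. x"] by (simp add: continuous_on_eq_continuous_at)
    then show ?thesis
      by (intro tendsto_intros isCont_tendsto_compose[of _ ee] x)
  qed
  then show "AE t in lebesgue. (\<lambda>n. f t * cnj (ee (t * X n))) \<longlonglongrightarrow> f t * cnj (ee (t * x))" by simp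
qed (use f in \<open>auto simp: norm_mult dest: integrable_mult_ee\<close>)

lemma fourier_measurable:
  assumes "integrable lebesgue f" shows "fourier f \<in> borel_measurable lebesgue"
proof -
  have "continuous_on UNIV (fourier f)"
    unfolding continuous_on_sequentially o_def using fourier_tendsto[OF assms] by auto
  then have "fourier f \<in> borel_measurable borel" by (rule borel_measurable_continuous_onI)
  then show ?thesis by (intro measurable_completion) simp
qed

lemma integral_U:
  fixes f :: "real \<Rightarrow> 'a::{banach, second_countable_topology}"
  assumes "\<And>x. x \<notin> {0..<1} \<Longrightarrow> f x = 0"
  shows "(LINT x|U. f x) = (LINT x|lebesgue. f x)"
proof -
  have "indicator {0..<1} x *\<^sub>R f x = f x" for x using assms[of x] by (auto simp: indicator_def)
  then show ?thesis by (subst integral_restrict_space) auto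
qed

lemma integrable_U:
  fixes f :: "real \<Rightarrow> 'a::{banach, second_countable_topology}"
  assumes "\<And>x. x \<notin> {0..<1} \<Longrightarrow> f x = 0"
  shows "integrable U f \<longleftrightarrow> integrable lebesgue f"
proof -
  have "indicator {0..<1} x *\<^sub>R f x = f x" for x using assms[of x] by (auto simp: indicator_def)
  then show ?thesis by (subst integrable_restrict_space) auto
qed

lemma measurable_U: "f \<in> borel_measurable lebesgue \<Longrightarrow> f \<in> borel_measurable U"
  by (rule measurable_restrict_space1)

lemma sq_integrable_U: "sq_integrable lebesgue f \<Longrightarrow> sq_integrable U f"
  using integrable_mult_indicator[of "{0..<1}" lebesgue "\<lambda>x. (cmod (f x))\<^sup>2"]
  by (auto simp: sq_integrable_def measurable_U integrable_restrict_space)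

lemma sq_integrable_U_mult_ee:
  assumes "sq_integrable U f" shows "sq_integrable U (\<lambda>t. f t * cnj (ee (s * t)))"
proof -
  note [measurable] = sq_integrable_measurable[OF assms]
  show ?thesis by (rule sq_integrable_bound[OF assms, of _ 1]) (auto simp: norm_mult)
qed

text \<open>The values of the Fourier transform on \<open>s + \<int>\<close> are the Fourier coefficients of
  \<open>f(t) exp(-2\<pi>ist)\<close>, so their squares sum to \<open>\<parallel>f\<parallel>\<^sup>2\<close> for every \<open>s\<close>; integrating over \<open>s \<in> [0,1)\<close> gives
  Plancherel's identity.\<close>

lemma plancherel_unit:
  assumes f: "sq_integrable lebesgue f" and z: "\<And>x. x \<notin> {0..<1} \<Longrightarrow> f x = 0"
  shows "integrable lebesgue f" "sq_integrable lebesgue (fourier f)" "sq_norm lebesgue (fourier f) = sq_norm lebesgue f"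
proof -
  have fU: "sq_integrable U f" by (rule sq_integrable_U[OF f])
  have "sq_integrable U (\<lambda>_. 1)" by (rule sq_integrable_U_bounded[where K = 1]) auto
  from sq_integrable_mult_integrable[OF fU this] have "integrable U f" by simp
  then show i: "integrable lebesgue f" using integrable_U[OF z] by simp
  have sU: "sq_norm U f = sq_norm lebesgue f" unfolding sq_norm_def by (rule integral_U) (simp add: z)
  have coef: "fourier f (s + of_int k) = fourier_coeff (\<lambda>t. f t * cnj (ee (s * t))) k" for s k
    unfolding fourier_ee fourier_coeff_def inner_on_def
    by (subst integral_U) (simp_all add: z ee_add distrib_left mult_ac)
  have inner: "(\<integral>\<^sup>+k. ennreal ((cmod (fourier f (s + of_int k)))\<^sup>2) \<partial>CZ) = ennreal (sq_norm lebesgue f)" for s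
    unfolding coef parseval_circle_nn[OF sq_integrable_U_mult_ee[OF fU]]
    by (simp add: sq_norm_def norm_mult flip: sU[unfolded sq_norm_def])
  have m: "fourier f \<in> borel_measurable lebesgue" by (rule fourier_measurable[OF i])
  have nn: "(\<integral>\<^sup>+x. ennreal ((cmod (fourier f x))\<^sup>2) \<partial>lebesgue) = ennreal (sq_norm lebesgue f)"
    using m by (subst nn_integral_periodize) (simp_all add: inner emeasure_restrict_space)
  show s: "sq_integrable lebesgue (fourier f)" by (rule sq_integrableI_nn[OF m]) (simp add: nn)
  show "sq_norm lebesgue (fourier f) = sq_norm lebesgue f"
    using nn_integral_sq_norm[OF s] nn by simp
qed

text \<open>An affine substitution carries \<open>{-N..<N}\<close> onto \<open>{0..<1}\<close>. The
  transform picks up the factor \<open>2 * N\<close>, whose square is cancelled by the Jacobians on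
  the two sides.\<close>

lemma plancherel_bounded:
  assumes f: "sq_integrable lebesgue f" and z: "\<And>x. x \<notin> {-N..<N} \<Longrightarrow> f x = 0" and N: "N > 0"
  shows "integrable lebesgue f" "sq_integrable lebesgue (fourier f)" "sq_norm lebesgue (fourier f) = sq_norm lebesgue f"
proof -
  define g where "g x = f (- N + 2 * N * x)" for x
  have g: "sq_integrable lebesgue g" "sq_norm lebesgue g = sq_norm lebesgue f / (2 * N)"
    unfolding g_def using sq_integrable_affine[OF f, of "2 * N" "- N"] sq_norm_affine[OF f, of "2 * N" "- N"] N by auto
  have "g x = 0" if "x \<notin> {0..<1}" for x
    unfolding g_def using that N by (intro z) (auto simp: not_le not_less mult_less_0_iff)
  note pg = plancherel_unit[OF g(1) this]
  have f_eq: "f x = g (1/2 + (1 / (2 * N)) * x)" for x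
    unfolding g_def using N by (simp add: field_simps)
  have "integrable lebesgue (\<lambda>x. g (1/2 + (1 / (2 * N)) * x))"
    using lebesgue_integrable_affine[of g "1 / (2 * N)"] pg(1) N by auto
  then show i: "integrable lebesgue f" by (simp only: f_eq[symmetric])
  have F: "fourier f \<gamma> = of_real (2 * N) * ee (N * \<gamma>) * fourier g (0 + 2 * N * \<gamma>)" for \<gamma>
    unfolding f_eq using fourier_affine[OF pg(1), of "1 / (2 * N)" "1/2" \<gamma>] N by (simp add: mult_ac)
  have S: "sq_integrable lebesgue (\<lambda>\<gamma>. fourier g (0 + 2 * N * \<gamma>))"
    "sq_norm lebesgue (\<lambda>\<gamma>. fourier g (0 + 2 * N * \<gamma>)) = sq_norm lebesgue (fourier g) / (2 * N)"
    using sq_integrable_affine[OF pg(2), of "2 * N" 0] sq_norm_affine[OF pg(2), of "2 * N" 0] N by auto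
  show "sq_integrable lebesgue (fourier f)"
    by (rule sq_integrable_bound[OF S(1) fourier_measurable[OF i], of "2 * N"]) (use N in \<open>simp add: F norm_mult\<close>)
  have "sq_norm lebesgue (fourier f) = (2 * N)\<^sup>2 * sq_norm lebesgue (\<lambda>\<gamma>. fourier g (0 + 2 * N * \<gamma>))"
    unfolding sq_norm_def by (subst F) (use N in \<open>simp add: norm_mult power_mult_distrib\<close>)
  then show "sq_norm lebesgue (fourier f) = sq_norm lebesgue f"
    using S(2) pg(3) g(2) N by (simp add: power2_eq_square)
qed

text \<open>\<open>Suc n\<close> keeps the interval nondegenerate at \<open>n = 0\<close>, as
  \<open>plancherel_bounded\<close> demands a positive half-length.\<close>

definition trunc :: "(real \<Rightarrow> complex) \<Rightarrow> nat \<Rightarrow> real \<Rightarrow> complex" where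
  "trunc f n x = (if x \<in> {- real (Suc n)..<real (Suc n)} then f x else 0)"

lemma trunc_le: "cmod (trunc f n x) \<le> cmod (f x)"
  by (simp add: trunc_def)

lemma trunc_tendsto: "(\<lambda>n. trunc f n x) \<longlonglongrightarrow> f x"
proof (rule tendsto_eventually)
  obtain M where "\<bar>x\<bar> < real M" using reals_Archimedean2 by blast
  then show "eventually (\<lambda>n. trunc f n x = f x) sequentially"
    by (intro eventually_sequentiallyI[of M]) (auto simp: trunc_def)
qed

lemma trunc_measurable: "f \<in> borel_measurable lebesgue \<Longrightarrow> trunc f n \<in> borel_measurable lebesgue"
  unfolding trunc_def[abs_def] by (rule measurable_If_set) auto

text \<open>For \<open>m \<le> n\<close> the difference of two truncations is dominated pointwise by
  the tail of \<open>f\<close> beyond the smaller one. Plancherel for bounded support transfers this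
  to the transforms, which supplies the explicit Cauchy modulus required by
  \<open>Riesz_Fischer\<close>.\<close>

lemma
  assumes f: "sq_integrable lebesgue f"
  shows sq_integrable_trunc: "sq_integrable lebesgue (trunc f n)"
    and integrable_trunc: "integrable lebesgue (trunc f n)"
    and plancherel_trunc_diff: "sq_integrable lebesgue (\<lambda>x. fourier (trunc f n) x - fourier (trunc f m) x)"
      "m \<le> n \<Longrightarrow> sq_norm lebesgue (\<lambda>x. fourier (trunc f n) x - fourier (trunc f m) x) \<le> sq_norm lebesgue (\<lambda>x. trunc f m x - f x)"
    and plancherel_trunc: "sq_integrable lebesgue (fourier (trunc f n))" "sq_norm lebesgue (fourier (trunc f n)) = sq_norm lebesgue (trunc f n)"
    and trunc_L2: "(\<lambda>n. sq_norm lebesgue (\<lambda>x. trunc f n x - f x)) \<longlonglongrightarrow> 0"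
proof -
  have t: "sq_integrable lebesgue (trunc f n)" for n
    using f by (intro sq_integrable_bound[OF f, of _ 1]) (auto intro: trunc_measurable simp: sq_integrable_def trunc_le)
  then show "sq_integrable lebesgue (trunc f n)" .
  note p = plancherel_bounded[OF t, of "real (Suc n)" n for n]
  show i: "integrable lebesgue (trunc f n)" by (rule p) (auto simp: trunc_def)
  show "sq_integrable lebesgue (fourier (trunc f n))" by (rule p) (auto simp: trunc_def)
  show "sq_norm lebesgue (fourier (trunc f n)) = sq_norm lebesgue (trunc f n)" by (rule p) (auto simp: trunc_def)
  have i': "integrable lebesgue (trunc f n)" for n by (rule p) (auto simp: trunc_def)
  have e: "(\<lambda>x. fourier (trunc f n) x - fourier (trunc f m) x) = fourier (\<lambda>x. trunc f n x - trunc f m x)"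
    using fourier_diff[OF i' i'] by auto
  have d: "sq_integrable lebesgue (\<lambda>x. trunc f n x - trunc f m x)" using t by auto
  show "sq_integrable lebesgue (\<lambda>x. fourier (trunc f n) x - fourier (trunc f m) x)"
    unfolding e by (rule plancherel_bounded[OF d, of "real (Suc (max m n))"]) (auto simp: trunc_def)
  show "sq_norm lebesgue (\<lambda>x. fourier (trunc f n) x - fourier (trunc f m) x) \<le> sq_norm lebesgue (\<lambda>x. trunc f m x - f x)" if "m \<le> n"
  proof -
    have "sq_norm lebesgue (\<lambda>x. fourier (trunc f n) x - fourier (trunc f m) x) = sq_norm lebesgue (\<lambda>x. trunc f n x - trunc f m x)"
      unfolding e by (rule plancherel_bounded[OF d, of "real (Suc (max m n))"]) (auto simp: trunc_def)
    also have "\<dots> \<le> sq_norm lebesgue (\<lambda>x. trunc f m x - f x)"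
      unfolding sq_norm_def using that
      by (intro integral_mono sq_integrable_integrable sq_integrable_diff d t f power_mono) (auto simp: trunc_def)
    finally show ?thesis .
  qed
  show "(\<lambda>n. sq_norm lebesgue (\<lambda>x. trunc f n x - f x)) \<longlonglongrightarrow> 0"
    using f by (intro sq_norm_dominated_convergence[OF f] trunc_measurable trunc_le AE_I2 trunc_tendsto)
      (auto dest: sq_integrable_measurable)
qed

lemma fourier_trunc_tendsto:
  assumes "integrable lebesgue f"
  shows "(\<lambda>n. fourier (trunc f n) \<gamma>) \<longlonglongrightarrow> fourier f \<gamma>"
  unfolding fourier_ee
proof (rule integral_dominated_convergence[where w = "\<lambda>t. cmod (f t)"])
  note [measurable] = borel_measurable_integrable[OF assms] trunc_measurable[OF borel_measurable_integrable[OF assms]]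
  show "(\<lambda>t. f t * cnj (ee (t * \<gamma>))) \<in> borel_measurable lebesgue" by measurable
  show "(\<lambda>t. trunc f n t * cnj (ee (t * \<gamma>))) \<in> borel_measurable lebesgue" for n by measurable
  show "AE t in lebesgue. (\<lambda>n. trunc f n t * cnj (ee (t * \<gamma>))) \<longlonglongrightarrow> f t * cnj (ee (t * \<gamma>))"
    by (intro AE_I2 tendsto_intros trunc_tendsto)
  show "AE t in lebesgue. norm (trunc f n t * cnj (ee (t * \<gamma>))) \<le> cmod (f t)" for n
    by (simp add: norm_mult trunc_le)
qed (use assms in simp)

text \<open>Integrability makes the transforms of the truncations converge pointwise to
  \<open>fourier f\<close>; Fatou combines this with their Cauchy estimate, so
  \<open>fourier f\<close> is also their limit in mean square and inherits the limit of the
  norms.\<close>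

theorem plancherel_L1_L2:
  assumes f: "sq_integrable lebesgue f" and i: "integrable lebesgue f"
  shows "sq_integrable lebesgue (fourier f)" "sq_norm lebesgue (fourier f) = sq_norm lebesgue f"
proof -
  note [measurable] = fourier_measurable[OF i] fourier_measurable[OF integrable_trunc[OF f]]
  have key: "(\<integral>\<^sup>+x. ennreal ((cmod (fourier (trunc f m) x - fourier f x))\<^sup>2) \<partial>lebesgue)
      \<le> ennreal (sq_norm lebesgue (\<lambda>x. trunc f m x - f x))" for m
  proof -
    have "(\<integral>\<^sup>+x. ennreal ((cmod (fourier (trunc f m) x - fourier f x))\<^sup>2) \<partial>lebesgue)
      = (\<integral>\<^sup>+x. liminf (\<lambda>n. ennreal ((cmod (fourier (trunc f n) x - fourier (trunc f m) x))\<^sup>2)) \<partial>lebesgue)"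
    proof (rule nn_integral_cong)
      fix x
      have "(\<lambda>n. ennreal ((cmod (fourier (trunc f n) x - fourier (trunc f m) x))\<^sup>2)) \<longlonglongrightarrow> ennreal ((cmod (fourier f x - fourier (trunc f m) x))\<^sup>2)"
        by (intro tendsto_ennrealI tendsto_intros fourier_trunc_tendsto i)
      then show "ennreal ((cmod (fourier (trunc f m) x - fourier f x))\<^sup>2) = liminf (\<lambda>n. ennreal ((cmod (fourier (trunc f n) x - fourier (trunc f m) x))\<^sup>2))"
        unfolding norm_minus_commute[of "fourier (trunc f m) x" "fourier f x"]
        by (rule lim_imp_Liminf[OF sequentially_bot, symmetric])
    qed
    also have "\<dots> \<le> liminf (\<lambda>n. \<integral>\<^sup>+x. ennreal ((cmod (fourier (trunc f n) x - fourier (trunc f m) x))\<^sup>2) \<partial>lebesgue)"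
      by (rule nn_integral_liminf) measurable
    also have "\<dots> \<le> liminf (\<lambda>n. ennreal (sq_norm lebesgue (\<lambda>x. trunc f m x - f x)))"
      by (intro Liminf_mono eventually_sequentiallyI[of m], subst nn_integral_sq_norm)
        (auto intro: plancherel_trunc_diff[OF f] ennreal_leI)
    also have "\<dots> = ennreal (sq_norm lebesgue (\<lambda>x. trunc f m x - f x))" by (simp add: Liminf_const)
    finally show ?thesis .
  qed
  have d: "sq_integrable lebesgue (\<lambda>x. fourier (trunc f m) x - fourier f x)" for m
    by (rule sq_integrableI_nn, measurable) (use key[of m] in \<open>auto intro: le_less_trans\<close>)
  have "sq_integrable lebesgue (\<lambda>x. fourier (trunc f 0) x - (fourier (trunc f 0) x - fourier f x))"
    by (intro sq_integrable_diff d plancherel_trunc f)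
  then show s: "sq_integrable lebesgue (fourier f)" by simp
  have "sq_norm lebesgue (\<lambda>x. fourier (trunc f m) x - fourier f x) \<le> sq_norm lebesgue (\<lambda>x. trunc f m x - f x)" for m
    using key[of m] nn_integral_sq_norm[OF d[of m]] by simp
  then have "(\<lambda>m. sq_norm lebesgue (\<lambda>x. fourier (trunc f m) x - fourier f x)) \<longlonglongrightarrow> 0"
    by (intro tendsto_sandwich[OF always_eventually always_eventually tendsto_const trunc_L2[OF f]] allI sq_norm_nonneg)
  from sq_norm_tendsto[OF plancherel_trunc(1)[OF f] s this]
  have "(\<lambda>m. sq_norm lebesgue (trunc f m)) \<longlonglongrightarrow> sq_norm lebesgue (fourier f)"
    by (simp add: plancherel_trunc(2)[OF f])
  moreover have "(\<lambda>m. sq_norm lebesgue (trunc f m)) \<longlonglongrightarrow> sq_norm lebesgue f"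
    by (rule sq_norm_tendsto[OF sq_integrable_trunc[OF f] f trunc_L2[OF f]])
  ultimately show "sq_norm lebesgue (fourier f) = sq_norm lebesgue f" by (rule LIMSEQ_unique)
qed

section \<open>The Fourier transform on \<open>L\<^sup>2\<close>\<close>

text \<open>By Plancherel each \<open>fourier (F n)\<close> is square integrable, so the nonnegative
  integrals behind \<open>L2_tendsto\<close> are finite and may be replaced by
  \<open>sq_norm\<close>.\<close>

lemma has_fourier_L2_iff:
  "has_fourier_L2 f g \<longleftrightarrow> sq_integrable lebesgue f \<and> sq_integrable lebesgue g \<and>
     (\<exists>F. (\<forall>n. sq_integrable lebesgue (F n) \<and> integrable lebesgue (F n)) \<and>
       (\<lambda>n. sq_norm lebesgue (\<lambda>x. F n x - f x)) \<longlonglongrightarrow> 0 \<and>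
       (\<lambda>n. sq_norm lebesgue (\<lambda>x. fourier (F n) x - g x)) \<longlonglongrightarrow> 0)"
  unfolding has_fourier_L2_def L2_sq_integrable
  by (auto simp: L2_tendsto_iff plancherel_L1_L2)

lemma has_fourier_L2E:
  assumes "has_fourier_L2 f g"
  obtains F where "\<forall>n. sq_integrable lebesgue (F n)" "\<forall>n. integrable lebesgue (F n)"
    "(\<lambda>n. sq_norm lebesgue (\<lambda>x. F n x - f x)) \<longlonglongrightarrow> 0"
    "(\<lambda>n. sq_norm lebesgue (\<lambda>x. fourier (F n) x - g x)) \<longlonglongrightarrow> 0"
    "\<forall>n. sq_integrable lebesgue (fourier (F n))"
  using assms unfolding has_fourier_L2_iff using plancherel_L1_L2(1) by blast

lemma has_fourier_L2_sq_integrable: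
  assumes "has_fourier_L2 f g" shows "sq_integrable lebesgue f" "sq_integrable lebesgue g"
  using assms by (auto simp: has_fourier_L2_iff)

lemma has_fourier_L2_sq_norm:
  assumes "has_fourier_L2 f g" shows "sq_norm lebesgue g = sq_norm lebesgue f"
proof -
  obtain F where F: "\<forall>n. sq_integrable lebesgue (F n)" "\<forall>n. integrable lebesgue (F n)"
    "(\<lambda>n. sq_norm lebesgue (\<lambda>x. F n x - f x)) \<longlonglongrightarrow> 0"
    "(\<lambda>n. sq_norm lebesgue (\<lambda>x. fourier (F n) x - g x)) \<longlonglongrightarrow> 0"
    "\<forall>n. sq_integrable lebesgue (fourier (F n))"
    by (rule has_fourier_L2E[OF assms])
  note F = F[rule_format]
  note fg = has_fourier_L2_sq_integrable[OF assms]
  have "(\<lambda>n. sq_norm lebesgue (fourier (F n))) \<longlonglongrightarrow> sq_norm lebesgue g"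
    by (rule sq_norm_tendsto[OF F(5) fg(2) F(4)])
  then have "(\<lambda>n. sq_norm lebesgue (F n)) \<longlonglongrightarrow> sq_norm lebesgue g"
    by (simp add: plancherel_L1_L2(2)[OF F(1,2)])
  moreover have "(\<lambda>n. sq_norm lebesgue (F n)) \<longlonglongrightarrow> sq_norm lebesgue f"
    by (rule sq_norm_tendsto[OF F(1) fg(1) F(3)])
  ultimately show ?thesis by (rule LIMSEQ_unique)
qed

lemma has_fourier_L2_scale:
  assumes "has_fourier_L2 f g"
  shows "has_fourier_L2 (\<lambda>x. c * f x) (\<lambda>x. c * g x)"
proof -
  obtain F where F: "\<forall>n. sq_integrable lebesgue (F n)" "\<forall>n. integrable lebesgue (F n)"
    "(\<lambda>n. sq_norm lebesgue (\<lambda>x. F n x - f x)) \<longlonglongrightarrow> 0"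
    "(\<lambda>n. sq_norm lebesgue (\<lambda>x. fourier (F n) x - g x)) \<longlonglongrightarrow> 0"
    "\<forall>n. sq_integrable lebesgue (fourier (F n))"
    by (rule has_fourier_L2E[OF assms])
  note F = F[rule_format]
  note fg = has_fourier_L2_sq_integrable[OF assms]
  have e: "sq_norm lebesgue (\<lambda>x. c * u x - c * v x) = (cmod c)\<^sup>2 * sq_norm lebesgue (\<lambda>x. u x - v x)" for u v
    unfolding sq_norm_scale[symmetric] by (simp add: right_diff_distrib)
  show ?thesis
    unfolding has_fourier_L2_iff
    using F fg by (intro conjI exI[of _ "\<lambda>n x. c * F n x"])
      (auto simp: fourier_scale e intro!: tendsto_mult_right_zero)
qed

lemma has_fourier_L2_add:
  assumes "has_fourier_L2 f g" "has_fourier_L2 f' g'"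
  shows "has_fourier_L2 (\<lambda>x. f x + f' x) (\<lambda>x. g x + g' x)"
proof -
  obtain F where F: "\<forall>n. sq_integrable lebesgue (F n)" "\<forall>n. integrable lebesgue (F n)"
    "(\<lambda>n. sq_norm lebesgue (\<lambda>x. F n x - f x)) \<longlonglongrightarrow> 0"
    "(\<lambda>n. sq_norm lebesgue (\<lambda>x. fourier (F n) x - g x)) \<longlonglongrightarrow> 0"
    "\<forall>n. sq_integrable lebesgue (fourier (F n))"
    by (rule has_fourier_L2E[OF assms(1)])
  note F = F[rule_format]
  obtain G where G: "\<forall>n. sq_integrable lebesgue (G n)" "\<forall>n. integrable lebesgue (G n)"
    "(\<lambda>n. sq_norm lebesgue (\<lambda>x. G n x - f' x)) \<longlonglongrightarrow> 0"
    "(\<lambda>n. sq_norm lebesgue (\<lambda>x. fourier (G n) x - g' x)) \<longlonglongrightarrow> 0"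
    "\<forall>n. sq_integrable lebesgue (fourier (G n))"
    by (rule has_fourier_L2E[OF assms(2)])
  note G = G[rule_format]
  note fg = has_fourier_L2_sq_integrable[OF assms(1)] has_fourier_L2_sq_integrable[OF assms(2)]
  have lim: "(\<lambda>n. sq_norm lebesgue (\<lambda>x. (u n x + v n x) - (a x + b x))) \<longlonglongrightarrow> 0"
    if "\<And>n. sq_integrable lebesgue (u n)" "\<And>n. sq_integrable lebesgue (v n)" "sq_integrable lebesgue a" "sq_integrable lebesgue b"
      "(\<lambda>n. sq_norm lebesgue (\<lambda>x. u n x - a x)) \<longlonglongrightarrow> 0" "(\<lambda>n. sq_norm lebesgue (\<lambda>x. v n x - b x)) \<longlonglongrightarrow> 0"
    for u v :: "nat \<Rightarrow> real \<Rightarrow> complex" and a b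
  proof (rule tendsto_sandwich[OF _ _ tendsto_const])
    let ?w = "\<lambda>n. 2 * sq_norm lebesgue (\<lambda>x. u n x - a x) + 2 * sq_norm lebesgue (\<lambda>x. v n x - b x)"
    show "?w \<longlonglongrightarrow> 0"
      by (intro tendsto_add_zero tendsto_mult_right_zero that)
    show "eventually (\<lambda>n. sq_norm lebesgue (\<lambda>x. (u n x + v n x) - (a x + b x)) \<le> ?w n) sequentially"
    proof (rule always_eventually, rule allI)
      fix n
      show "sq_norm lebesgue (\<lambda>x. (u n x + v n x) - (a x + b x)) \<le> ?w n"
        using sq_norm_add_le[OF sq_integrable_diff[OF that(1)[of n] that(3)] sq_integrable_diff[OF that(2)[of n] that(4)]]
        by (simp add: add_diff_add)
    qed
  qed simp
  have e: "fourier (\<lambda>x. F n x + G n x) = (\<lambda>x. fourier (F n) x + fourier (G n) x)" for n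
    using fourier_add[OF F(2) G(2)] by auto
  show ?thesis
    unfolding has_fourier_L2_iff
  proof (intro conjI exI[of _ "\<lambda>n x. F n x + G n x"] allI)
    show "(\<lambda>n. sq_norm lebesgue (\<lambda>x. (F n x + G n x) - (f x + f' x))) \<longlonglongrightarrow> 0"
      by (rule lim[OF F(1) G(1) fg(1) fg(3) F(3) G(3)])
    show "(\<lambda>n. sq_norm lebesgue (\<lambda>x. fourier (\<lambda>x. F n x + G n x) x - (g x + g' x))) \<longlonglongrightarrow> 0"
      unfolding e by (rule lim[OF F(5) G(5) fg(2) fg(4) F(4) G(4)])
  qed (use F G fg in auto)
qed

text \<open>Polarization: equality of the norms of a sum gives the real parts, and the imaginary
  part is the real part after multiplying the second function by \<open>\<i>\<close>.\<close>

theorem has_fourier_L2_inner_on: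
  assumes "has_fourier_L2 f g" "has_fourier_L2 f' g'"
  shows "inner_on lebesgue g g' = inner_on lebesgue f f'"
proof -
  note fg = has_fourier_L2_sq_integrable[OF assms(1)]
  have re: "Re (inner_on lebesgue g h') = Re (inner_on lebesgue f h)" if h: "has_fourier_L2 h h'" for h h'
    using has_fourier_L2_sq_norm[OF has_fourier_L2_add[OF assms(1) h]] has_fourier_L2_sq_norm[OF assms(1)]
      has_fourier_L2_sq_norm[OF h] sq_norm_add[OF fg(1) has_fourier_L2_sq_integrable(1)[OF h]] sq_norm_add[OF fg(2) has_fourier_L2_sq_integrable(2)[OF h]]
    by simp
  show ?thesis
    using re[OF assms(2)] re[OF has_fourier_L2_scale[OF assms(2), of \<i>]]
    by (simp add: complex_eq_iff inner_on_scale_right)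
qed

text \<open>The limit of the transforms of the truncations, which exists by completeness.\<close>

lemma has_fourier_L2_exists:
  assumes f: "sq_integrable lebesgue f" obtains g where "has_fourier_L2 f g"
proof -
  obtain g where "sq_integrable lebesgue g" "(\<lambda>n. sq_norm lebesgue (\<lambda>x. fourier (trunc f n) x - g x)) \<longlonglongrightarrow> 0"
    using Riesz_Fischer[OF plancherel_trunc(1)[OF f] plancherel_trunc_diff(2)[OF f] trunc_L2[OF f]] by blast
  then have "has_fourier_L2 f g"
    unfolding has_fourier_L2_iff using f sq_integrable_trunc[OF f] integrable_trunc[OF f] trunc_L2[OF f] by blast
  then show thesis by (rule that)
qed

section \<open>Multiplication formula and surjectivity of the Fourier transform\<close>

interpretation lebesgue: sigma_finite_measure "lebesgue :: real measure"
proof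
  let ?A = "range (\<lambda>n::nat. {- real n..real n})"
  have "\<Union>?A = UNIV"
  proof (intro equalityI subsetI UNIV_I)
    fix x :: real
    obtain n where "\<bar>x\<bar> < real n" using reals_Archimedean2 by blast
    then have "x \<in> {- real n..real n}" by auto
    then show "x \<in> \<Union>?A" by blast
  qed
  then show "\<exists>A. countable A \<and> A \<subseteq> sets (lebesgue :: real measure) \<and> \<Union>A = space lebesgue \<and> (\<forall>a\<in>A. emeasure lebesgue a \<noteq> \<infinity>)"
    by (intro exI[of _ ?A]) auto
qed

interpretation LL: pair_sigma_finite "lebesgue :: real measure" "lebesgue :: real measure" ..

text \<open>The kernel depends on the product \<open>x * y\<close> only, hence is symmetric, and
  Fubini moves the transform from one factor to the other.\<close>

lemma fourier_multiplication_L1: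
  assumes f: "integrable lebesgue f" and g: "integrable lebesgue g"
  shows "(LINT x|lebesgue. fourier f x * g x) = (LINT x|lebesgue. f x * fourier g x)"
proof -
  note [measurable] = borel_measurable_integrable[OF f] borel_measurable_integrable[OF g]
  let ?h = "\<lambda>x y. f x * g y * cnj (ee (x * y))"
  have h: "(\<lambda>(x, y). ?h x y) \<in> borel_measurable (lebesgue \<Otimes>\<^sub>M lebesgue)" by measurable
  have "integrable (lebesgue \<Otimes>\<^sub>M lebesgue) (\<lambda>(x, y). ?h x y)"
  proof (rule LL.Fubini_integrable[OF h])
    have "integrable lebesgue (\<lambda>x. cmod (f x) * (LINT y|lebesgue. cmod (g y)))" using f by auto
    then show "integrable lebesgue (\<lambda>x. LINT y|lebesgue. norm (case (x, y) of (x, y) \<Rightarrow> ?h x y))"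
      by (simp add: norm_mult)
    have "integrable lebesgue (\<lambda>y. ?h x y)" for x
    proof -
      have "integrable lebesgue (\<lambda>y. f x * (g y * cnj (ee (y * x))))"
        by (intro integrable_mult_right integrable_mult_ee g)
      then show ?thesis by (simp add: mult_ac)
    qed
    then show "AE x in lebesgue. integrable lebesgue (\<lambda>y. case (x, y) of (x, y) \<Rightarrow> ?h x y)" by simp
  qed
  then have "(LINT y|lebesgue. LINT x|lebesgue. ?h x y) = (LINT x|lebesgue. LINT y|lebesgue. ?h x y)"
    by (rule LL.Fubini_integral)
  moreover have "(LINT x|lebesgue. ?h x y) = fourier f y * g y" for y
    unfolding fourier_ee by (subst integral_mult_left_zero[symmetric]) (simp add: mult_ac)
  moreover have "(LINT y|lebesgue. ?h x y) = f x * fourier g x" for x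
    unfolding fourier_ee by (subst integral_mult_right_zero[symmetric]) (simp add: mult_ac)
  ultimately show ?thesis by simp
qed

text \<open>The extra conjugates undo the one inside \<open>inner_on\<close>, so this is the
  bilinear multiplication formula, extended from integrable functions by continuity.\<close>

lemma has_fourier_L2_multiplication:
  assumes "has_fourier_L2 f g" "has_fourier_L2 f' g'"
  shows "inner_on lebesgue g (\<lambda>x. cnj (f' x)) = inner_on lebesgue f (\<lambda>x. cnj (g' x))"
proof -
  obtain F where F: "\<forall>n. sq_integrable lebesgue (F n)" "\<forall>n. integrable lebesgue (F n)"
    "(\<lambda>n. sq_norm lebesgue (\<lambda>x. F n x - f x)) \<longlonglongrightarrow> 0"
    "(\<lambda>n. sq_norm lebesgue (\<lambda>x. fourier (F n) x - g x)) \<longlonglongrightarrow> 0"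
    "\<forall>n. sq_integrable lebesgue (fourier (F n))"
    by (rule has_fourier_L2E[OF assms(1)])
  note F = F[rule_format]
  obtain G where G: "\<forall>n. sq_integrable lebesgue (G n)" "\<forall>n. integrable lebesgue (G n)"
    "(\<lambda>n. sq_norm lebesgue (\<lambda>x. G n x - f' x)) \<longlonglongrightarrow> 0"
    "(\<lambda>n. sq_norm lebesgue (\<lambda>x. fourier (G n) x - g' x)) \<longlonglongrightarrow> 0"
    "\<forall>n. sq_integrable lebesgue (fourier (G n))"
    by (rule has_fourier_L2E[OF assms(2)])
  note G = G[rule_format]
  note fg = has_fourier_L2_sq_integrable[OF assms(1)] has_fourier_L2_sq_integrable[OF assms(2)]
  have c: "(\<lambda>n. sq_norm lebesgue (\<lambda>x. cnj (u n x) - cnj (v x))) \<longlonglongrightarrow> 0"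
    if "(\<lambda>n. sq_norm lebesgue (\<lambda>x. u n x - v x)) \<longlonglongrightarrow> 0" for u :: "nat \<Rightarrow> real \<Rightarrow> complex" and v
    using that by (simp add: sq_norm_def flip: complex_cnj_diff)
  have "(\<lambda>n. inner_on lebesgue (fourier (F n)) (\<lambda>x. cnj (G n x))) \<longlonglongrightarrow> inner_on lebesgue g (\<lambda>x. cnj (f' x))"
    by (intro inner_on_tendsto F(5) sq_integrable_cnj fg G(1) F(4) c G(3))
  moreover have "(\<lambda>n. inner_on lebesgue (F n) (\<lambda>x. cnj (fourier (G n) x))) \<longlonglongrightarrow> inner_on lebesgue f (\<lambda>x. cnj (g' x))"
    by (intro inner_on_tendsto F(1) sq_integrable_cnj fg G(5) F(3) c G(4))
  moreover have "inner_on lebesgue (fourier (F n)) (\<lambda>x. cnj (G n x)) = inner_on lebesgue (F n) (\<lambda>x. cnj (fourier (G n) x))" for n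
    using fourier_multiplication_L1[OF F(2) G(2), of n n] by (simp add: inner_on_def)
  ultimately show ?thesis using LIMSEQ_unique by auto
qed

lemma sq_norm_reflect:
  fixes f :: "real \<Rightarrow> complex"
  shows
  "sq_integrable lebesgue f \<Longrightarrow> sq_norm lebesgue (\<lambda>x. f (- x)) = sq_norm lebesgue f"
  "sq_integrable lebesgue f \<Longrightarrow> sq_integrable lebesgue (\<lambda>x. f (- x))"
  using sq_norm_affine[of f "-1" 0] sq_integrable_affine[of f "-1" 0] by simp_all

lemma has_fourier_L2_cnj:
  assumes "has_fourier_L2 f g"
  shows "has_fourier_L2 (\<lambda>x. cnj (f x)) (\<lambda>x. cnj (g (- x)))"
proof -
  obtain F where F: "\<forall>n. sq_integrable lebesgue (F n)" "\<forall>n. integrable lebesgue (F n)"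
    "(\<lambda>n. sq_norm lebesgue (\<lambda>x. F n x - f x)) \<longlonglongrightarrow> 0"
    "(\<lambda>n. sq_norm lebesgue (\<lambda>x. fourier (F n) x - g x)) \<longlonglongrightarrow> 0"
    "\<forall>n. sq_integrable lebesgue (fourier (F n))"
    by (rule has_fourier_L2E[OF assms(1)])
  note F = F[rule_format]
  note fg = has_fourier_L2_sq_integrable[OF assms]
  have e: "sq_norm lebesgue (\<lambda>x. cnj (fourier (F n) (- x)) - cnj (g (- x))) = sq_norm lebesgue (\<lambda>x. fourier (F n) x - g x)" for n
    using sq_norm_reflect(1)[OF sq_integrable_diff[OF F(5)[of n] fg(2)]] by (simp add: sq_norm_def flip: complex_cnj_diff)
  have e': "sq_norm lebesgue (\<lambda>x. cnj (F n x) - cnj (f x)) = sq_norm lebesgue (\<lambda>x. F n x - f x)" for n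
    by (simp add: sq_norm_def flip: complex_cnj_diff)
  show ?thesis
    unfolding has_fourier_L2_iff
    using F fg sq_norm_reflect(2)[OF fg(2)] by (intro conjI exI[of _ "\<lambda>n x. cnj (F n x)"])
      (auto simp: fourier_cnj e e')
qed

text \<open>With \<open>h\<close> the transform of \<open>g\<close>, \<open>f(x) = h(-x)\<close>, and \<open>u\<close> the transform of \<open>f\<close>, the multiplication
  formula gives \<open>\<langle>u, g\<rangle> = \<parallel>f\<parallel>\<^sup>2\<close>. Since \<open>\<parallel>u\<parallel> = \<parallel>f\<parallel> = \<parallel>g\<parallel>\<close>, this forces \<open>u = g\<close> almost everywhere.\<close>

theorem has_fourier_L2_surj:
  assumes g: "sq_integrable lebesgue g" obtains f where "has_fourier_L2 f g"
proof -
  obtain h where h: "has_fourier_L2 g h" using has_fourier_L2_exists[OF g] .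
  note hs = has_fourier_L2_sq_integrable(2)[OF h]
  define f where "f x = h (- x)" for x
  have f: "sq_integrable lebesgue f" "sq_norm lebesgue f = sq_norm lebesgue h"
    unfolding f_def using sq_norm_reflect[OF hs] by auto
  obtain u where u: "has_fourier_L2 f u" using has_fourier_L2_exists[OF f(1)] .
  note us = has_fourier_L2_sq_integrable(2)[OF u]
  have "inner_on lebesgue u g = inner_on lebesgue f f"
    using has_fourier_L2_multiplication[OF u has_fourier_L2_cnj[OF h]] by (simp add: f_def[abs_def])
  then have "sq_norm lebesgue (\<lambda>x. u x - g x) = 0"
    unfolding sq_norm_diff[OF us g] using has_fourier_L2_sq_norm[OF u] has_fourier_L2_sq_norm[OF h] f(2)
    by (simp add: inner_on_self)
  then have ae: "AE x in lebesgue. u x = g x"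
    using sq_norm_eq_0_iff[OF sq_integrable_diff[OF us g]] by simp
  obtain F where F: "\<forall>n. sq_integrable lebesgue (F n)" "\<forall>n. integrable lebesgue (F n)"
    "(\<lambda>n. sq_norm lebesgue (\<lambda>x. F n x - f x)) \<longlonglongrightarrow> 0"
    "(\<lambda>n. sq_norm lebesgue (\<lambda>x. fourier (F n) x - u x)) \<longlonglongrightarrow> 0"
    "\<forall>n. sq_integrable lebesgue (fourier (F n))"
    by (rule has_fourier_L2E[OF u])
  note F = F[rule_format]
  have "sq_norm lebesgue (\<lambda>x. fourier (F n) x - u x) = sq_norm lebesgue (\<lambda>x. fourier (F n) x - g x)" for n
    by (rule sq_norm_cong_AE) (use ae us g F(5)[of n] in \<open>auto dest: sq_integrable_measurable\<close>)
  with F f(1) g have "has_fourier_L2 f g" unfolding has_fourier_L2_iff by auto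
  then show thesis by (rule that)
qed

lemma has_fourier_L2_affine:
  assumes "has_fourier_L2 f g" and a: "a > 0"
  shows "has_fourier_L2 (\<lambda>x. f (b + a * x)) (\<lambda>\<gamma>. of_real (1 / a) * ee (b * \<gamma> / a) * g (\<gamma> / a))"
proof -
  obtain F where F: "\<forall>n. sq_integrable lebesgue (F n)" "\<forall>n. integrable lebesgue (F n)"
    "(\<lambda>n. sq_norm lebesgue (\<lambda>x. F n x - f x)) \<longlonglongrightarrow> 0"
    "(\<lambda>n. sq_norm lebesgue (\<lambda>x. fourier (F n) x - g x)) \<longlonglongrightarrow> 0"
    "\<forall>n. sq_integrable lebesgue (fourier (F n))"
    by (rule has_fourier_L2E[OF assms(1)])
  note F = F[rule_format]
  note fg = has_fourier_L2_sq_integrable[OF assms(1)]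
  let ?m = "\<lambda>u \<gamma>. of_real (1 / a) * ee (b * \<gamma> / a) * u (\<gamma> / a) :: complex"
  have e: "sq_norm lebesgue (\<lambda>x. F n (b + a * x) - f (b + a * x)) = sq_norm lebesgue (\<lambda>x. F n x - f x) / a" for n
    using sq_norm_affine[OF sq_integrable_diff[OF F(1)[of n] fg(1)], of a b] a by simp
  have s: "sq_integrable lebesgue (?m u)" if "sq_integrable lebesgue u" for u
  proof -
    have s: "sq_integrable lebesgue (\<lambda>x. u (x / a))" using sq_integrable_affine[OF that, of "1 / a" 0] a by simp
    note [measurable] = sq_integrable_measurable[OF s]
    show ?thesis by (rule sq_integrable_bound[OF s, where c = "1 / a"]) (use a in \<open>auto simp: norm_mult norm_divide\<close>)
  qed
  have e': "sq_norm lebesgue (\<lambda>\<gamma>. ?m (fourier (F n)) \<gamma> - ?m g \<gamma>) = (1 / a) * sq_norm lebesgue (\<lambda>x. fourier (F n) x - g x)" for n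
  proof -
    have "sq_norm lebesgue (\<lambda>\<gamma>. ?m (fourier (F n)) \<gamma> - ?m g \<gamma>) = (1 / a)\<^sup>2 * sq_norm lebesgue (\<lambda>x. fourier (F n) (x / a) - g (x / a))"
      unfolding right_diff_distrib[symmetric] sq_norm_def by (simp add: norm_mult norm_divide power_mult_distrib power_divide)
    then show ?thesis
      using sq_norm_affine[OF sq_integrable_diff[OF F(5)[of n] fg(2)], of "1 / a" 0] a by (simp add: power2_eq_square)
  qed
  show ?thesis
    unfolding has_fourier_L2_iff
  proof (intro conjI exI[of _ "\<lambda>n x. F n (b + a * x)"] allI)
    show "(\<lambda>n. sq_norm lebesgue (\<lambda>x. F n (b + a * x) - f (b + a * x))) \<longlonglongrightarrow> 0"
      unfolding e using F(3) by (rule tendsto_divide_zero)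
    show "(\<lambda>n. sq_norm lebesgue (\<lambda>x. fourier (\<lambda>x. F n (b + a * x)) x - ?m g x)) \<longlonglongrightarrow> 0"
      unfolding fourier_affine[OF F(2) a] e' using F(4) by (rule tendsto_mult_right_zero)
    show "integrable lebesgue (\<lambda>x. F n (b + a * x))" for n
      using lebesgue_integrable_affine[of "F n" a b] F(1,2)[of n] a by (auto dest: sq_integrable_measurable)
  qed (use F fg s a sq_integrable_affine in auto)
qed

section \<open>Refinable functions\<close>

text \<open>\<open>m\<close> plays the role of \<open>H0\<close>, and the \<open>phi\<close> defined
  below that of the transform \<phi>-hat. The last assumption is a Lipschitz bound at 0, which
  forces \<open>m 0 = 1\<close>; it makes the infinite product converge and its value tend to 1 at
  0.\<close>

locale lowpass =
  fixes m :: "real \<Rightarrow> complex"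
  assumes m_measurable [measurable]: "m \<in> borel_measurable borel"
    and m_periodic: "m (x + 1) = m x"
    and m_sub_qmf: "(cmod (m x))\<^sup>2 + (cmod (m (x + 1/2)))\<^sup>2 \<le> 1"
    and m_near_0: "\<exists>C \<delta>. 0 < \<delta> \<and> (\<forall>x. \<bar>x\<bar> < \<delta> \<longrightarrow> cmod (m x - 1) \<le> C * \<bar>x\<bar>)"
begin

definition phi :: "real \<Rightarrow> complex" where
  "phi x = (\<Prod>k. m (x / 2 ^ Suc k))"

lemma m_le_1: "cmod (m x) \<le> 1"
proof -
  have "(cmod (m x))\<^sup>2 \<le> 1\<^sup>2" using m_sub_qmf[of x] zero_le_power2[of "cmod (m (x + 1/2))"] unfolding power_one by linarith
  then show ?thesis by (rule power2_le_imp_le) simp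
qed

lemma m_periodic_nat: "m (x + real n) = m x"
proof (induction n)
  case (Suc n)
  then show ?case using m_periodic[of "x + real n"] by (simp add: add_ac)
qed simp

text \<open>From index \<open>N\<close> on the arguments lie in the \<delta>-neighbourhood of 0,
  where the Lipschitz bound turns the deviations of the factors from 1 into a geometric
  series.\<close>

lemma phi_convergent: "convergent_prod (\<lambda>k. m (x / 2 ^ Suc k))"
proof -
  obtain C \<delta> where d: "0 < \<delta>" "\<And>y. \<bar>y\<bar> < \<delta> \<Longrightarrow> cmod (m y - 1) \<le> C * \<bar>y\<bar>"
    using m_near_0 by blast
  have "(\<lambda>k. \<bar>x\<bar> * (1/2) ^ k) \<longlonglongrightarrow> \<bar>x\<bar> * 0"
    by (intro tendsto_intros LIMSEQ_power_zero) simp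
  then have "eventually (\<lambda>k. \<bar>x\<bar> * (1/2) ^ k < \<delta>) sequentially"
    using d(1) by (intro order_tendstoD(2)) auto
  then obtain N where N: "\<And>k. k \<ge> N \<Longrightarrow> \<bar>x\<bar> * (1/2) ^ k < \<delta>"
    unfolding eventually_sequentially by blast
  have "summable (\<lambda>k. C * \<bar>x\<bar> * (1/2) ^ Suc k)"
    unfolding power_Suc by (intro summable_mult summable_geometric) simp
  then have "summable (\<lambda>k. cmod (m (x / 2 ^ Suc k) - 1))"
  proof (rule summable_comparison_test'[where N = N])
    fix k assume "N \<le> k"
    then have "\<bar>x\<bar> * (1/2) ^ Suc k < \<delta>" by (intro N) simp
    moreover have e: "\<bar>x / 2 ^ Suc k\<bar> = \<bar>x\<bar> * (1/2) ^ Suc k" by (simp add: abs_mult power_divide)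
    ultimately show "norm (cmod (m (x / 2 ^ Suc k) - 1)) \<le> C * \<bar>x\<bar> * (1/2) ^ Suc k"
      using d(2)[of "x / 2 ^ Suc k"] by (simp only: e real_norm_def abs_norm_cancel mult.assoc)
  qed
  then show ?thesis
    by (intro abs_convergent_prod_imp_convergent_prod) (simp add: abs_convergent_prod_conv_summable)
qed

definition pprod :: "nat \<Rightarrow> real \<Rightarrow> complex" where
  "pprod n x = (\<Prod>k<n. m (x / 2 ^ Suc k))"

lemma pprod_tendsto: "(\<lambda>n. pprod n x) \<longlonglongrightarrow> phi x"
proof -
  have "(\<lambda>n. pprod (Suc n) x) \<longlonglongrightarrow> phi x"
    using convergent_prod_LIMSEQ[OF phi_convergent[of x]] by (simp add: pprod_def phi_def lessThan_Suc_atMost)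
  then show ?thesis by (rule LIMSEQ_imp_Suc)
qed

lemma pprod_measurable [measurable]: "pprod n \<in> borel_measurable borel"
  unfolding pprod_def[abs_def] by measurable

lemma phi_measurable [measurable]: "phi \<in> borel_measurable borel"
  by (rule borel_measurable_LIMSEQ_metric[OF pprod_measurable pprod_tendsto])

lemma phi_refine: "phi x = m (x / 2) * phi (x / 2)"
proof (rule LIMSEQ_unique)
  have "pprod (Suc n) x = m (x / 2) * pprod n (x / 2)" for n
    unfolding pprod_def by (subst prod.lessThan_Suc_shift) simp
  moreover have "(\<lambda>n. pprod (Suc n) x) \<longlonglongrightarrow> phi x"
    using pprod_tendsto by (rule LIMSEQ_Suc)
  ultimately show "(\<lambda>n. m (x / 2) * pprod n (x / 2)) \<longlonglongrightarrow> phi x" by simp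
  show "(\<lambda>n. m (x / 2) * pprod n (x / 2)) \<longlonglongrightarrow> m (x / 2) * phi (x / 2)"
    by (intro tendsto_intros pprod_tendsto)
qed

lemma pprod_periodic: "pprod n (x + 2 ^ n) = pprod n x"
  unfolding pprod_def
proof (rule prod.cong[OF refl])
  fix k assume "k \<in> {..<n}"
  then have "(2::real) ^ n = 2 ^ Suc k * 2 ^ (n - Suc k)" by (subst power_add[symmetric]) simp
  then have "(x + 2 ^ n) / 2 ^ Suc k = x / 2 ^ Suc k + real (2 ^ (n - Suc k))"
    by (simp add: field_simps)
  then show "m ((x + 2 ^ n) / 2 ^ Suc k) = m (x / 2 ^ Suc k)"
    by (simp only: m_periodic_nat)
qed

text \<open>Induction pairs \<open>k\<close> with \<open>k + 2^n\<close>. By periodicity both share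
  the first \<open>n\<close> factors, while the arguments of their last factors differ by 1/2 up to
  sign, so \<open>m_sub_qmf\<close> removes the last factor from the sum.\<close>

lemma pprod_bracket: "(\<Sum>k<2^n. (cmod (pprod n (x + real k)))\<^sup>2) \<le> 1"
proof (induction n)
  case 0
  then show ?case by (simp add: pprod_def)
next
  case (Suc n)
  let ?f = "\<lambda>k. (cmod (pprod (Suc n) (x + real k)))\<^sup>2"
  have "(\<Sum>k<2 ^ Suc n. ?f k) = (\<Sum>k<2^n. ?f k) + (\<Sum>k<2^n. ?f (k + 2 ^ n))"
  proof -
    have "{..<2 ^ Suc n} = {..<2 ^ n} \<union> (\<lambda>k. k + 2 ^ n) ` {..<(2::nat) ^ n}"
    proof (intro equalityI subsetI)
      fix k :: nat assume "k \<in> {..<2 ^ Suc n}"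
      then show "k \<in> {..<2 ^ n} \<union> (\<lambda>k. k + 2 ^ n) ` {..<2 ^ n}"
        by (cases "k < 2 ^ n") (auto intro!: image_eqI[of _ _ "k - 2 ^ n"])
    qed auto
    then show ?thesis
      by (simp only:) (subst sum.union_disjoint, auto simp: sum.reindex)
  qed
  also have "\<dots> = (\<Sum>k<2^n. ?f k + ?f (k + 2 ^ n))" by (simp add: sum.distrib)
  also have "\<dots> \<le> (\<Sum>k<2^n. (cmod (pprod n (x + real k)))\<^sup>2)"
  proof (rule sum_mono)
    fix k
    let ?y = "x + real k"
    have 1: "pprod (Suc n) ?y = pprod n ?y * m (?y / 2 ^ Suc n)" by (simp add: pprod_def)
    have y: "x + real (k + 2 ^ n) = ?y + 2 ^ n" by simp
    have "(?y + 2 ^ n) / 2 ^ Suc n = ?y / 2 ^ Suc n + 1/2" by (simp add: field_simps)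
    then have 2: "pprod (Suc n) (?y + 2 ^ n) = pprod n ?y * m (?y / 2 ^ Suc n + 1/2)"
      using pprod_periodic[of n ?y] by (simp add: pprod_def)
    have "?f k + ?f (k + 2 ^ n) = (cmod (pprod n ?y))\<^sup>2 * ((cmod (m (?y / 2 ^ Suc n)))\<^sup>2 + (cmod (m (?y / 2 ^ Suc n + 1/2)))\<^sup>2)"
      unfolding y 1 2 by (simp add: norm_mult power_mult_distrib distrib_left)
    also have "\<dots> \<le> (cmod (pprod n ?y))\<^sup>2 * 1" by (intro mult_left_mono m_sub_qmf) simp
    finally show "?f k + ?f (k + 2 ^ n) \<le> (cmod (pprod n ?y))\<^sup>2" by simp
  qed
  also have "\<dots> \<le> 1" by (rule Suc.IH)
  finally show ?case .
qed

text \<open>A fixed finite set of integers fits into a full period of \<open>pprod n\<close> for all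
  large \<open>n\<close>, so the bound for partial products passes to the limit.\<close>

lemma phi_bracket_finite:
  assumes F: "finite (F :: int set)"
  shows "(\<Sum>k\<in>F. (cmod (phi (x + of_int k)))\<^sup>2) \<le> 1"
proof (rule LIMSEQ_le_const2)
  show "(\<lambda>n. \<Sum>k\<in>F. (cmod (pprod n (x + of_int k)))\<^sup>2) \<longlonglongrightarrow> (\<Sum>k\<in>F. (cmod (phi (x + of_int k)))\<^sup>2)"
    by (intro tendsto_intros pprod_tendsto)
  obtain N :: nat where N: "\<And>k. k \<in> F \<Longrightarrow> \<bar>k\<bar> \<le> int N"
  proof
    fix k assume "k \<in> F"
    then have "nat \<bar>k\<bar> \<le> Max ((\<lambda>k. nat \<bar>k\<bar>) ` F)" using F by (intro Max_ge) auto
    then show "\<bar>k\<bar> \<le> int (Max ((\<lambda>k. nat \<bar>k\<bar>) ` F))" by linarith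
  qed
  show "\<exists>N. \<forall>n\<ge>N. (\<Sum>k\<in>F. (cmod (pprod n (x + of_int k)))\<^sup>2) \<le> 1"
  proof (intro exI[of _ "Suc N"] allI impI)
    fix n assume n: "Suc N \<le> n"
    \<comment> \<open>A window symmetric about 0 of length \<open>2^n\<close> has half-length
      \<open>2^p\<close> with \<open>n = Suc p\<close>. Moving the base point to
      \<open>x - 2^p\<close> turns it into the window of \<open>pprod_bracket\<close>.\<close>
    then obtain p where p: "n = Suc p" "N \<le> p" by (cases n) auto
    have "N < 2 ^ p" using p(2) less_exp[of p] by linarith
    then have Np: "int N < 2 ^ p" by (metis of_nat_less_iff of_nat_numeral of_nat_power)
    have q: "int i < 2 * 2 ^ p \<longleftrightarrow> i < 2 * 2 ^ p" for i
      using of_nat_less_iff[of i "2 * 2 ^ p", where 'a = int] by simp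
    have b: "bij_betw (\<lambda>k. nat (k + 2 ^ p)) {- (2 ^ p)..<2 ^ p} {..<2 ^ n}"
      by (rule bij_betwI[where g = "\<lambda>j. int j - 2 ^ p"])
        (auto simp: p(1) nat_less_iff Pi_iff q)
    have "(\<Sum>k\<in>F. (cmod (pprod n (x + of_int k)))\<^sup>2) \<le> (\<Sum>k\<in>{- (2 ^ p)..<2 ^ p}. (cmod (pprod n (x + of_int k)))\<^sup>2)"
    proof (rule sum_mono2)
      show "F \<subseteq> {- (2 ^ p)..<2 ^ p}"
      proof
        fix k assume "k \<in> F"
        from N[OF this] show "k \<in> {- (2 ^ p)..<2 ^ p}"
          using Np unfolding atLeastLessThan_iff by linarith
      qed
    qed auto
    also have "\<dots> = (\<Sum>k\<in>{- (2 ^ p)..<2 ^ p}. (cmod (pprod n ((x - 2 ^ p) + real (nat (k + 2 ^ p)))))\<^sup>2)"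
      by (intro sum.cong refl) simp
    also have "\<dots> = (\<Sum>j<2 ^ n. (cmod (pprod n ((x - 2 ^ p) + real j)))\<^sup>2)"
      by (rule sum.reindex_bij_betw[OF b])
    also have "\<dots> \<le> 1" by (rule pprod_bracket)
    finally show "(\<Sum>k\<in>F. (cmod (pprod n (x + of_int k)))\<^sup>2) \<le> 1" .
  qed
qed

lemma phi_bracket: "(\<integral>\<^sup>+k. ennreal ((cmod (phi (x + of_int k)))\<^sup>2) \<partial>CZ) \<le> 1"
proof -
  let ?f = "\<lambda>k::int. (cmod (phi (x + of_int k)))\<^sup>2"
  have s: "?f summable_on UNIV"
    by (intro nonneg_bdd_above_summable_on bdd_aboveI[where M = 1]) (auto simp: phi_bracket_finite)
  have "infsum ?f UNIV \<le> 1"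
    by (intro infsum_le_finite_sums s phi_bracket_finite)
  moreover have "(\<integral>\<^sup>+k. ennreal (?f k) \<partial>CZ) = ennreal (infsum ?f UNIV)"
    by (rule has_sum_nn_integral) (use s in auto)
  ultimately show ?thesis by (simp add: ennreal_le_1)
qed

lemma phi_le_1: "cmod (phi x) \<le> 1"
proof -
  have "(cmod (phi x))\<^sup>2 \<le> 1\<^sup>2" using phi_bracket_finite[of "{0}" x] by simp
  then show ?thesis by (rule power2_le_imp_le) simp
qed

lemma phi_measurable_lebesgue: "phi \<in> borel_measurable lebesgue"
  by (rule measurable_completion) simp

lemma phi_sq_integrable: "sq_integrable lebesgue phi"
proof (rule sq_integrableI_nn[OF phi_measurable_lebesgue])
  have "(\<integral>\<^sup>+x. ennreal ((cmod (phi x))\<^sup>2) \<partial>lebesgue) \<le> (\<integral>\<^sup>+x. 1 \<partial>U)"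
    by (subst nn_integral_periodize) (use phi_measurable_lebesgue in simp, intro nn_integral_mono phi_bracket)
  also have "\<dots> < \<infinity>" by (simp add: emeasure_restrict_space)
  finally show "(\<integral>\<^sup>+x. ennreal ((cmod (phi x))\<^sup>2) \<partial>lebesgue) < \<infinity>" .
qed

text \<open>Comparing the product with \<open>1 + cmod (m y - 1)\<close> factor by factor bounds the
  deviation of every partial product from 1 by \<open>exp (C * \<bar>x\<bar>) - 1\<close>, uniformly
  in \<open>n\<close>.\<close>

lemma phi_tendsto_1:
  assumes X: "X \<longlonglongrightarrow> 0" shows "(\<lambda>n. phi (X n)) \<longlonglongrightarrow> 1"
proof -
  obtain C \<delta> where d: "0 < \<delta>" "\<And>y. \<bar>y\<bar> < \<delta> \<Longrightarrow> cmod (m y - 1) \<le> C * \<bar>y\<bar>"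
    using m_near_0 by blast
  have bd: "cmod (phi x - 1) \<le> exp (C * \<bar>x\<bar>) - 1" if x: "\<bar>x\<bar> < \<delta>" for x
  proof (rule LIMSEQ_le_const2)
    show "(\<lambda>n. cmod (pprod n x - 1)) \<longlonglongrightarrow> cmod (phi x - 1)"
      by (intro tendsto_intros pprod_tendsto)
    have "cmod (pprod n x - 1) \<le> exp (C * \<bar>x\<bar>) - 1" for n
    proof -
      have a: "cmod (m (x / 2 ^ Suc k) - 1) \<le> C * \<bar>x\<bar> * (1/2) ^ Suc k" for k
      proof -
        have e: "\<bar>x / 2 ^ Suc k\<bar> = \<bar>x\<bar> * (1/2) ^ Suc k" by (simp add: abs_mult power_divide)
        have "\<bar>x\<bar> * (1/2) ^ Suc k \<le> \<bar>x\<bar> * 1" by (intro mult_left_mono power_le_one) auto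
        then show ?thesis using d(2)[of "x / 2 ^ Suc k"] x by (simp only: e mult.assoc)
      qed
      have "cmod (pprod n x - 1) \<le> (\<Prod>k<n. 1 + cmod (m (x / 2 ^ Suc k) - 1)) - 1"
        using norm_prod_minus1_le_prod_minus1[of "\<lambda>k. m (x / 2 ^ Suc k) - 1" "{..<n}"] by (simp add: pprod_def)
      also have "(\<Prod>k<n. 1 + cmod (m (x / 2 ^ Suc k) - 1)) \<le> exp (\<Sum>k<n. cmod (m (x / 2 ^ Suc k) - 1))"
        by (rule prod_le_exp_sum) simp
      also have "(\<Sum>k<n. cmod (m (x / 2 ^ Suc k) - 1)) \<le> C * \<bar>x\<bar>"
      proof -
        \<comment> \<open>Nothing is known about the sign of \<open>C\<close>, but this product
          bounds a norm.\<close>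
        have C: "0 \<le> C * \<bar>x\<bar>" using order_trans[OF norm_ge_zero d(2)[OF x]] .
        have "(\<Sum>k<n. cmod (m (x / 2 ^ Suc k) - 1)) \<le> (\<Sum>k<n. C * \<bar>x\<bar> * (1/2) ^ Suc k)"
          by (intro sum_mono a)
        also have "\<dots> = C * \<bar>x\<bar> * (\<Sum>k<n. (1/2) ^ Suc k)" by (simp only: sum_distrib_left)
        also have "(\<Sum>k<n. (1/2::real) ^ Suc k) = 1 - (1/2) ^ n"
          by (induction n) auto
        also have "C * \<bar>x\<bar> * (1 - (1/2) ^ n) \<le> C * \<bar>x\<bar> * 1" using C by (intro mult_left_mono) auto
        finally show ?thesis by simp
      qed
      finally show ?thesis by simp
    qed
    then show "\<exists>N. \<forall>n\<ge>N. cmod (pprod n x - 1) \<le> exp (C * \<bar>x\<bar>) - 1" by blast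
  qed
  have "eventually (\<lambda>n. \<bar>X n\<bar> < \<delta>) sequentially"
    using d(1) tendsto_rabs[OF X] by (intro order_tendstoD(2)) auto
  then have "eventually (\<lambda>n. cmod (phi (X n) - 1) \<le> exp (C * \<bar>X n\<bar>) - 1) sequentially"
    by eventually_elim (rule bd)
  moreover have "(\<lambda>n. exp (C * \<bar>X n\<bar>) - 1) \<longlonglongrightarrow> exp (C * \<bar>0\<bar>) - 1"
    by (intro tendsto_intros X)
  then have "(\<lambda>n. exp (C * \<bar>X n\<bar>) - 1) \<longlonglongrightarrow> 0" by simp
  ultimately have "(\<lambda>n. phi (X n) - 1) \<longlonglongrightarrow> 0" by (rule Lim_null_comparison)
  then show ?thesis by (simp add: LIM_zero_iff)
qed

end

section \<open>Bracket products\<close>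

lemma shift_measurable: "(\<lambda>(m, x). x + of_int m) \<in> CZ \<Otimes>\<^sub>M lebesgue \<rightarrow>\<^sub>M (lebesgue :: real measure)"
proof (rule measurable_pair_measure_countable1)
  fix m :: int
  show "(\<lambda>x. case (m, x) of (m, x) \<Rightarrow> x + of_int m) \<in> lebesgue \<rightarrow>\<^sub>M (lebesgue :: real measure)"
    using lebesgue_affine_measurable_real[of 1 "of_int m"] by (simp add: add.commute)
qed simp

lemma shift_measurable_comp:
  "f \<in> borel_measurable lebesgue \<Longrightarrow> (\<lambda>(x, m). f (x + of_int m :: real)) \<in> borel_measurable (lebesgue \<Otimes>\<^sub>M CZ)"
  using measurable_compose[OF measurable_pair_swap[OF shift_measurable], of f borel]
  by (simp add: case_prod_unfold)

lemma nn_integral_shift_measurable: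
  fixes f :: "real \<Rightarrow> ennreal"
  assumes "f \<in> borel_measurable lebesgue"
  shows "(\<lambda>x. \<integral>\<^sup>+m. f (x + of_int m) \<partial>CZ) \<in> borel_measurable lebesgue"
  by (rule CZ.borel_measurable_nn_integral[OF shift_measurable_comp[OF assms]])

text \<open>As a Bochner integral this takes the value 0 where the series is not absolutely
  summable; for square integrable \<open>u\<close> and \<open>p\<close> that happens only on a null
  set.\<close>

definition bracket_product :: "(real \<Rightarrow> complex) \<Rightarrow> (real \<Rightarrow> complex) \<Rightarrow> real \<Rightarrow> complex" where
  "bracket_product u p x = (LINT k|CZ. u (x + of_int k) * cnj (p (x + of_int k)))"

lemma bracket_product_inner_on: "bracket_product u p x = inner_on CZ (\<lambda>k. u (x + of_int k)) (\<lambda>k. p (x + of_int k))"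
  by (simp add: bracket_product_def inner_on_def)

lemma bracket_product_measurable:
  assumes "u \<in> borel_measurable lebesgue" "p \<in> borel_measurable lebesgue"
  shows "bracket_product u p \<in> borel_measurable lebesgue"
proof -
  have "(\<lambda>x. u x * cnj (p x)) \<in> borel_measurable lebesgue" using assms by measurable
  from CZ.borel_measurable_lebesgue_integral[OF shift_measurable_comp[OF this]]
  show ?thesis unfolding bracket_product_def[abs_def] .
qed

text \<open>By periodization the fiber energies integrate to the squared norm of \<open>u\<close>,
  so they are finite almost everywhere.\<close>

lemma AE_sq_integrable_fiber:
  assumes u: "sq_integrable lebesgue u"
  shows "AE x in U. sq_integrable CZ (\<lambda>k. u (x + of_int k))"
proof -
  have m: "(\<lambda>x. ennreal ((cmod (u x))\<^sup>2)) \<in> borel_measurable lebesgue"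
    using sq_integrable_measurable[OF u] by measurable
  have "(\<integral>\<^sup>+x. \<integral>\<^sup>+k. ennreal ((cmod (u (x + of_int k)))\<^sup>2) \<partial>CZ \<partial>U) \<noteq> \<infinity>"
    unfolding nn_integral_periodize[OF m, symmetric] nn_integral_sq_norm[OF u] by simp
  then have "AE x in U. (\<integral>\<^sup>+k. ennreal ((cmod (u (x + of_int k)))\<^sup>2) \<partial>CZ) \<noteq> \<infinity>"
    by (intro nn_integral_noteq_infinite measurable_restrict_space1 nn_integral_shift_measurable[OF m])
  then show ?thesis
    by eventually_elim (rule sq_integrableI_nn, simp, simp add: less_top)
qed

text \<open>Cauchy-Schwarz on each fiber, followed by integration over the unit interval.\<close>

lemma
  assumes u: "sq_integrable lebesgue u" and p: "p \<in> borel_measurable lebesgue"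
    and C: "\<And>x. x \<in> {0..<1} \<Longrightarrow> (\<integral>\<^sup>+k. ennreal ((cmod (p (x + of_int k)))\<^sup>2) \<partial>CZ) \<le> ennreal C" and C0: "0 \<le> C"
  shows bracket_product_sq_integrable: "sq_integrable U (bracket_product u p)" and sq_norm_bracket_product_le: "sq_norm U (bracket_product u p) \<le> C * sq_norm lebesgue u"
proof -
  have m: "(\<lambda>x. ennreal ((cmod (u x))\<^sup>2)) \<in> borel_measurable lebesgue"
    using sq_integrable_measurable[OF u] by measurable
  have "AE x in U. x \<in> {0..<1}" by (rule AE_I2) simp
  with AE_sq_integrable_fiber[OF u]
  have "AE x in U. ennreal ((cmod (bracket_product u p x))\<^sup>2) \<le> ennreal C * (\<integral>\<^sup>+k. ennreal ((cmod (u (x + of_int k)))\<^sup>2) \<partial>CZ)"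
  proof eventually_elim
    case (elim x)
    have p: "sq_integrable CZ (\<lambda>k. p (x + of_int k))"
      by (rule sq_integrableI_nn) (use C[OF elim(2)] in \<open>auto intro: le_less_trans\<close>)
    have "sq_norm CZ (\<lambda>k. p (x + of_int k)) \<le> C"
      using C[OF elim(2)] C0 unfolding nn_integral_sq_norm[OF p] by simp
    then have "(cmod (bracket_product u p x))\<^sup>2 \<le> C * sq_norm CZ (\<lambda>k. u (x + of_int k))"
      using Cauchy_Schwarz_L2[OF elim(1) p] mult_right_mono[of _ C "sq_norm CZ (\<lambda>k. u (x + of_int k))"]
      unfolding bracket_product_inner_on by (simp add: mult.commute) (meson order_trans sq_norm_nonneg)
    then show ?case
      unfolding nn_integral_sq_norm[OF elim(1)] using C0 by (simp add: ennreal_leI flip: ennreal_mult)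
  qed
  then have "(\<integral>\<^sup>+x. ennreal ((cmod (bracket_product u p x))\<^sup>2) \<partial>U)
      \<le> (\<integral>\<^sup>+x. ennreal C * (\<integral>\<^sup>+k. ennreal ((cmod (u (x + of_int k)))\<^sup>2) \<partial>CZ) \<partial>U)"
    by (rule nn_integral_mono_AE)
  also have "\<dots> = ennreal C * (\<integral>\<^sup>+x. \<integral>\<^sup>+k. ennreal ((cmod (u (x + of_int k)))\<^sup>2) \<partial>CZ \<partial>U)"
    by (intro nn_integral_cmult measurable_restrict_space1 nn_integral_shift_measurable m)
  also have "\<dots> = ennreal (C * sq_norm lebesgue u)"
    unfolding nn_integral_periodize[OF m, symmetric] nn_integral_sq_norm[OF u] using C0 by (simp add: ennreal_mult)
  finally have le: "(\<integral>\<^sup>+x. ennreal ((cmod (bracket_product u p x))\<^sup>2) \<partial>U) \<le> ennreal (C * sq_norm lebesgue u)" .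
  show s: "sq_integrable U (bracket_product u p)"
    by (rule sq_integrableI_nn) (use le bracket_product_measurable[OF sq_integrable_measurable[OF u] p] in \<open>auto intro: le_less_trans measurable_U\<close>)
  show "sq_norm U (bracket_product u p) \<le> C * sq_norm lebesgue u"
    using le C0 unfolding nn_integral_sq_norm[OF s] by simp
qed

text \<open>\<open>p\<close> is the transform of a generator, and \<open>C\<close> is a Bessel bound
  for its integer translates. It is used with \<open>phi\<close> and \<open>C = 1\<close>, and with
  the filtered functions and \<open>C = 2\<close>.\<close>

locale bracket =
  fixes p :: "real \<Rightarrow> complex" and C :: real
  assumes p_measurable: "p \<in> borel_measurable lebesgue"
    and p_bracket: "\<And>x. (\<integral>\<^sup>+k. ennreal ((cmod (p (x + of_int k)))\<^sup>2) \<partial>CZ) \<le> ennreal C" and C_nonneg: "0 \<le> C"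
begin

lemma p_fiber: "sq_integrable CZ (\<lambda>k. p (x + of_int k))"
  by (rule sq_integrableI_nn) (use p_bracket[of x] in \<open>auto intro: le_less_trans\<close>)

lemma p_sq_integrable: "sq_integrable lebesgue p"
proof (rule sq_integrableI_nn[OF p_measurable])
  have "(\<integral>\<^sup>+x. ennreal ((cmod (p x))\<^sup>2) \<partial>lebesgue) \<le> (\<integral>\<^sup>+x. ennreal C \<partial>U)"
    by (subst nn_integral_periodize) (use p_measurable in simp, intro nn_integral_mono p_bracket)
  also have "\<dots> < \<infinity>" by (simp add: emeasure_restrict_space)
  finally show "(\<integral>\<^sup>+x. ennreal ((cmod (p x))\<^sup>2) \<partial>lebesgue) < \<infinity>" .
qed

text \<open>The energy of \<open>u\<close> against all integer translates of the generator, written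
  as an integral so that scales can be compared pointwise; \<open>has_sum_translates\<close> links
  it to the coefficients.\<close>

definition Q :: "(real \<Rightarrow> complex) \<Rightarrow> real" where "Q u = sq_norm U (bracket_product u p)"

lemma sq_integrable_bracket_product: "sq_integrable lebesgue u \<Longrightarrow> sq_integrable U (bracket_product u p)"
  by (rule bracket_product_sq_integrable[OF _ p_measurable p_bracket C_nonneg])

lemma Q_le: "sq_integrable lebesgue u \<Longrightarrow> Q u \<le> C * sq_norm lebesgue u"
  unfolding Q_def by (rule sq_norm_bracket_product_le[OF _ p_measurable p_bracket C_nonneg])

lemma Q_nonneg: "0 \<le> Q u"
  by (simp add: Q_def)

text \<open>\<open>Q\<close> is a quadratic form. The bracket product is additive only where the
  fibers of both functions are square summable, hence the detour through an almost everywhere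
  identity.\<close>

lemma Q_parallelogram:
  assumes u: "sq_integrable lebesgue u" and v: "sq_integrable lebesgue v"
  shows "Q (\<lambda>x. u x + v x) + Q (\<lambda>x. u x - v x) = 2 * Q u + 2 * Q v"
proof -
  have ae: "AE x in U. bracket_product (\<lambda>x. u x + v x) p x = bracket_product u p x + bracket_product v p x \<and> bracket_product (\<lambda>x. u x - v x) p x = bracket_product u p x - bracket_product v p x"
    using AE_sq_integrable_fiber[OF u] AE_sq_integrable_fiber[OF v]
    by eventually_elim (simp add: bracket_product_inner_on inner_on_add_left inner_on_diff_left p_fiber)
  note m = sq_integrable_measurable[OF sq_integrable_bracket_product]
  have "Q (\<lambda>x. u x + v x) = sq_norm U (\<lambda>x. bracket_product u p x + bracket_product v p x)" "Q (\<lambda>x. u x - v x) = sq_norm U (\<lambda>x. bracket_product u p x - bracket_product v p x)"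
    unfolding Q_def using ae m[OF u] m[OF v] m[OF sq_integrable_add[OF u v]] m[OF sq_integrable_diff[OF u v]]
    by (auto intro!: sq_norm_cong_AE)
  then show ?thesis
    using sq_norm_parallelogram[OF sq_integrable_bracket_product[OF u] sq_integrable_bracket_product[OF v]] by (simp add: Q_def)
qed

lemma Q_add_le:
  assumes "sq_integrable lebesgue u" "sq_integrable lebesgue v"
  shows "Q (\<lambda>x. u x + v x) \<le> 2 * Q u + 2 * Q v"
  using Q_parallelogram[OF assms] Q_nonneg[of "\<lambda>x. u x - v x"] by linarith

text \<open>The translates of \<open>p\<close> become the Fourier coefficients of the periodic function \<open>bracket_product u p\<close>.\<close>

lemma has_sum_translates:
  assumes u: "sq_integrable lebesgue u"
  shows "((\<lambda>k::int. (cmod (inner_on lebesgue u (\<lambda>x. p x * cnj (ee (of_int k * x)))))\<^sup>2) has_sum Q u) UNIV"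
proof -
  \<comment> \<open>The modulation is conjugated once explicitly and once by
    \<open>inner_on\<close>, so frequency \<open>- k\<close> appears. This is harmless in a sum over
    all integers.\<close>
  have coef: "inner_on lebesgue u (\<lambda>x. p x * cnj (ee (of_int k * x))) = fourier_coeff (bracket_product u p) (- k)" for k
  proof -
    have s: "sq_integrable lebesgue (\<lambda>x. p x * cnj (ee (of_int k * x)))"
    proof -
      note [measurable] = p_measurable
      show ?thesis by (rule sq_integrable_bound[OF p_sq_integrable, of _ 1]) (auto simp: norm_mult)
    qed
    have "inner_on lebesgue u (\<lambda>x. p x * cnj (ee (of_int k * x)))
        = (LINT x|U. LINT m|CZ. u (x + of_int m) * cnj (p (x + of_int m) * cnj (ee (of_int k * (x + of_int m)))))"
      unfolding inner_on_def by (rule integral_periodize[OF sq_integrable_inner_on_integrable[OF u s]])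
    also have "\<dots> = (LINT x|U. bracket_product u p x * cnj (ee (of_int (- k) * x)))"
    proof (rule arg_cong[where f = "integral\<^sup>L U"], rule ext)
      fix x
      \<comment> \<open>An integer modulation is constant along the fiber \<open>x + \<int>\<close>
        and leaves the inner sum.\<close>
      have "ee (of_int k * (x + of_int m)) = ee (of_int k * x)" for m :: int
        using ee_of_int[of "k * m"] by (simp add: distrib_left ee_add)
      then have "(LINT m|CZ. u (x + of_int m) * cnj (p (x + of_int m) * cnj (ee (of_int k * (x + of_int m)))))
          = (LINT m|CZ. (u (x + of_int m) * cnj (p (x + of_int m))) * ee (of_int k * x))"
        by (simp add: mult.assoc)
      also have "\<dots> = bracket_product u p x * ee (of_int k * x)" unfolding bracket_product_def by (rule integral_mult_left_zero)
      finally show "(LINT m|CZ. u (x + of_int m) * cnj (p (x + of_int m) * cnj (ee (of_int k * (x + of_int m)))))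
          = bracket_product u p x * cnj (ee (of_int (- k) * x))"
        by (simp add: ee_minus)
    qed
    finally show ?thesis by (simp add: fourier_coeff_def inner_on_def)
  qed
  have "((\<lambda>k. (cmod (fourier_coeff (bracket_product u p) (- k)))\<^sup>2) has_sum Q u) UNIV
      \<longleftrightarrow> ((\<lambda>k. (cmod (fourier_coeff (bracket_product u p) k))\<^sup>2) has_sum Q u) UNIV"
    by (rule has_sum_reindex_bij_betw) (rule bij_uminus)
  then show ?thesis
    unfolding coef Q_def using parseval_circle[OF sq_integrable_bracket_product[OF u]] by simp
qed

end

section \<open>Dilations and splitting into even and odd integers\<close>

text \<open>The unitary dilation on the transform side. The transform turns
  \<open>dilation_pow j\<close> into \<open>dilate (- j)\<close>, and passing to the adjoint puts
  \<open>dilate j\<close> on the transform of \<open>f\<close>.\<close>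

definition dilate :: "int \<Rightarrow> (real \<Rightarrow> complex) \<Rightarrow> real \<Rightarrow> complex" where
  "dilate j u x = of_real (2 powr (of_int j / 2)) * u (2 powr of_int j * x)"

lemma
  assumes u: "sq_integrable lebesgue u"
  shows sq_integrable_dilate: "sq_integrable lebesgue (dilate j u)" and sq_norm_dilate: "sq_norm lebesgue (dilate j u) = sq_norm lebesgue u"
proof -
  have a: "sq_integrable lebesgue (\<lambda>x. u (2 powr of_int j * x))"
    "sq_norm lebesgue (\<lambda>x. u (2 powr of_int j * x)) = sq_norm lebesgue u / 2 powr of_int j"
    using sq_integrable_affine[OF u, of "2 powr of_int j" 0] sq_norm_affine[OF u, of "2 powr of_int j" 0] by simp_all
  show "sq_integrable lebesgue (dilate j u)" unfolding dilate_def[abs_def] by (rule sq_integrable_scale[OF a(1)])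
  have "(2 powr (of_int j / 2))\<^sup>2 = (2::real) powr of_int j"
    by (simp add: power2_eq_square flip: powr_add)
  then show "sq_norm lebesgue (dilate j u) = sq_norm lebesgue u"
    unfolding dilate_def[abs_def] sq_norm_scale a(2) by simp
qed

lemma dilate_add: "dilate j (\<lambda>x. u x + v x) = (\<lambda>x. dilate j u x + dilate j v x)"
  and dilate_diff: "dilate j (\<lambda>x. u x - v x) = (\<lambda>x. dilate j u x - dilate j v x)"
  by (auto simp: dilate_def algebra_simps)

lemma dilate_half: "dilate j u (2 * y) = of_real (1 / sqrt 2) * dilate (j + 1) u y"
proof -
  have a: "2 powr (of_int (j + 1) / 2) = 2 powr (of_int j / 2) * sqrt 2"
    by (simp add: add_divide_distrib powr_add powr_half_sqrt)
  have b: "2 powr of_int (j + 1) * y = 2 powr of_int j * (2 * y)"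
    by (simp add: powr_add)
  show ?thesis unfolding dilate_def a b by simp
qed

lemma bij_even: "bij_betw (\<lambda>k::int. 2 * k) UNIV {k. even k}"
  and bij_odd: "bij_betw (\<lambda>k::int. 2 * k + 1) UNIV {k. odd k}"
  by (auto simp: bij_betw_def inj_on_def elim!: evenE oddE) presburger?

lemma nn_integral_CZ_even_odd:
  "(\<integral>\<^sup>+k. f k \<partial>CZ) = (\<integral>\<^sup>+k. f (2 * k) \<partial>CZ) + (\<integral>\<^sup>+k. f (2 * k + 1) \<partial>CZ)" for f :: "int \<Rightarrow> ennreal"
proof -
  have e: "{k::int. even k} \<union> {k. odd k} = UNIV" by auto
  have "(\<integral>\<^sup>+k. f k \<partial>CZ) = (\<integral>\<^sup>+k\<in>{k. even k}. f k \<partial>CZ) + (\<integral>\<^sup>+k\<in>{k. odd k}. f k \<partial>CZ)"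
    using nn_integral_disjoint_pair_countspace[of "{k. even k}" "{k. odd k}" f] unfolding e by auto
  also have "(\<integral>\<^sup>+k\<in>{k. even k}. f k \<partial>CZ) = (\<integral>\<^sup>+k. f (2 * k) \<partial>CZ)"
    unfolding nn_integral_bij_count_space[OF bij_even] by (subst nn_integral_count_space_indicator) auto
  also have "(\<integral>\<^sup>+k\<in>{k. odd k}. f k \<partial>CZ) = (\<integral>\<^sup>+k. f (2 * k + 1) \<partial>CZ)"
    unfolding nn_integral_bij_count_space[OF bij_odd] by (subst nn_integral_count_space_indicator) auto
  finally show ?thesis .
qed

lemma integral_CZ_even_odd:
  fixes f :: "int \<Rightarrow> complex"
  assumes "integrable CZ f"
  shows "(LINT k|CZ. f k) = (LINT k|CZ. f (2 * k)) + (LINT k|CZ. f (2 * k + 1))"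
proof -
  have s: "Infinite_Set_Sum.abs_summable_on f UNIV" using assms by (simp add: abs_summable_on_def)
  have e: "{k::int. even k} \<union> {k. odd k} = UNIV" by auto
  have "infsetsum f ({k. even k} \<union> {k. odd k}) = infsetsum f {k. even k} + infsetsum f {k. odd k}"
    by (rule infsetsum_Un_disjoint) (auto intro: abs_summable_on_subset[OF s])
  also have "infsetsum f {k. even k} = infsetsum (\<lambda>k. f (2 * k)) UNIV"
    by (rule infsetsum_reindex_bij_betw[OF bij_even, symmetric])
  also have "infsetsum f {k. odd k} = infsetsum (\<lambda>k. f (2 * k + 1)) UNIV"
    by (rule infsetsum_reindex_bij_betw[OF bij_odd, symmetric])
  finally show ?thesis unfolding e by (simp add: infsetsum_def)
qed

text \<open>As \<open>x\<close> runs through the unit interval, \<open>x / 2\<close> and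
  \<open>x / 2 + 1/2\<close> sweep its two halves at half speed.\<close>

lemma nn_integral_U_halves:
  fixes f :: "real \<Rightarrow> ennreal"
  assumes f [measurable]: "f \<in> borel_measurable lebesgue"
  shows "(\<integral>\<^sup>+x. f (x / 2) + f (x / 2 + 1/2) \<partial>U) = 2 * (\<integral>\<^sup>+x. f x \<partial>U)"
proof -
  have m: "(\<lambda>x. f (x / 2)) \<in> borel_measurable lebesgue" "(\<lambda>x. f (x / 2 + 1/2)) \<in> borel_measurable lebesgue"
    using measurable_compose[OF lebesgue_affine_measurable_real f, of "1/2" 0]
      measurable_compose[OF lebesgue_affine_measurable_real f, of "1/2" "1/2"] by (simp_all add: add.commute)
  have [simp]: "{a..<b::real} \<in> sets lebesgue" for a b by simp
  have h1: "(\<integral>\<^sup>+x. f (x / 2) \<partial>U) = 2 * (\<integral>\<^sup>+y. f y * indicator {0..<1/2} y \<partial>lebesgue)"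
  proof -
    have "(\<integral>\<^sup>+x. f (x / 2) \<partial>U) = (\<integral>\<^sup>+x. f (x / 2) * indicator {0..<1} x \<partial>lebesgue)"
      by (subst nn_integral_restrict_space) auto
    also have "\<dots> = 2 * (\<integral>\<^sup>+y. f ((0 + 2 * y) / 2) * indicator {0..<1} (0 + 2 * y) \<partial>lebesgue)"
      using m by (subst nn_integral_real_affine_lebesgue[of _ 2 0]) auto
    also have "(\<integral>\<^sup>+y. f ((0 + 2 * y) / 2) * indicator {0..<1} (0 + 2 * y) \<partial>lebesgue)
        = (\<integral>\<^sup>+y. f y * indicator {0..<1/2} y \<partial>lebesgue)"
      by (intro nn_integral_cong) (auto simp: indicator_def)
    finally show ?thesis .
  qed
  have h2: "(\<integral>\<^sup>+x. f (x / 2 + 1/2) \<partial>U) = 2 * (\<integral>\<^sup>+y. f y * indicator {1/2..<1} y \<partial>lebesgue)"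
  proof -
    have "(\<integral>\<^sup>+x. f (x / 2 + 1/2) \<partial>U) = (\<integral>\<^sup>+x. f (x / 2 + 1/2) * indicator {0..<1} x \<partial>lebesgue)"
      by (subst nn_integral_restrict_space) auto
    also have "\<dots> = 2 * (\<integral>\<^sup>+y. f ((-1 + 2 * y) / 2 + 1/2) * indicator {0..<1} (-1 + 2 * y) \<partial>lebesgue)"
      using m by (subst nn_integral_real_affine_lebesgue[of _ 2 "-1"]) auto
    also have "(\<integral>\<^sup>+y. f ((-1 + 2 * y) / 2 + 1/2) * indicator {0..<1} (-1 + 2 * y) \<partial>lebesgue)
        = (\<integral>\<^sup>+y. f y * indicator {1/2..<1} y \<partial>lebesgue)"
      by (intro nn_integral_cong) (auto simp: indicator_def diff_divide_distrib)
    finally show ?thesis .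
  qed
  have "(\<integral>\<^sup>+x. f (x / 2) + f (x / 2 + 1/2) \<partial>U) = (\<integral>\<^sup>+x. f (x / 2) \<partial>U) + (\<integral>\<^sup>+x. f (x / 2 + 1/2) \<partial>U)"
    using m by (intro nn_integral_add measurable_restrict_space1)
  also have "\<dots> = 2 * ((\<integral>\<^sup>+y. f y * indicator {0..<1/2} y \<partial>lebesgue) + (\<integral>\<^sup>+y. f y * indicator {1/2..<1} y \<partial>lebesgue))"
    unfolding h1 h2 by (simp add: distrib_left)
  also have "(\<integral>\<^sup>+y. f y * indicator {0..<1/2} y \<partial>lebesgue) + (\<integral>\<^sup>+y. f y * indicator {1/2..<1} y \<partial>lebesgue)
      = (\<integral>\<^sup>+y. f y * indicator {0..<1/2} y + f y * indicator {1/2..<1} y \<partial>lebesgue)"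
    by (intro nn_integral_add[symmetric]) auto
  also have "\<dots> = (\<integral>\<^sup>+y. f y * indicator {0..<1} y \<partial>lebesgue)"
    by (intro nn_integral_cong) (auto simp: indicator_def)
  also have "\<dots> = (\<integral>\<^sup>+y. f y \<partial>U)"
    by (subst nn_integral_restrict_space) auto
  finally show ?thesis .
qed

section \<open>Energy of dilates\<close>

lemma has_sum_Sigma_nonneg:
  fixes f :: "'a \<times> 'b \<Rightarrow> real"
  assumes "\<And>x. x \<in> A \<Longrightarrow> ((\<lambda>y. f (x, y)) has_sum g x) (B x)" "(g has_sum S) A" "\<And>x. 0 \<le> f x"
  shows "(f has_sum S) (Sigma A B)"
  using assms by (intro has_sum_SigmaI[where g = g] summable_on_SigmaI[where g = g]) (auto intro: has_sum_imp_summable)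

text \<open>The differences are nonnegative, so the sum over any finite set containing a large
  symmetric window lies between the sum over that window and \<open>L\<close>; the window sums
  telescope.\<close>

lemma has_sum_int_telescope:
  fixes S :: "int \<Rightarrow> real"
  assumes mono: "\<And>j. S j \<le> S (j + 1)"
    and up: "(\<lambda>n. S (int n)) \<longlonglongrightarrow> L" and down: "(\<lambda>n. S (- int n)) \<longlonglongrightarrow> 0"
  shows "((\<lambda>j. S (j + 1) - S j) has_sum L) UNIV"
proof -
  define T where "T j = S (j + 1) - S j" for j
  have T0: "0 \<le> T j" for j using mono[of j] by (simp add: T_def)
  have sumT: "sum T {- int n..<int n} = S (int n) - S (- int n)" for n
  proof (induction n)
    case (Suc n)
    have "{- int (Suc n)..<int (Suc n)} = insert (- int n - 1) (insert (int n) {- int n..<int n})" by auto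
    moreover have "S (- 1 - int n) = S (- int n - 1)" "S (1 + int n) = S (int n + 1)"
      by (rule arg_cong[where f = S], simp)+
    ultimately show ?case using Suc by (simp add: T_def)
  qed simp
  have inc: "incseq (\<lambda>n. S (int n))"
    using mono[of "int n" for n] by (intro incseq_SucI) (simp only: of_nat_Suc add.commute)
  have dec: "decseq (\<lambda>n. S (- int n))"
  proof (rule decseq_SucI)
    show "S (- int (Suc n)) \<le> S (- int n)" for n using mono[of "- int (Suc n)"] by simp
  qed
  have bd: "sum T {- int n..<int n} \<le> L" for n
    unfolding sumT using incseq_le[OF inc up, of n] decseq_ge[OF dec down, of n] by linarith
  show ?thesis
    unfolding T_def[symmetric] has_sum_def tendsto_iff eventually_finite_subsets_at_top
  proof (intro allI impI)
    fix e :: real assume "e > 0"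
    moreover have "(\<lambda>n. sum T {- int n..<int n}) \<longlonglongrightarrow> L - 0"
      unfolding sumT by (intro tendsto_intros up down)
    ultimately have "eventually (\<lambda>n. L - e < sum T {- int n..<int n}) sequentially"
      by (intro order_tendstoD(1)) auto
    then obtain n where n: "L - e < sum T {- int n..<int n}"
      using eventually_happens sequentially_bot by blast
    have "dist (sum T Y) L < e" if Y: "finite Y" "{- int n..<int n} \<subseteq> Y" for Y
    proof -
      have "sum T {- int n..<int n} \<le> sum T Y" using Y T0 by (intro sum_mono2) auto
      moreover obtain N where N: "\<And>j. j \<in> Y \<Longrightarrow> nat \<bar>j\<bar> \<le> N"
        using Y(1) finite_nat_set_iff_bounded_le[of "(\<lambda>j. nat \<bar>j\<bar>) ` Y"] by auto
      have "Y \<subseteq> {- int (Suc N)..<int (Suc N)}"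
      proof
        fix j assume "j \<in> Y"
        from N[OF this] show "j \<in> {- int (Suc N)..<int (Suc N)}"
          unfolding atLeastLessThan_iff by linarith
      qed
      then have "sum T Y \<le> sum T {- int (Suc N)..<int (Suc N)}" using T0 by (intro sum_mono2) auto
      with bd[of "Suc N"] have "sum T Y \<le> L" by linarith
      ultimately show ?thesis using n by (simp add: dist_real_def)
    qed
    then show "\<exists>X. finite X \<and> X \<subseteq> UNIV \<and> (\<forall>Y. finite Y \<and> X \<subseteq> Y \<and> Y \<subseteq> UNIV \<longrightarrow> dist (sum T Y) L < e)"
      by (intro exI[of _ "{- int n..<int n}"]) auto
  qed
qed

sublocale lowpass \<subseteq> phi: bracket phi 1
  by unfold_locales (use phi_bracket phi_measurable_lebesgue in auto)

context lowpass
begin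

text \<open>The function with transform relation \<open>filt g (2 * t) = g t * phi t\<close>. The
  mask \<open>m\<close> reproduces \<open>phi\<close> itself, so scaling function and wavelets are
  handled by the same lemmas.\<close>

definition filt :: "(real \<Rightarrow> complex) \<Rightarrow> real \<Rightarrow> complex" where
  "filt g x = g (x / 2) * phi (x / 2)"

lemma filt_m: "filt m = phi"
  by (auto simp: filt_def phi_refine[symmetric])

text \<open>Halving the argument splits the integers by parity into two fibers of
  \<open>phi\<close>, each contributing at most 1.\<close>

lemma filt_bracket:
  assumes g: "g \<in> borel_measurable lebesgue" "\<And>x. cmod (g x) \<le> 1"
  shows "bracket (filt g) 2"
proof
  have "(\<lambda>x. g x * phi x) \<in> borel_measurable lebesgue"
    using g(1) phi_measurable_lebesgue by measurable
  from borel_measurable_lebesgue_affine[OF this, of "1/2" 0]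
  show "filt g \<in> borel_measurable lebesgue" unfolding filt_def[abs_def] by simp
  fix x
  have "(\<integral>\<^sup>+k. ennreal ((cmod (filt g (x + of_int k)))\<^sup>2) \<partial>CZ) \<le> (\<integral>\<^sup>+k. ennreal ((cmod (phi ((x + of_int k) / 2)))\<^sup>2) \<partial>CZ)"
  proof (intro nn_integral_mono ennreal_leI power_mono)
    fix k
    show "cmod (filt g (x + of_int k)) \<le> cmod (phi ((x + of_int k) / 2))"
      using mult_right_mono[OF g(2)] by (force simp: filt_def norm_mult)
  qed simp
  also have "\<dots> = (\<integral>\<^sup>+k. ennreal ((cmod (phi (x / 2 + of_int k)))\<^sup>2) \<partial>CZ)
      + (\<integral>\<^sup>+k. ennreal ((cmod (phi ((x + 1) / 2 + of_int k)))\<^sup>2) \<partial>CZ)"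
    unfolding nn_integral_CZ_even_odd[of "\<lambda>k. ennreal ((cmod (phi ((x + of_int k) / 2)))\<^sup>2)"]
    by (intro arg_cong2[where f = "(+)"] nn_integral_cong) (simp_all add: add_divide_distrib add_ac)
  also have "\<dots> \<le> 1 + 1" by (intro add_mono phi_bracket)
  finally show "(\<integral>\<^sup>+k. ennreal ((cmod (filt g (x + of_int k)))\<^sup>2) \<partial>CZ) \<le> ennreal 2" by simp
qed simp

text \<open>Even and odd integers give two fibers of step 1 at scale \<open>j + 1\<close>, based at
  \<open>x / 2\<close> and \<open>x / 2 + 1/2\<close>; on each of them the periodic mask
  \<open>g\<close> is constant. The splitting needs absolute summability, hence almost
  everywhere.\<close>

lemma bracket_product_filt:
  assumes g: "g \<in> borel_measurable lebesgue" "\<And>x. cmod (g x) \<le> 1" "\<And>x. g (x + 1) = g x"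
    and v: "sq_integrable lebesgue v"
  shows "AE x in U. bracket_product (dilate j v) (filt g) x = of_real (1 / sqrt 2) *
    (cnj (g (x / 2)) * bracket_product (dilate (j + 1) v) phi (x / 2) + cnj (g (x / 2 + 1/2)) * bracket_product (dilate (j + 1) v) phi (x / 2 + 1/2))"
proof -
  interpret F: bracket "filt g" 2 by (rule filt_bracket[OF g(1,2)])
  have gn: "g (x + real n) = g x" for x n
  proof (induction n)
    case (Suc n)
    then show ?case using g(3)[of "x + real n"] by (simp add: add_ac)
  qed simp
  have gi: "g (x + of_int n) = g x" for x n
    using gn[of x "nat n"] gn[of "x + of_int n" "nat (- n)"] by (cases "0 \<le> n") auto
  have fd: "filt g (2 * t) = g t * phi t" for t by (simp add: filt_def)
  have half: "(LINT k|CZ. dilate j v (2 * (y + of_int k)) * cnj (filt g (2 * (y + of_int k))))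
      = of_real (1 / sqrt 2) * (cnj (g y) * bracket_product (dilate (j + 1) v) phi y)" for y
  proof -
    have "dilate j v (2 * (y + of_int k)) * cnj (filt g (2 * (y + of_int k)))
        = (of_real (1 / sqrt 2) * cnj (g y)) * (dilate (j + 1) v (y + of_int k) * cnj (phi (y + of_int k)))" for k
      unfolding dilate_half fd gi by simp
    then have "(LINT k|CZ. dilate j v (2 * (y + of_int k)) * cnj (filt g (2 * (y + of_int k))))
        = (of_real (1 / sqrt 2) * cnj (g y)) * bracket_product (dilate (j + 1) v) phi y"
      unfolding bracket_product_def by (simp only: integral_mult_right_zero)
    then show ?thesis by (simp only: mult.assoc)
  qed
  show ?thesis
    using AE_sq_integrable_fiber[OF sq_integrable_dilate[OF v, of j]]
  proof eventually_elim
    case (elim x)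
    let ?f = "\<lambda>k::int. dilate j v (x + of_int k) * cnj (filt g (x + of_int k))"
    have i: "integrable CZ ?f" by (rule sq_integrable_inner_on_integrable[OF elim F.p_fiber])
    have e: "x + of_int (2 * k) = 2 * (x / 2 + of_int k)" "x + of_int (2 * k + 1) = 2 * ((x / 2 + 1/2) + of_int k)" for k
      by (simp_all add: field_simps)
    have "bracket_product (dilate j v) (filt g) x = (LINT k|CZ. ?f (2 * k)) + (LINT k|CZ. ?f (2 * k + 1))"
      unfolding bracket_product_def by (rule integral_CZ_even_odd[OF i])
    also have "\<dots> = of_real (1 / sqrt 2) * (cnj (g (x / 2)) * bracket_product (dilate (j + 1) v) phi (x / 2))
       + of_real (1 / sqrt 2) * (cnj (g (x / 2 + 1/2)) * bracket_product (dilate (j + 1) v) phi (x / 2 + 1/2))"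
      unfolding e half ..
    finally show ?case by (simp only: distrib_left)
  qed
qed

text \<open>The Bessel constant of \<open>phi\<close> is exactly 1, so the energy never exceeds the
  squared norm.\<close>

lemma dilate_dominated:
  assumes "sq_integrable lebesgue u" shows "phi.Q (dilate j u) \<le> sq_norm lebesgue u"
  using phi.Q_le[OF sq_integrable_dilate[OF assms, of j]] by (simp add: sq_norm_dilate[OF assms])

lemma Q_dilate_add_le:
  assumes "sq_integrable lebesgue u" "sq_integrable lebesgue v"
  shows "phi.Q (dilate j (\<lambda>x. u x + v x)) \<le> 2 * phi.Q (dilate j u) + 2 * phi.Q (dilate j v)"
  unfolding dilate_add by (intro phi.Q_add_le sq_integrable_dilate assms)

text \<open>The defect \<open>\<parallel>u\<parallel>\<^sup>2 - Q\<close> is itself a nonnegative quadratic form, so it suffices to know its limit on a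
  dense set.\<close>

lemma defect_dilate_add_le:
  assumes "sq_integrable lebesgue u" "sq_integrable lebesgue v"
  shows "sq_norm lebesgue (\<lambda>x. u x + v x) - phi.Q (dilate j (\<lambda>x. u x + v x))
    \<le> 2 * (sq_norm lebesgue u - phi.Q (dilate j u)) + 2 * (sq_norm lebesgue v - phi.Q (dilate j v))"
proof -
  have alg: "sp - qp \<le> 2 * (su - qu) + 2 * (sv - qv)"
    if "qp + qm = 2 * qu + 2 * qv" "sp + sm = 2 * su + 2 * sv" "qm \<le> sm" for sp sm su sv qp qm qu qv :: real
    using that unfolding right_diff_distrib by linarith
  show ?thesis
    unfolding dilate_add
    by (rule alg[OF phi.Q_parallelogram[OF sq_integrable_dilate[OF assms(1)] sq_integrable_dilate[OF assms(2)]] sq_norm_parallelogram[OF assms]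
        dilate_dominated[OF sq_integrable_diff[OF assms], unfolded dilate_diff]])
qed

text \<open>At fine scales the dilate is supported in an interval of length 1, so only one term of the
  bracket product survives.\<close>

lemma Q_dilate_compact_support:
  assumes u: "sq_integrable lebesgue u" and R: "\<And>x. x \<notin> {-R..<R} \<Longrightarrow> u x = 0" and j: "2 * R \<le> 2 powr of_int j"
  shows "phi.Q (dilate j u) = sq_norm lebesgue (\<lambda>x. u x * phi (x / 2 powr of_int j))"
proof -
  let ?v = "dilate j u"
  let ?w = "\<lambda>x. u x * phi (x / 2 powr of_int j)"
  have v0: "?v y = 0" if "y \<notin> {-(1/2)..<1/2}" for y
  proof -
    have p: "0 < (2::real) powr of_int j" by simp
    have "2 powr of_int j * y \<notin> {-R..<R}"
    proof (cases "y < -(1/2)")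
      case True
      then have "2 powr of_int j * y < 2 powr of_int j * (-(1/2))" using p by (intro mult_strict_left_mono) auto
      then show ?thesis using j unfolding atLeastLessThan_iff by linarith
    next
      case False
      then have "2 powr of_int j * (1/2) \<le> 2 powr of_int j * y" using p that by (intro mult_left_mono) auto
      then show ?thesis using j unfolding atLeastLessThan_iff by linarith
    qed
    then show ?thesis by (simp add: dilate_def R)
  qed
  have ws: "sq_integrable lebesgue ?w"
  proof (rule sq_integrable_bound[OF u, of _ 1])
    have "(\<lambda>x. phi (x / 2 powr of_int j)) \<in> borel_measurable lebesgue"
      using borel_measurable_lebesgue_affine[OF phi_measurable_lebesgue, of "1 / 2 powr of_int j" 0] by simp
    then show "?w \<in> borel_measurable lebesgue" using sq_integrable_measurable[OF u] by measurable
    show "cmod (?w x) \<le> 1 * cmod (u x)" for x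
      using mult_left_mono[OF phi_le_1[of "x / 2 powr of_int j"], of "cmod (u x)"] by (simp add: norm_mult)
  qed
  \<comment> \<open>Dilation carries \<open>phi (x / 2 powr j)\<close> back to \<open>phi\<close>,
    and being unitary it lets the norm be computed before dilating.\<close>
  have dw: "dilate j ?w = (\<lambda>x. ?v x * phi x)" by (auto simp: dilate_def)
  have m: "(\<lambda>x. ennreal ((cmod (?v x * cnj (phi x)))\<^sup>2)) \<in> borel_measurable lebesgue"
    using sq_integrable_measurable[OF sq_integrable_dilate[OF u, of j]] phi_measurable_lebesgue by measurable
  have "(\<integral>\<^sup>+x. ennreal ((cmod (bracket_product ?v phi x))\<^sup>2) \<partial>U)
      = (\<integral>\<^sup>+x. \<integral>\<^sup>+k. ennreal ((cmod (?v (x + of_int k) * cnj (phi (x + of_int k))))\<^sup>2) \<partial>CZ \<partial>U)"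
  proof (rule nn_integral_cong)
    fix x :: real
    let ?f = "\<lambda>k::int. ?v (x + of_int k) * cnj (phi (x + of_int k))"
    \<comment> \<open>The only integer that moves \<open>x\<close> into the interval from -1/2 to
      1/2 supporting the dilate.\<close>
    define k0 where "k0 = - \<lfloor>x + 1/2\<rfloor>"
    have z: "?f k = 0" if "k \<noteq> k0" for k
    proof -
      have "x + of_int k \<notin> {-(1/2)..<1/2}"
      proof
        assume "x + of_int k \<in> {-(1/2)..<1/2}"
        then have "\<lfloor>x + 1/2\<rfloor> = - k" by (intro floor_unique) auto
        with that show False by (simp add: k0_def)
      qed
      then show ?thesis by (simp add: v0)
    qed
    have "bracket_product ?v phi x = ?f k0"
    proof -
      have "{k \<in> UNIV. ?f k \<noteq> 0} \<subseteq> {k0}" using z by blast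
      then have "finite {k \<in> UNIV. ?f k \<noteq> 0}" by (rule finite_subset) simp
      then have "bracket_product ?v phi x = (\<Sum>k | k \<in> UNIV \<and> ?f k \<noteq> 0. ?f k)"
        unfolding bracket_product_def by (rule lebesgue_integral_count_space_finite_support)
      also have "\<dots> = (\<Sum>k\<in>{k0}. ?f k)"
        using z by (intro sum.mono_neutral_left) auto
      finally show ?thesis by simp
    qed
    moreover have "(\<integral>\<^sup>+k. ennreal ((cmod (?f k))\<^sup>2) \<partial>CZ) = (\<Sum>k\<in>{k0}. ennreal ((cmod (?f k))\<^sup>2))"
    proof (rule nn_integral_count_space')
      fix k assume "k \<notin> {k0}"
      then have "?f k = 0" by (intro z) simp
      then show "ennreal ((cmod (?f k))\<^sup>2) = 0" by simp
    qed auto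
    ultimately show "ennreal ((cmod (bracket_product ?v phi x))\<^sup>2) = (\<integral>\<^sup>+k. ennreal ((cmod (?f k))\<^sup>2) \<partial>CZ)" by simp
  qed
  also have "\<dots> = (\<integral>\<^sup>+x. ennreal ((cmod (?v x * cnj (phi x)))\<^sup>2) \<partial>lebesgue)"
    by (rule nn_integral_periodize[OF m, symmetric])
  also have "\<dots> = (\<integral>\<^sup>+x. ennreal ((cmod (dilate j ?w x))\<^sup>2) \<partial>lebesgue)"
    unfolding dw by (simp add: norm_mult)
  also have "\<dots> = ennreal (sq_norm lebesgue ?w)"
    by (subst nn_integral_sq_norm[OF sq_integrable_dilate[OF ws]]) (simp add: sq_norm_dilate[OF ws])
  finally show ?thesis
    unfolding nn_integral_sq_norm[OF phi.sq_integrable_bracket_product[OF sq_integrable_dilate[OF u]]] phi.Q_def by simp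
qed

text \<open>For a truncation the energy is eventually the squared norm of its product with
  \<open>phi (x / 2^j)\<close>, which tends to the truncation itself. For general \<open>u\<close>
  the defect is at most twice that of a truncation plus twice the squared norm of the remainder,
  both made smaller than \<open>e / 4\<close>.\<close>

lemma Q_dilate_tendsto:
  assumes u: "sq_integrable lebesgue u"
  shows "(\<lambda>j. phi.Q (dilate (int j) u)) \<longlonglongrightarrow> sq_norm lebesgue u"
proof -
  define D where "D w j = sq_norm lebesgue w - phi.Q (dilate (int j) w)" for w j
  have D0: "0 \<le> D w j" if "sq_integrable lebesgue w" for w j
    using dilate_dominated[OF that] by (simp add: D_def)
  have comp: "(\<lambda>j. D (trunc u n) j) \<longlonglongrightarrow> 0" for n
  proof -
    note ts = sq_integrable_trunc[OF u, of n]
    have "(\<lambda>j. sq_norm lebesgue (\<lambda>x. trunc u n x * phi (x / 2 powr of_int (int j)) - trunc u n x)) \<longlonglongrightarrow> 0"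
    proof (rule sq_norm_dominated_convergence[OF ts])
      show "(\<lambda>x. trunc u n x * phi (x / 2 powr of_int (int j))) \<in> borel_measurable lebesgue" for j
      proof -
        have "(\<lambda>x. phi (x / 2 powr of_int (int j))) \<in> borel_measurable lebesgue"
          using borel_measurable_lebesgue_affine[OF phi_measurable_lebesgue, of "1 / 2 powr of_int (int j)" 0] by simp
        then show ?thesis using sq_integrable_measurable[OF ts] by measurable
      qed
      show "cmod (trunc u n x * phi (x / 2 powr of_int (int j))) \<le> cmod (trunc u n x)" for j x
        using mult_left_mono[OF phi_le_1, of "cmod (trunc u n x)"] by (simp add: norm_mult)
      have "(\<lambda>j. trunc u n x * phi (x / 2 powr of_int (int j))) \<longlonglongrightarrow> trunc u n x * 1" for x
      proof (intro tendsto_mult tendsto_const phi_tendsto_1)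
        have "(\<lambda>j. x * (1/2) ^ j) \<longlonglongrightarrow> x * 0" by (intro tendsto_intros LIMSEQ_power_zero) simp
        then show "(\<lambda>j. x / 2 powr of_int (int j)) \<longlonglongrightarrow> 0"
          by (simp add: powr_realpow power_divide)
      qed
      then show "AE x in lebesgue. (\<lambda>j. trunc u n x * phi (x / 2 powr of_int (int j))) \<longlonglongrightarrow> trunc u n x" by simp
    qed (use sq_integrable_measurable[OF ts] in auto)
    moreover have "sq_integrable lebesgue (\<lambda>x. trunc u n x * phi (x / 2 powr of_int (int j)))" for j
    proof (rule sq_integrable_bound[OF ts, of _ 1])
      have "(\<lambda>x. phi (x / 2 powr of_int (int j))) \<in> borel_measurable lebesgue"
        using borel_measurable_lebesgue_affine[OF phi_measurable_lebesgue, of "1 / 2 powr of_int (int j)" 0] by simp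
      then show "(\<lambda>x. trunc u n x * phi (x / 2 powr of_int (int j))) \<in> borel_measurable lebesgue"
        using sq_integrable_measurable[OF ts] by measurable
      show "cmod (trunc u n x * phi (x / 2 powr of_int (int j))) \<le> 1 * cmod (trunc u n x)" for x
        using mult_left_mono[OF phi_le_1, of "cmod (trunc u n x)"] by (simp add: norm_mult)
    qed
    ultimately have lim: "(\<lambda>j. sq_norm lebesgue (\<lambda>x. trunc u n x * phi (x / 2 powr of_int (int j)))) \<longlonglongrightarrow> sq_norm lebesgue (trunc u n)"
      by (intro sq_norm_tendsto ts)
    have "eventually (\<lambda>j. sq_norm lebesgue (\<lambda>x. trunc u n x * phi (x / 2 powr of_int (int j))) = phi.Q (dilate (int j) (trunc u n))) sequentially"
    proof -
      obtain N where N: "2 * real (Suc n) < 2 ^ N" using real_arch_pow[of 2] by auto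
      show ?thesis
      proof (rule eventually_sequentiallyI[of N])
        fix j assume "N \<le> j"
        then have "(2::real) ^ N \<le> 2 ^ j" by (intro power_increasing) auto
        with N have "2 * real (Suc n) \<le> 2 ^ j" by linarith
        then have "2 * real (Suc n) \<le> 2 powr of_int (int j)" by (simp only: powr_realpow of_int_of_nat_eq zero_less_numeral)
        then show "sq_norm lebesgue (\<lambda>x. trunc u n x * phi (x / 2 powr of_int (int j))) = phi.Q (dilate (int j) (trunc u n))"
          by (intro Q_dilate_compact_support[symmetric] ts) (auto simp: trunc_def)
      qed
    qed
    with lim have "(\<lambda>j. phi.Q (dilate (int j) (trunc u n))) \<longlonglongrightarrow> sq_norm lebesgue (trunc u n)"
      by (rule Lim_transform_eventually)
    then have "(\<lambda>j. sq_norm lebesgue (trunc u n) - phi.Q (dilate (int j) (trunc u n))) \<longlonglongrightarrow> sq_norm lebesgue (trunc u n) - sq_norm lebesgue (trunc u n)"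
      by (intro tendsto_intros)
    then show ?thesis unfolding D_def by simp
  qed
  have "(\<lambda>j. D u j) \<longlonglongrightarrow> 0"
    unfolding lim_sequentially
  proof (intro allI impI)
    fix e :: real assume e: "e > 0"
    have "eventually (\<lambda>n. sq_norm lebesgue (\<lambda>x. trunc u n x - u x) < e / 4) sequentially"
      using e by (intro order_tendstoD(2)[OF trunc_L2[OF u]]) simp
    then obtain n where n: "sq_norm lebesgue (\<lambda>x. trunc u n x - u x) < e / 4"
      using eventually_happens sequentially_bot by blast
    have "eventually (\<lambda>j. D (trunc u n) j < e / 4) sequentially"
      using e by (intro order_tendstoD(2)[OF comp]) simp
    then obtain N where N: "\<And>j. j \<ge> N \<Longrightarrow> D (trunc u n) j < e / 4"
      unfolding eventually_sequentially by blast
    have "dist (D u j) 0 < e" if "j \<ge> N" for j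
    proof -
      let ?r = "\<lambda>x. u x - trunc u n x"
      have r: "sq_integrable lebesgue ?r" by (intro sq_integrable_diff u sq_integrable_trunc)
      have "D u j \<le> 2 * D (trunc u n) j + 2 * D ?r j"
        using defect_dilate_add_le[OF sq_integrable_trunc[OF u, of n] r, of "int j"] by (simp add: D_def)
      moreover have "D ?r j \<le> sq_norm lebesgue ?r" by (simp add: D_def phi.Q_nonneg)
      moreover have "sq_norm lebesgue ?r = sq_norm lebesgue (\<lambda>x. trunc u n x - u x)"
        by (simp add: sq_norm_def norm_minus_commute)
      ultimately show ?thesis using n N[OF that] D0[OF u, of j] by (simp add: dist_real_def)
    qed
    then show "\<exists>N. \<forall>j\<ge>N. dist (D u j) 0 < e" by blast
  qed
  then have "(\<lambda>j. sq_norm lebesgue u - D u j) \<longlonglongrightarrow> sq_norm lebesgue u - 0" by (intro tendsto_intros)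
  then show ?thesis by (simp add: D_def)
qed

end

section \<open>The unitary extension principle\<close>

lemma card_int_ball: "finite {k::int. \<bar>x + of_int k\<bar> \<le> T}" "0 \<le> T \<Longrightarrow> real (card {k::int. \<bar>x + of_int k\<bar> \<le> T}) \<le> 2 * T + 1"
proof -
  have e: "{k::int. \<bar>x + of_int k\<bar> \<le> T} = {\<lceil>- T - x\<rceil>..\<lfloor>T - x\<rfloor>}"
    by (auto simp: ceiling_le_iff le_floor_iff abs_le_iff)
  then show "finite {k::int. \<bar>x + of_int k\<bar> \<le> T}" by simp
  assume "0 \<le> T"
  then have "real (nat (\<lfloor>T - x\<rfloor> + 1 - \<lceil>- T - x\<rceil>)) \<le> 2 * T + 1"
    by (cases "\<lceil>- T - x\<rceil> \<le> \<lfloor>T - x\<rfloor> + 1") (simp, linarith, simp)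
  then show "real (card {k::int. \<bar>x + of_int k\<bar> \<le> T}) \<le> 2 * T + 1" unfolding e by simp
qed

context lowpass
begin

text \<open>Interchanging the roles of the two functions: the bracket of the dilate with itself is bounded
  because it counts at most \<open>2R \<cdot> 2\<^sup>j + 1\<close> points, each with weight of order \<open>1/2\<^sup>j\<close>, while \<open>phi\<close> enters only through its tail.\<close>

lemma Q_dilate_far_support:
  assumes w: "sq_integrable lebesgue w" and K: "\<And>x. cmod (w x) \<le> K" and d: "\<And>x. \<bar>x\<bar> < \<delta> \<Longrightarrow> w x = 0"
    and R: "\<And>x. R < \<bar>x\<bar> \<Longrightarrow> w x = 0" "0 \<le> R"
  shows "phi.Q (dilate (- int j) w) \<le> K\<^sup>2 * (2 * R + 1) * sq_norm lebesgue (\<lambda>x. if \<delta> * 2 ^ j \<le> \<bar>x\<bar> then phi x else 0)"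
proof -
  let ?v = "dilate (- int j) w"
  let ?p = "\<lambda>x. if \<delta> * 2 ^ j \<le> \<bar>x\<bar> then phi x else 0"
  have scale: "2 powr of_int (- int j) = (1 / 2 ^ j :: real)"
    by (simp add: powr_minus_divide powr_realpow)
  have v: "?v x = of_real (2 powr (of_int (- int j) / 2)) * w (x / 2 ^ j)" for x
    unfolding dilate_def scale by simp
  have v0: "?v x = 0" if "\<bar>x\<bar> < \<delta> * 2 ^ j \<or> R * 2 ^ j < \<bar>x\<bar>" for x
  proof -
    have "\<bar>x / 2 ^ j\<bar> < \<delta> \<or> R < \<bar>x / 2 ^ j\<bar>"
      using that by (simp add: pos_divide_less_eq pos_less_divide_eq)
    then show ?thesis unfolding v using d R(1) by auto
  qed
  have p: "sq_integrable lebesgue ?p"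
  proof (rule sq_integrable_bound[OF phi_sq_integrable, of _ 1])
    have "(\<lambda>x. if \<delta> * 2 ^ j \<le> \<bar>x\<bar> then phi x else 0) \<in> borel_measurable borel" by measurable
    then show "?p \<in> borel_measurable lebesgue" by (intro measurable_completion) simp
  qed auto
  have vs: "sq_integrable lebesgue ?v" by (rule sq_integrable_dilate[OF w])
  have "(\<integral>\<^sup>+k. ennreal ((cmod (?v (x + of_int k)))\<^sup>2) \<partial>CZ) \<le> ennreal (K\<^sup>2 * (2 * R + 1))" for x
  proof -
    let ?A = "{k::int. \<bar>x + of_int k\<bar> \<le> R * 2 ^ j}"
    have bd: "(cmod (?v y))\<^sup>2 \<le> K\<^sup>2 / 2 ^ j" for y
    proof -
      have "(2 powr (of_int (- int j) / 2))\<^sup>2 = (1 / 2 ^ j :: real)"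
        unfolding scale[symmetric] by (simp add: power2_eq_square flip: powr_add)
      then have "(cmod (?v y))\<^sup>2 = (cmod (w (y / 2 ^ j)))\<^sup>2 / 2 ^ j"
        unfolding v norm_mult power_mult_distrib by simp
      also have "\<dots> \<le> K\<^sup>2 / 2 ^ j" using K by (intro divide_right_mono power_mono) auto
      finally show ?thesis .
    qed
    have "(\<integral>\<^sup>+k. ennreal ((cmod (?v (x + of_int k)))\<^sup>2) \<partial>CZ) = (\<Sum>k\<in>?A. ennreal ((cmod (?v (x + of_int k)))\<^sup>2))"
    proof (rule nn_integral_count_space')
      fix k assume "k \<notin> ?A"
      then have "?v (x + of_int k) = 0" by (intro v0) auto
      then show "ennreal ((cmod (?v (x + of_int k)))\<^sup>2) = 0" by simp
    qed (auto simp: card_int_ball)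
    also have "\<dots> \<le> (\<Sum>k\<in>?A. ennreal (K\<^sup>2 / 2 ^ j))" by (intro sum_mono ennreal_leI bd)
    also have "\<dots> = ennreal (real (card ?A) * (K\<^sup>2 / 2 ^ j))"
      by (subst ennreal_mult) (auto simp: ennreal_of_nat_eq_real_of_nat)
    also have "real (card ?A) * (K\<^sup>2 / 2 ^ j) \<le> (2 * (R * 2 ^ j) + 1) * (K\<^sup>2 / 2 ^ j)"
      using R(2) by (intro mult_right_mono card_int_ball(2)) auto
    also have "\<dots> = K\<^sup>2 * (2 * R + 1 / 2 ^ j)" by (simp add: field_simps)
    also have "\<dots> \<le> K\<^sup>2 * (2 * R + 1)" by (intro mult_left_mono add_left_mono) auto
    finally show ?thesis by (simp add: ennreal_leI)
  qed
  note le = sq_norm_bracket_product_le[OF p sq_integrable_measurable[OF vs] this]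
  have "bracket_product ?v phi x = cnj (bracket_product ?p ?v x)" for x
  proof -
    \<comment> \<open>The dilate vanishes for arguments below \<open>\<delta> * 2^j\<close>, so
      \<open>phi\<close> may be replaced by its tail \<open>?p\<close>.\<close>
    have "?v y * cnj (phi y) = ?v y * cnj (?p y)" for y using v0[of y] by (cases "\<delta> * 2 ^ j \<le> \<bar>y\<bar>") auto
    then have "bracket_product ?v phi x = bracket_product ?v ?p x" unfolding bracket_product_def by (intro Bochner_Integration.integral_cong refl)
    also have "\<dots> = cnj (bracket_product ?p ?v x)" unfolding bracket_product_inner_on by (rule inner_on_commute)
    finally show ?thesis .
  qed
  then have "phi.Q ?v = sq_norm U (bracket_product ?p ?v)"
    unfolding phi.Q_def sq_norm_def by simp
  also have "\<dots> \<le> K\<^sup>2 * (2 * R + 1) * sq_norm lebesgue ?p"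
    by (rule le) (use R(2) in auto)
  finally show ?thesis .
qed

lemma Q_dilate_tendsto_0:
  assumes u: "sq_integrable lebesgue u"
  shows "(\<lambda>j. phi.Q (dilate (- int j) u)) \<longlonglongrightarrow> 0"
proof -
  \<comment> \<open>The three cut-offs provide the \<delta>, \<open>R\<close> and \<open>K\<close>
    of \<open>Q_dilate_far_support\<close>. At the point 0 the value of \<open>t n\<close> stays 0,
    so convergence to \<open>u\<close> is claimed only off a null set.\<close>
  define t where "t n x = (if 1 / real (Suc n) \<le> \<bar>x\<bar> \<and> \<bar>x\<bar> \<le> real (Suc n) \<and> cmod (u x) \<le> real n then u x else 0)" for n x
  note [measurable] = sq_integrable_measurable[OF u]
  have tm: "t n \<in> borel_measurable lebesgue" for n
    unfolding t_def[abs_def] by measurable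
  have ts: "sq_integrable lebesgue (t n)" for n
    by (rule sq_integrable_bound[OF u tm, where c = 1]) (auto simp: t_def)
  have tl: "(\<lambda>n. sq_norm lebesgue (\<lambda>x. t n x - u x)) \<longlonglongrightarrow> 0"
  proof (rule sq_norm_dominated_convergence[OF u])
    have lim: "(\<lambda>n. t n x) \<longlonglongrightarrow> u x" if "x \<noteq> 0" for x
    proof (rule tendsto_eventually)
      obtain M1 where M1: "1 / \<bar>x\<bar> < real M1" using reals_Archimedean2 by blast
      obtain M2 where M2: "\<bar>x\<bar> < real M2" using reals_Archimedean2 by blast
      obtain M3 where M3: "cmod (u x) < real M3" using reals_Archimedean2 by blast
      show "eventually (\<lambda>n. t n x = u x) sequentially"
      proof (rule eventually_sequentiallyI[of "max M1 (max M2 M3)"])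
        fix n assume n: "max M1 (max M2 M3) \<le> n"
        then have "real M1 \<le> real n" "real M2 \<le> real n" "real M3 \<le> real n" by simp_all
        then have "1 / \<bar>x\<bar> \<le> real (Suc n)" "\<bar>x\<bar> \<le> real (Suc n)" "cmod (u x) \<le> real n"
          using M1 M2 M3 by linarith+
        moreover from this(1) have "1 / real (Suc n) \<le> \<bar>x\<bar>"
          using that by (simp add: pos_divide_le_eq mult.commute)
        ultimately show "t n x = u x" by (simp add: t_def)
      qed
    qed
    have "AE x in lebesgue. x \<notin> {0::real}" by (intro AE_not_in) (simp add: negligible_iff_null_sets[symmetric])
    then show "AE x in lebesgue. (\<lambda>n. t n x) \<longlonglongrightarrow> u x" by eventually_elim (simp add: lim)
  qed (auto simp: t_def tm)
  have comp: "(\<lambda>j. phi.Q (dilate (- int j) (t n))) \<longlonglongrightarrow> 0" for n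
  proof -
    let ?d = "1 / real (Suc n)" and ?R = "real (Suc n)"
    let ?p = "\<lambda>j x. if ?d * 2 ^ j \<le> \<bar>x\<bar> then phi x else 0"
    have "(\<lambda>j. sq_norm lebesgue (\<lambda>x. ?p j x - 0)) \<longlonglongrightarrow> 0"
    proof (rule sq_norm_dominated_convergence[OF phi_sq_integrable])
      have "?p j \<in> borel_measurable borel" for j by measurable
      then show "?p j \<in> borel_measurable lebesgue" for j by (intro measurable_completion) simp
      have "(\<lambda>j. ?p j x) \<longlonglongrightarrow> 0" for x
      proof (rule tendsto_eventually)
        obtain N where N: "\<bar>x\<bar> * real (Suc n) < 2 ^ N" using real_arch_pow[of 2 "\<bar>x\<bar> * real (Suc n)"] by auto
        show "eventually (\<lambda>j. ?p j x = 0) sequentially"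
        proof (rule eventually_sequentiallyI[of N])
          fix j assume "N \<le> j"
          then have "(2::real) ^ N \<le> 2 ^ j" by (intro power_increasing) auto
          with N have "\<bar>x\<bar> * real (Suc n) < 2 ^ j" by linarith
          then have "\<bar>x\<bar> < ?d * 2 ^ j" by (simp add: pos_less_divide_eq)
          then show "?p j x = 0" by simp
        qed
      qed
      then show "AE x in lebesgue. (\<lambda>j. ?p j x) \<longlonglongrightarrow> 0" by simp
    qed auto
    then have lim: "(\<lambda>j. (real n)\<^sup>2 * (2 * ?R + 1) * sq_norm lebesgue (?p j)) \<longlonglongrightarrow> 0"
      by (intro tendsto_mult_right_zero) simp
    have "phi.Q (dilate (- int j) (t n)) \<le> (real n)\<^sup>2 * (2 * ?R + 1) * sq_norm lebesgue (?p j)" for j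
      by (rule Q_dilate_far_support[OF ts]) (auto simp: t_def)
    then show ?thesis
      by (intro tendsto_sandwich[OF always_eventually always_eventually tendsto_const lim] allI phi.Q_nonneg)
  qed
  show ?thesis
    unfolding lim_sequentially
  proof (intro allI impI)
    fix e :: real assume e: "e > 0"
    have "eventually (\<lambda>n. sq_norm lebesgue (\<lambda>x. t n x - u x) < e / 4) sequentially"
      using e by (intro order_tendstoD(2)[OF tl]) simp
    then obtain n where n: "sq_norm lebesgue (\<lambda>x. t n x - u x) < e / 4"
      using eventually_happens sequentially_bot by blast
    have "eventually (\<lambda>j. phi.Q (dilate (- int j) (t n)) < e / 4) sequentially"
      using e by (intro order_tendstoD(2)[OF comp]) simp
    then obtain N where N: "\<And>j. j \<ge> N \<Longrightarrow> phi.Q (dilate (- int j) (t n)) < e / 4"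
      unfolding eventually_sequentially by blast
    have "dist (phi.Q (dilate (- int j) u)) 0 < e" if "j \<ge> N" for j
    proof -
      let ?r = "\<lambda>x. u x - t n x"
      have r: "sq_integrable lebesgue ?r" by (intro sq_integrable_diff u ts)
      have "phi.Q (dilate (- int j) u) \<le> 2 * phi.Q (dilate (- int j) (t n)) + 2 * phi.Q (dilate (- int j) ?r)"
        using Q_dilate_add_le[OF ts[of n] r, of "- int j"] by simp
      moreover have "phi.Q (dilate (- int j) ?r) \<le> sq_norm lebesgue ?r" by (rule dilate_dominated[OF r])
      moreover have "sq_norm lebesgue ?r = sq_norm lebesgue (\<lambda>x. t n x - u x)"
        by (simp add: sq_norm_def norm_minus_commute)
      ultimately have "phi.Q (dilate (- int j) u) < e" using n N[OF that] by linarith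
      then show ?thesis using phi.Q_nonneg by (simp add: dist_real_def)
    qed
    then show "\<exists>N. \<forall>j\<ge>N. dist (phi.Q (dilate (- int j) u)) 0 < e" by blast
  qed
qed

end

text \<open>For each \<open>x\<close> the vectors of all filter values, \<open>m\<close> included,
  at \<open>x\<close> and at \<open>x + 1/2\<close> are orthonormal: \<open>uep_diag\<close> gives
  length 1 at either point, \<open>uep_off\<close> orthogonality.\<close>

locale uep = lowpass m for m +
  fixes N :: "'n set" and h :: "'n \<Rightarrow> real \<Rightarrow> complex"
  assumes finite_N: "finite N"
    and h_measurable: "n \<in> N \<Longrightarrow> h n \<in> borel_measurable lebesgue"
    and h_periodic: "n \<in> N \<Longrightarrow> h n (x + 1) = h n x"
    and uep_diag: "(cmod (m x))\<^sup>2 + (\<Sum>n\<in>N. (cmod (h n x))\<^sup>2) = 1"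
    and uep_off: "m x * cnj (m (x + 1/2)) + (\<Sum>n\<in>N. h n x * cnj (h n (x + 1/2))) = 0"
begin

lemma h_le_1: assumes "n \<in> N" shows "cmod (h n x) \<le> 1"
proof -
  have "(cmod (h n x))\<^sup>2 \<le> (\<Sum>n\<in>N. (cmod (h n x))\<^sup>2)"
    using assms finite_N by (intro member_le_sum) auto
  also have "\<dots> \<le> 1\<^sup>2" using uep_diag[of x] zero_le_power2[of "cmod (m x)"] unfolding power_one by linarith
  finally show ?thesis by (rule power2_le_imp_le) simp
qed

text \<open>A matrix with two orthonormal columns acts as an isometry on the pair
  \<open>(A, B)\<close>; the filter identities are the entries of its Gram matrix.\<close>

lemma uep_norm:
  "(cmod (cnj (m y) * A + cnj (m (y + 1/2)) * B))\<^sup>2 + (\<Sum>n\<in>N. (cmod (cnj (h n y) * A + cnj (h n (y + 1/2)) * B))\<^sup>2)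
    = (cmod A)\<^sup>2 + (cmod B)\<^sup>2"
proof -
  let ?z = "y + 1/2"
  have m1: "m (?z + 1/2) = m y" using m_periodic[of y] by (simp add: add.assoc)
  have e: "(cmod (cnj a * A + cnj b * B))\<^sup>2
      = (cmod a)\<^sup>2 * (cmod A)\<^sup>2 + (cmod b)\<^sup>2 * (cmod B)\<^sup>2 + 2 * Re (cnj (a * cnj b) * (A * cnj B))" for a b
    unfolding cmod_power2 by (simp add: power2_eq_square algebra_simps)
  have "(cmod (cnj (m y) * A + cnj (m ?z) * B))\<^sup>2 + (\<Sum>n\<in>N. (cmod (cnj (h n y) * A + cnj (h n ?z) * B))\<^sup>2)
     = ((cmod (m y))\<^sup>2 + (\<Sum>n\<in>N. (cmod (h n y))\<^sup>2)) * (cmod A)\<^sup>2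
     + ((cmod (m ?z))\<^sup>2 + (\<Sum>n\<in>N. (cmod (h n ?z))\<^sup>2)) * (cmod B)\<^sup>2
     + 2 * Re (cnj (m y * cnj (m ?z) + (\<Sum>n\<in>N. h n y * cnj (h n ?z))) * (A * cnj B))"
    unfolding e
    by (simp add: sum.distrib sum_distrib_left sum_distrib_right distrib_left distrib_right Re_sum Im_sum
        del: times_complex.simps)
  then show ?thesis unfolding uep_diag uep_off by simp
qed

definition psi :: "'n \<Rightarrow> real \<Rightarrow> complex" where "psi n = filt (h n)"

lemma psi_bracket: "n \<in> N \<Longrightarrow> bracket (psi n) 2"
  unfolding psi_def by (intro filt_bracket h_measurable h_le_1)

text \<open>By \<open>bracket_product_filt\<close> the vector of all bracket products at scale
  \<open>j\<close> is the image under that isometry of the bracket product of \<open>phi\<close> at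
  scale \<open>j + 1\<close>, taken at \<open>x / 2\<close> and \<open>x / 2 + 1/2\<close>.\<close>

lemma energy_step:
  assumes v: "sq_integrable lebesgue v"
  shows "phi.Q (dilate j v) + (\<Sum>n\<in>N. bracket.Q (psi n) (dilate j v)) = phi.Q (dilate (j + 1) v)"
proof -
  let ?G = "bracket_product (dilate (j + 1) v) phi"
  have Gm: "?G \<in> borel_measurable lebesgue"
    by (intro bracket_product_measurable phi_measurable_lebesgue sq_integrable_measurable[OF sq_integrable_dilate[OF v]])
  \<comment> \<open>The division by 2 is the square of \<open>1 / sqrt 2\<close> in
    \<open>bracket_product_filt\<close>; it cancels the 2 of
    \<open>nn_integral_U_halves\<close>.\<close>
  define R where "R x = ((cmod (?G (x / 2)))\<^sup>2 + (cmod (?G (x / 2 + 1/2)))\<^sup>2) / 2" for x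
  have mm: "m \<in> borel_measurable lebesgue" by (rule measurable_completion) simp
  have sb: "sq_integrable U (bracket_product (dilate j v) (psi n))" if "n \<in> N" for n
    by (rule bracket.sq_integrable_bracket_product[OF psi_bracket[OF that] sq_integrable_dilate[OF v]])
  have sp: "sq_integrable U (bracket_product (dilate j v) phi)" by (rule phi.sq_integrable_bracket_product[OF sq_integrable_dilate[OF v]])
  have ae: "AE x in U. (cmod (bracket_product (dilate j v) phi x))\<^sup>2 + (\<Sum>n\<in>N. (cmod (bracket_product (dilate j v) (psi n) x))\<^sup>2) = R x"
  proof -
    have "AE x in U. \<forall>n\<in>N. bracket_product (dilate j v) (psi n) x = of_real (1 / sqrt 2) *
      (cnj (h n (x / 2)) * ?G (x / 2) + cnj (h n (x / 2 + 1/2)) * ?G (x / 2 + 1/2))"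
      unfolding psi_def using finite_N
      by (intro AE_finite_allI bracket_product_filt h_measurable h_le_1 h_periodic v)
    moreover have "AE x in U. bracket_product (dilate j v) phi x = of_real (1 / sqrt 2) *
      (cnj (m (x / 2)) * ?G (x / 2) + cnj (m (x / 2 + 1/2)) * ?G (x / 2 + 1/2))"
      using bracket_product_filt[OF mm m_le_1 m_periodic v, of j] unfolding filt_m .
    ultimately show ?thesis
    proof eventually_elim
      case (elim x)
      have s: "(cmod (of_real (1 / sqrt 2) * c))\<^sup>2 = (cmod c)\<^sup>2 / 2" for c
        by (simp add: norm_mult norm_divide power_divide)
      have "(\<Sum>n\<in>N. (cmod (bracket_product (dilate j v) (psi n) x))\<^sup>2)
        = (\<Sum>n\<in>N. (cmod (cnj (h n (x / 2)) * ?G (x / 2) + cnj (h n (x / 2 + 1/2)) * ?G (x / 2 + 1/2)))\<^sup>2) / 2"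
        unfolding sum_divide_distrib by (intro sum.cong refl) (simp only: elim(1) s)
      then show ?case
        unfolding elim(2) s R_def using uep_norm[of "x / 2" "?G (x / 2)" "?G (x / 2 + 1/2)"] by simp
    qed
  qed
  have Rm: "R \<in> borel_measurable U"
  proof -
    have "(\<lambda>x. ?G (x / 2)) \<in> borel_measurable lebesgue" "(\<lambda>x. ?G (x / 2 + 1/2)) \<in> borel_measurable lebesgue"
      using borel_measurable_lebesgue_affine[OF Gm, of "1/2" 0] borel_measurable_lebesgue_affine[OF Gm, of "1/2" "1/2"]
      by (simp_all add: add.commute)
    then have "R \<in> borel_measurable lebesgue" unfolding R_def[abs_def] by measurable
    then show ?thesis by (rule measurable_U)
  qed
  have "phi.Q (dilate j v) + (\<Sum>n\<in>N. bracket.Q (psi n) (dilate j v))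
      = phi.Q (dilate j v) + (\<Sum>n\<in>N. sq_norm U (bracket_product (dilate j v) (psi n)))"
    using bracket.Q_def[OF psi_bracket] by simp
  also have "\<dots> = (LINT x|U. (cmod (bracket_product (dilate j v) phi x))\<^sup>2 + (\<Sum>n\<in>N. (cmod (bracket_product (dilate j v) (psi n) x))\<^sup>2))"
  proof -
    have "(LINT x|U. (\<Sum>n\<in>N. (cmod (bracket_product (dilate j v) (psi n) x))\<^sup>2)) = (\<Sum>n\<in>N. LINT x|U. (cmod (bracket_product (dilate j v) (psi n) x))\<^sup>2)"
      by (rule Bochner_Integration.integral_sum) (rule sq_integrable_integrable[OF sb])
    then show ?thesis
      unfolding phi.Q_def sq_norm_def
      by (subst Bochner_Integration.integral_add)
        (auto intro!: sq_integrable_integrable sp sb Bochner_Integration.integrable_sum)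
  qed
  also have "\<dots> = (LINT x|U. R x)"
    by (rule integral_cong_AE[OF _ Rm ae])
      (use sq_integrable_integrable[OF sp] sq_integrable_integrable[OF sb] in \<open>auto intro!: borel_measurable_add borel_measurable_sum\<close>)
  also have "\<dots> = enn2real (\<integral>\<^sup>+x. ennreal (R x) \<partial>U)"
    by (rule integral_eq_nn_integral[OF Rm]) (simp add: R_def)
  also have "(\<integral>\<^sup>+x. ennreal (R x) \<partial>U) = ennreal (phi.Q (dilate (j + 1) v))"
  proof -
    let ?g = "\<lambda>y. ennreal ((cmod (?G y))\<^sup>2 / 2)"
    have "(\<integral>\<^sup>+x. ennreal (R x) \<partial>U) = (\<integral>\<^sup>+x. ?g (x / 2) + ?g (x / 2 + 1/2) \<partial>U)"
      unfolding R_def by (intro nn_integral_cong) (simp add: add_divide_distrib flip: ennreal_plus)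
    also have "\<dots> = 2 * (\<integral>\<^sup>+x. ?g x \<partial>U)"
      by (rule nn_integral_U_halves) (use Gm in measurable)
    also have "\<dots> = (\<integral>\<^sup>+x. 2 * ?g x \<partial>U)"
      by (rule nn_integral_cmult[symmetric]) (use measurable_U[OF Gm] in measurable)
    also have "\<dots> = (\<integral>\<^sup>+x. ennreal ((cmod (?G x))\<^sup>2) \<partial>U)"
    proof (intro nn_integral_cong)
      fix x
      have "2 * ?g x = ennreal (2 * ((cmod (?G x))\<^sup>2 / 2))" by (subst ennreal_mult) auto
      then show "2 * ?g x = ennreal ((cmod (?G x))\<^sup>2)" by simp
    qed
    also have "\<dots> = ennreal (phi.Q (dilate (j + 1) v))"
      unfolding phi.Q_def by (rule nn_integral_sq_norm[OF phi.sq_integrable_bracket_product[OF sq_integrable_dilate[OF v]]])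
    finally show ?thesis .
  qed
  finally show ?thesis using phi.Q_nonneg by simp
qed

theorem uep_has_sum:
  assumes v: "sq_integrable lebesgue v"
  shows "((\<lambda>(n, j, k). (cmod (inner_on lebesgue (dilate j v) (\<lambda>x. psi n x * cnj (ee (of_int k * x)))))\<^sup>2)
    has_sum sq_norm lebesgue v) (N \<times> (UNIV :: int set) \<times> (UNIV :: int set))"
proof -
  define c where "c n j k = (cmod (inner_on lebesgue (dilate j v) (\<lambda>x. psi n x * cnj (ee (of_int k * x)))))\<^sup>2" for n and j k :: int
  have c0: "0 \<le> c n j k" for n j k by (simp add: c_def)
  have S: "phi.Q (dilate (j + 1) v) - phi.Q (dilate j v) = (\<Sum>n\<in>N. bracket.Q (psi n) (dilate j v))" for j
    using energy_step[OF v, of j] by linarith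
  have Q0: "0 \<le> bracket.Q (psi n) (dilate j v)" if "n \<in> N" for n j
    by (rule bracket.Q_nonneg[OF psi_bracket[OF that]])
  have "((\<lambda>j. phi.Q (dilate (j + 1) v) - phi.Q (dilate j v)) has_sum sq_norm lebesgue v) UNIV"
  proof (rule has_sum_int_telescope)
    show "phi.Q (dilate j v) \<le> phi.Q (dilate (j + 1) v)" for j
      using S[of j] sum_nonneg[of N "\<lambda>n. bracket.Q (psi n) (dilate j v)"] Q0 by simp
  qed (rule Q_dilate_tendsto[OF v] Q_dilate_tendsto_0[OF v])+
  then have "((\<lambda>j. \<Sum>n\<in>N. bracket.Q (psi n) (dilate j v)) has_sum sq_norm lebesgue v) UNIV"
    unfolding S .
  moreover have "((\<lambda>(n, k). c n j k) has_sum (\<Sum>n\<in>N. bracket.Q (psi n) (dilate j v))) (N \<times> UNIV)" for j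
  proof (rule has_sum_Sigma_nonneg[where g = "\<lambda>n. bracket.Q (psi n) (dilate j v)"])
    fix n assume "n \<in> N"
    show "((\<lambda>k. case (n, k) of (n, k) \<Rightarrow> c n j k) has_sum bracket.Q (psi n) (dilate j v)) UNIV"
      using bracket.has_sum_translates[OF psi_bracket[OF \<open>n \<in> N\<close>] sq_integrable_dilate[OF v, of j]] by (simp add: c_def)
  qed (use finite_N c0 in auto)
  ultimately have "((\<lambda>(j, n, k). c n j k) has_sum sq_norm lebesgue v) (UNIV \<times> (N \<times> UNIV))"
    by (intro has_sum_Sigma_nonneg[where g = "\<lambda>j. \<Sum>n\<in>N. bracket.Q (psi n) (dilate j v)"]) (auto simp: c0)
  \<comment> \<open>Telescoping needs \<open>j\<close> outermost, whereas the frame is indexed by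
    \<open>(n, j, k)\<close>.\<close>
  moreover have "bij_betw (\<lambda>(n, j, k). (j, n, k)) (N \<times> (UNIV :: int set) \<times> (UNIV :: int set)) (UNIV \<times> (N \<times> UNIV))"
    by (rule bij_betwI[where g = "\<lambda>(j, n, k). (n, j, k)"]) auto
  ultimately have "((\<lambda>x. (\<lambda>(j, n, k). c n j k) ((\<lambda>(n, j, k). (j, n, k)) x)) has_sum sq_norm lebesgue v) (N \<times> UNIV \<times> UNIV)"
    by (simp only: has_sum_reindex_bij_betw)
  then show ?thesis by (simp add: c_def case_prod_unfold)
qed

end

section \<open>Complex pseudo-splines\<close>

text \<open>The bound keeps \<open>w + 1\<close> off the poles of \<open>Gamma\<close>, where
  \<open>Gamma\<close> has the default value 0 and the quotient would collapse to 0.\<close>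

lemma cbinom_0: "Re w > -1 \<Longrightarrow> cbinom w 0 = 1"
proof -
  assume w: "Re w > -1"
  have "w + 1 \<notin> \<int>\<^sub>\<le>\<^sub>0"
  proof
    assume "w + 1 \<in> \<int>\<^sub>\<le>\<^sub>0"
    then obtain n where "w + 1 = of_int n" "n \<le> 0" by (auto elim!: nonpos_Ints_cases)
    then have "Re (w + 1) = of_int n" by (metis Re_complex_of_real of_real_of_int_eq)
    with w \<open>n \<le> 0\<close> show False by simp
  qed
  then show ?thesis by (simp add: cbinom_def Gamma_eq_zero_iff)
qed

lemma H0_0:
  assumes "Re z \<ge> 1" shows "H0 z l 0 = 1"
proof -
  have "(\<Sum>k = 0..l. cbinom (z + of_nat l) k * of_real (((sin (pi * 0))\<^sup>2) ^ k * ((cos (pi * 0))\<^sup>2) ^ (l - k)))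
      = (\<Sum>k\<in>{0}. cbinom (z + of_nat l) k * of_real (((sin (pi * 0))\<^sup>2) ^ k * ((cos (pi * 0))\<^sup>2) ^ (l - k)))"
    by (intro sum.mono_neutral_right) auto
  then show ?thesis using assms by (simp add: H0_def cbinom_0)
qed

lemma H0_periodic: "H0 z l (x + 1) = H0 z l x"
  by (simp add: H0_def distrib_left)

lemma H0_measurable: "H0 z l \<in> borel_measurable borel"
proof -
  have [measurable]: "(exp :: complex \<Rightarrow> complex) \<in> borel_measurable borel"
    by (intro borel_measurable_continuous_onI continuous_intros)
  have [measurable]: "(\<lambda>x::real. (cos (pi * x))\<^sup>2) \<in> borel_measurable borel"
    by (intro borel_measurable_continuous_onI continuous_intros)
  have [measurable]: "(\<lambda>x. (\<Sum>k = 0..l. cbinom (z + of_nat l) k * of_real (((sin (pi * x))\<^sup>2) ^ k * ((cos (pi * x))\<^sup>2) ^ (l - k)))) \<in> borel_measurable borel"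
    by (intro borel_measurable_continuous_onI continuous_intros)
  \<comment> \<open>The explicit case at 0 covers the zeros of the cosine, where \<open>powr\<close>
    gives 0.\<close>
  have p: "complex_of_real r powr z = (if r = 0 then 0 else exp (z * of_real (ln r)))" if "0 \<le> r" for r
    using that by (simp add: powr_def Ln_of_real)
  show ?thesis
    unfolding H0_def[abs_def] p[OF zero_le_power2] by measurable
qed

text \<open>Near 0 the function extends holomorphically, because there the squared cosine avoids the
  branch cut of \<open>Ln\<close>. The difference quotient at 0 stays below
  \<open>cmod D + 1\<close>, which becomes the Lipschitz constant.\<close>

lemma H0_near_0:
  assumes "Re z \<ge> 1"
  shows "\<exists>C \<delta>. 0 < \<delta> \<and> (\<forall>x. \<bar>x\<bar> < \<delta> \<longrightarrow> cmod (H0 z l x - 1) \<le> C * \<bar>x\<bar>)"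
proof -
  define G where "G w = exp (z * Ln ((cos (of_real pi * w))\<^sup>2)) *
    (\<Sum>k = 0..l. cbinom (z + of_nat l) k * (((sin (of_real pi * w))\<^sup>2) ^ k * ((cos (of_real pi * w))\<^sup>2) ^ (l - k)))" for w :: complex
  let ?S = "(\<lambda>w::complex. (cos (of_real pi * w))\<^sup>2) -` (- \<real>\<^sub>\<le>\<^sub>0)"
  have "open ?S"
    by (intro open_vimage open_Compl closed_nonpos_Reals_complex continuous_intros)
  moreover have "G holomorphic_on ?S"
    unfolding G_def by (intro holomorphic_intros) auto
  moreover have "0 \<in> ?S" by simp
  ultimately obtain D where "(G has_field_derivative D) (at 0)"
    using holomorphic_on_imp_differentiable_at unfolding field_differentiable_def by blast
  then have "((\<lambda>w. (G w - G 0) / w) \<longlongrightarrow> D) (at 0)" by (simp add: has_field_derivative_iff)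
  then have "((\<lambda>w. cmod ((G w - G 0) / w)) \<longlongrightarrow> cmod D) (at 0)" by (rule tendsto_norm)
  then have "eventually (\<lambda>w. cmod ((G w - G 0) / w) < cmod D + 1) (at 0)"
    by (rule order_tendstoD(2)) simp
  then obtain d where d: "d > 0" "\<And>w. w \<noteq> 0 \<Longrightarrow> cmod w < d \<Longrightarrow> cmod ((G w - G 0) / w) < cmod D + 1"
    unfolding eventually_at by auto
  have G: "H0 z l x = G (of_real x)" if "\<bar>x\<bar> < 1/2" for x
  proof -
    have "\<bar>pi * x\<bar> < pi / 2" using that by (simp add: abs_mult)
    then have "0 < cos (pi * x)" by (intro cos_gt_zero_pi) linarith+
    then have "cos (pi * x) \<noteq> 0" by simp
    moreover have "cos (of_real pi * of_real x) = complex_of_real (cos (pi * x))"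
      "sin (of_real pi * of_real x) = complex_of_real (sin (pi * x))"
      by (simp_all add: cos_of_real sin_of_real flip: of_real_mult)
    ultimately show ?thesis by (simp add: H0_def G_def powr_def)
  qed
  show ?thesis
  proof (intro exI conjI allI impI)
    show "0 < min d (1/2)" using d(1) by simp
    fix x :: real assume x: "\<bar>x\<bar> < min d (1/2)"
    show "cmod (H0 z l x - 1) \<le> (cmod D + 1) * \<bar>x\<bar>"
    proof (cases "x = 0")
      case True
      then show ?thesis using H0_0[OF assms] by simp
    next
      case False
      have "G 0 = 1" using G[of 0] H0_0[OF assms] by simp
      then have "cmod ((H0 z l x - 1) / of_real x) < cmod D + 1"
        using d(2)[of "of_real x"] False x G[of x] by simp
      then show ?thesis using False by (simp add: norm_divide pos_divide_less_eq)
    qed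
  qed
qed

section \<open>Transfer from the transform side to the wavelets\<close>

lemma powr_half_int:
  "(2 powr (of_int j / 2)) * 2 powr (of_int j / 2) = (2 powr of_int j :: real)"
  "2 powr (of_int (- j) / 2) = (1 / 2 powr (of_int j / 2) :: real)"
proof -
  have "of_int (- j) / 2 = - (of_int j / 2 :: real)" by simp
  then show "2 powr (of_int (- j) / 2) = (1 / 2 powr (of_int j / 2) :: real)"
    by (simp only: powr_minus_divide)
qed (simp flip: powr_add)

text \<open>The adjoint of a unitary dilation is its inverse; the Jacobian \<open>2 powr j\<close>
  is shared between the two normalizing square roots.\<close>

lemma inner_on_dilate:
  assumes u: "sq_integrable lebesgue u" and w: "sq_integrable lebesgue w"
  shows "inner_on lebesgue (dilate j u) w = inner_on lebesgue u (dilate (- j) w)"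
proof -
  let ?a = "2 powr of_int j :: real"
  let ?f = "\<lambda>y. u y * cnj (dilate (- j) w y)"
  have "dilate j u x * cnj (w x) = of_real ?a * ?f (0 + ?a * x)" for x
  proof -
    have "2 powr of_int (- j) * (?a * x) = x" by (simp add: powr_minus)
    then have e: "dilate (- j) w (0 + ?a * x) = of_real (2 powr (of_int (- j) / 2)) * w x"
      by (simp only: dilate_def add_0)
    have h: "2 powr (of_int j / 2) = ?a * 2 powr (of_int (- j) / 2)"
      unfolding powr_half_int(2) powr_half_int(1)[of j, symmetric] by simp
    show ?thesis unfolding e unfolding dilate_def h by simp
  qed
  then have "inner_on lebesgue (dilate j u) w = of_real ?a * (LINT x|lebesgue. ?f (0 + ?a * x))"
    unfolding inner_on_def by (simp only: integral_mult_right_zero)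
  also have "(LINT x|lebesgue. ?f (0 + ?a * x)) = (1 / \<bar>?a\<bar>) *\<^sub>R (LINT y|lebesgue. ?f y)"
    using sq_integrable_measurable[OF u] sq_integrable_measurable[OF sq_integrable_dilate[OF w, of "- j"]]
    by (intro lebesgue_integral_affine) auto
  finally show ?thesis by (simp add: inner_on_def scaleR_conv_of_real)
qed

text \<open>The wavelet is \<open>2^(j/2) * f (2^j * x - k)\<close>, an affine substitution, so the
  translation turns into a modulation and the dilation into its inverse.\<close>

lemma has_fourier_L2_wavelet:
  assumes "has_fourier_L2 f g"
  shows "has_fourier_L2 (dilation_pow j (translation k f)) (dilate (- j) (\<lambda>x. g x * cnj (ee (of_int k * x))))"
proof -
  let ?a = "2 powr of_int j :: real"
  have 1: "has_fourier_L2 (\<lambda>x. of_real (2 powr (of_int j / 2)) * f (- of_int k + ?a * x))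
     (\<lambda>x. of_real (2 powr (of_int j / 2)) * (of_real (1 / ?a) * ee (- of_int k * x / ?a) * g (x / ?a)))"
    by (intro has_fourier_L2_scale has_fourier_L2_affine assms) simp
  have 2: "(\<lambda>x. of_real (2 powr (of_int j / 2)) * f (- of_int k + ?a * x)) = dilation_pow j (translation k f)"
    by (auto simp: dilation_pow_eq translation_def)
  have b: "2 powr (of_int j / 2) * (1 / ?a) = 2 powr (of_int (- j) / 2)"
    unfolding powr_half_int(2) powr_half_int(1)[of j, symmetric] by simp
  have "of_real (2 powr (of_int j / 2)) * (of_real (1 / ?a) * ee (- of_int k * x / ?a) * g (x / ?a))
     = dilate (- j) (\<lambda>x. g x * cnj (ee (of_int k * x))) x" for x
  proof -
    have c: "2 powr of_int (- j) * x = x / ?a" by (simp add: powr_minus_divide)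
    have d: "- of_int k * x / ?a = - (of_int k * (x / ?a))" by simp
    show ?thesis
      unfolding dilate_def c d b[symmetric] ee_minus by (simp only: of_real_mult mult_ac)
  qed
  with 1 show ?thesis unfolding 2 by simp
qed

text \<open>A transform determines its original only up to a null set, so the frame property is
  asserted for every choice of \<psi>; the existence clauses ensure that it is not vacuous, and the
  convergence clause that \<open>phi_hat\<close> is a genuine infinite product.\<close>

theorem proposition4p1:
  fixes z :: complex and l :: nat and \<sigma> :: "real \<Rightarrow> complex"
  assumes "Re z \<ge> 1"
    and "int l \<le> \<lfloor>Re z - 1/2\<rfloor>"
    and "\<sigma> \<in> borel_measurable lebesgue"
    and "\<And>\<gamma>. \<sigma> (\<gamma> + 1) = \<sigma> \<gamma>"
    and "\<And>\<gamma>. (cmod (\<sigma> \<gamma>))\<^sup>2 = eta z l \<gamma>"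
  shows "(\<forall>\<gamma>. convergent_prod (\<lambda>m. H0 z l (\<gamma> / 2 ^ Suc m)))
    \<and> (\<exists>\<phi>. has_fourier_L2 \<phi> (phi_hat z l))
    \<and> (\<forall>n\<in>{1..3}. \<exists>\<psi>. has_fourier_L2 \<psi> (psi_hat z l \<sigma> n))
    \<and> (\<forall>\<psi> :: nat \<Rightarrow> real \<Rightarrow> complex.
         (\<forall>n\<in>{1..3}. has_fourier_L2 (\<psi> n) (psi_hat z l \<sigma> n)) \<longrightarrow>
         parseval_frame ({1..3} \<times> UNIV \<times> UNIV)
           (\<lambda>(n, j, k). dilation_pow j (translation k (\<psi> n))))"
proof -
  have qmf: "(cmod (H0 z l x))\<^sup>2 + (cmod (H0 z l (x + 1/2)))\<^sup>2 \<le> 1" for x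
    using assms(5)[of x] zero_le_power2[of "cmod (\<sigma> x)"] by (simp add: eta_def)
  interpret lowpass "H0 z l"
    by unfold_locales (use H0_measurable H0_periodic qmf H0_near_0[OF assms(1)] in auto)
  have phi: "phi_hat z l = phi" by (auto simp: phi_hat_def phi_def)
  have H: "H z l \<sigma> 1 x = ee x * cnj (H0 z l (x + 1/2))" "H z l \<sigma> 2 x = of_real (1 / sqrt 2) * \<sigma> x"
    "H z l \<sigma> 3 x = of_real (1 / sqrt 2) * ee x * \<sigma> x" for x
    by (simp_all add: H_def ee_eq_exp)
  have N: "{1..3::nat} = {1, 2, 3}" by auto
  have shift: "ee (x + 1) = ee x" "ee (x + 1/2) = - ee x" for x
    using ee_of_int[of 1] by (simp_all add: ee_add ee_half)
  have per: "H0 z l (x + 1/2 + 1/2) = H0 z l x" for x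
    using H0_periodic[of z l x] by (simp add: add.assoc)
  have half: "of_real (1 / sqrt 2) * (of_real (1 / sqrt 2) :: complex) = 1 / 2"
    by (simp flip: of_real_mult)
  interpret uep "H0 z l" "{1..3::nat}" "H z l \<sigma>"
  proof
    fix n :: nat assume n: "n \<in> {1..3}"
    have "(\<lambda>x. ee x * cnj (H0 z l (x + 1/2))) \<in> borel_measurable borel" by measurable
    then have "(\<lambda>x. ee x * cnj (H0 z l (x + 1/2))) \<in> borel_measurable lebesgue"
      by (intro measurable_completion) simp
    then have "H z l \<sigma> 1 \<in> borel_measurable lebesgue" "H z l \<sigma> 2 \<in> borel_measurable lebesgue"
      "H z l \<sigma> 3 \<in> borel_measurable lebesgue"
      unfolding H[abs_def] using assms(3) by measurable
    with n show "H z l \<sigma> n \<in> borel_measurable lebesgue" unfolding N by blast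
    have "H z l \<sigma> 1 (x + 1) = H z l \<sigma> 1 x" "H z l \<sigma> 2 (x + 1) = H z l \<sigma> 2 x" "H z l \<sigma> 3 (x + 1) = H z l \<sigma> 3 x" for x
    proof -
      have "x + 1 + 1/2 = x + 1/2 + 1" by simp
      then show "H z l \<sigma> 1 (x + 1) = H z l \<sigma> 1 x" "H z l \<sigma> 2 (x + 1) = H z l \<sigma> 2 x" "H z l \<sigma> 3 (x + 1) = H z l \<sigma> 3 x"
        by (simp_all only: H shift assms(4) H0_periodic)
    qed
    with n show "H z l \<sigma> n (x + 1) = H z l \<sigma> n x" for x unfolding N by blast
  next
    fix x
    show "(cmod (H0 z l x))\<^sup>2 + (\<Sum>n\<in>{1..3}. (cmod (H z l \<sigma> n x))\<^sup>2) = 1"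
      unfolding N using assms(5)[of x]
      by (simp add: H norm_mult norm_divide power_mult_distrib power_divide eta_def del: One_nat_def)
    \<comment> \<open>The half-shift changes the sign of \<open>ee x\<close>: the first filter
      cancels the cross term of \<open>H0\<close>, and the third cancels that of the second.\<close>
    have "H z l \<sigma> 1 x * cnj (H z l \<sigma> 1 (x + 1/2)) = - (H0 z l x * cnj (H0 z l (x + 1/2)))"
      unfolding H per shift using ee_mult_cnj(1)[of x] by (simp add: mult_ac)
    moreover have "H z l \<sigma> 2 x * cnj (H z l \<sigma> 2 (x + 1/2)) = (of_real (1 / sqrt 2) * of_real (1 / sqrt 2)) * (\<sigma> x * cnj (\<sigma> (x + 1/2)))"
      unfolding H by simp
    moreover have "H z l \<sigma> 3 x * cnj (H z l \<sigma> 3 (x + 1/2)) = - (of_real (1 / sqrt 2) * of_real (1 / sqrt 2)) * (\<sigma> x * cnj (\<sigma> (x + 1/2))) * (ee x * cnj (ee x))"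
      unfolding H shift by simp
    ultimately show "H0 z l x * cnj (H0 z l (x + 1/2)) + (\<Sum>n\<in>{1..3}. H z l \<sigma> n x * cnj (H z l \<sigma> n (x + 1/2))) = 0"
      unfolding N by (simp del: One_nat_def)
  qed simp
  have psi: "psi_hat z l \<sigma> n = psi n" for n
    by (auto simp: psi_hat_def psi_def filt_def phi)
  have frame: "parseval_frame ({1..3} \<times> UNIV \<times> UNIV) (\<lambda>(n, j, k). dilation_pow j (translation k (\<psi> n)))"
    if \<psi>: "\<forall>n\<in>{1..3}. has_fourier_L2 (\<psi> n) (psi_hat z l \<sigma> n)" for \<psi>
    unfolding parseval_frame_def L2_sq_integrable
  proof (intro conjI ballI)
    note w = has_fourier_L2_wavelet[OF \<psi>[rule_format, unfolded psi]]
    show "sq_integrable lebesgue (case i of (n, j, k) \<Rightarrow> dilation_pow j (translation k (\<psi> n)))"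
      if i: "i \<in> {1..3} \<times> UNIV \<times> UNIV" for i
    proof -
      obtain n j k where "i = (n, j, k)" "n \<in> {1..3}" using i by blast
      then show ?thesis using has_fourier_L2_sq_integrable(1)[OF w] by simp
    qed
    fix f assume "f \<in> L2"
    then have f: "sq_integrable lebesgue f" by (simp add: L2_sq_integrable)
    obtain g where g: "has_fourier_L2 f g" using has_fourier_L2_exists[OF f] .
    note gs = has_fourier_L2_sq_integrable(2)[OF g]
    \<comment> \<open>Plancherel moves the coefficient to the transform side, and the adjoint then
      shifts the dilation from the wavelet onto \<open>g\<close>, which is the form summed by
      \<open>uep_has_sum\<close>.\<close>
    have inner_on: "L2_inner f (dilation_pow j (translation k (\<psi> n)))
        = inner_on lebesgue (dilate j g) (\<lambda>x. psi n x * cnj (ee (of_int k * x)))" if n: "n \<in> {1..3}" for n j k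
    proof -
      have s: "sq_integrable lebesgue (\<lambda>x. psi n x * cnj (ee (of_int k * x)))"
      proof -
        note p = bracket.p_sq_integrable[OF psi_bracket[OF n]]
        note [measurable] = sq_integrable_measurable[OF p]
        show ?thesis by (rule sq_integrable_bound[OF p, of _ 1]) (auto simp: norm_mult)
      qed
      have "L2_inner f (dilation_pow j (translation k (\<psi> n))) = inner_on lebesgue f (dilation_pow j (translation k (\<psi> n)))"
        by (simp add: L2_inner_def inner_on_def)
      also have "\<dots> = inner_on lebesgue g (dilate (- j) (\<lambda>x. psi n x * cnj (ee (of_int k * x))))"
        by (rule has_fourier_L2_inner_on[OF g w[OF n], symmetric])
      also have "\<dots> = inner_on lebesgue (dilate j g) (\<lambda>x. psi n x * cnj (ee (of_int k * x)))"
        by (rule inner_on_dilate[OF gs s, symmetric])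
      finally show ?thesis .
    qed
    have "(L2_norm f)\<^sup>2 = sq_norm lebesgue g"
      unfolding has_fourier_L2_sq_norm[OF g] by (simp add: L2_norm_def sq_norm_def)
    with uep_has_sum[OF gs]
    show "((\<lambda>i. (cmod (L2_inner f (case i of (n, j, k) \<Rightarrow> dilation_pow j (translation k (\<psi> n)))))\<^sup>2) has_sum (L2_norm f)\<^sup>2) ({1..3} \<times> UNIV \<times> UNIV)"
      by (subst has_sum_cong[where g = "\<lambda>(n, j, k). (cmod (inner_on lebesgue (dilate j g) (\<lambda>x. psi n x * cnj (ee (of_int k * x)))))\<^sup>2"])
        (auto simp: inner_on)
  qed
  have "\<exists>\<phi>. has_fourier_L2 \<phi> (phi_hat z l)"
    unfolding phi using has_fourier_L2_surj[OF phi_sq_integrable] by blast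
  moreover have "\<exists>\<psi>. has_fourier_L2 \<psi> (psi_hat z l \<sigma> n)" if "n \<in> {1..3}" for n
    unfolding psi using has_fourier_L2_surj[OF bracket.p_sq_integrable[OF psi_bracket[OF that]]] by blast
  ultimately show ?thesis using phi_convergent frame by blast
qed

end
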